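(* Let $k,\ell\ge 0$ be integers with $k+\ell\ge 2$, let $\xi$ be a variational $k$-vector and $\eta$ a variational $\ell$-vector, and let $p\in\overline{J^\infty_\pi}(\widehat\pi)$ (so that $p_{\alpha,\sigma}$ are even jet variables, independent of the $q^\beta_\tau$). Then the variational Schouten bracket satisfies $$\llbracket \xi,\eta\rrbracket(p)=\frac{\ell}{k+\ell-1}\,\llbracket \xi,\eta(p)\rrbracket+(-1)^{\ell-1}\frac{k}{k+\ell-1}\,\llbracket \xi(p),\eta\rrbracket ,$$ where a term with numerical coefficient $0$ is read as $0$.
   Context: Setting. $\pi\colon E\to M$ is a vector bundle of rank $m$ over a smooth oriented $n$-dimensional manifold $M$; $x^i$ are coordinates on $M$, $q^\alpha$ fibre coordinates, and $J^\infty(\pi)$ is the infinite jet space with coordinates $x^i,q^\alpha_\sigma$ ($\sigma$ a multi-index); $\mathcal F(\pi)$ is the ring of smooth functions on $J^\infty(\pi)$. Let $\widehat\pi\colon E^*\otimes\Lambda^n(M)\to M$. The horizontal jet bundle $\overline{J^\infty_\pi}(\widehat\pi)$ over $J^\infty(\pi)$ has coordinates $x^i,q^\alpha_\sigma,p_{\alpha,\sigma}$; here $p_{\alpha,\sigma}$ are fibre coordinates with $\partial p_{\beta,\tau}/\partial q^\alpha_\sigma=0$. Reversing the parity of its fibres gives $\overline{J^\infty_\pi}(\Pi\widehat\pi)$ with coordinates $x^i,q^\alpha_\sigma,b_{\alpha,\sigma}$, where the $b_{\alpha,\sigma}$ are odd (anticommuting). The total derivatives $D_i$ satisfy $D_i=\partial/\partial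 x^i+\sum q^\alpha_{\sigma+1_i}\partial/\partial q^\alpha_\sigma+\sum b_{\alpha,\sigma+1_i}\partial/\partial b_{\alpha,\sigma}$ (and likewise $D_i p_{\alpha,\sigma}=p_{\alpha,\sigma+1_i}$ when variables $p$ are present); $D_\sigma$ is the corresponding composition. Variational multivectors. A variational $k$-vector ($k\ge 0$) is a class $\xi=\int f\,\mathrm{dVol}$ of top-degree horizontal forms modulo horizontally exact ones (i.e. modulo total divergences $\sum_i D_i(g^i)$) having a density $f$ that is a homogeneous polynomial of degree $k$ in the $b_{\alpha,\sigma}$, with coefficients in $\mathcal F(\pi)$ (and possibly depending on additional inserted even jet variables $p_{\alpha,\sigma}$). Its degree is $k$. Variational derivatives. For a density $f$, $\delta f/\delta q^\alpha=\sum_\sigma(-1)^{|\sigma|}D_\sigma(\partial f/\partial q^\alpha_\sigma)$, and similarly for $b_\alpha$. Arrows indicate the direction in which the variation is transported: $\overleftarrow{\delta f}/\delta b_\alpha$ is obtained by moving $\delta b_\alpha$ to the far left ($\delta_b f=\sum_\alpha\delta b_\alpha\,\overleftarrow{\delta f}/\delta b_\alpha$ modulo total divergences), and $\overrightarrow{\delta f}/\delta b_\alpha$ by moving it to the far right; for the even $q^\alpha$ both arrows give the same result. These do not depend on the choice of density. Schouten bracket. For a $k$-vector $\xi$ and an $\ell$-vector $\eta$, the bracket is the $(k+\ell-1)$-vector $$\llbracket\xi,\eta\rrbracket=\int\sum_\alpha\left[\frac{\overrightarrow{\delta\xi}}{\delta q^\alpha}\frac{\overleftarrow{\delta\eta}}{\delta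 b_\alpha}-\frac{\overrightarrow{\delta\xi}}{\delta b_\alpha}\frac{\overleftarrow{\delta\eta}}{\delta q^\alpha}\right],$$ (variational derivatives being taken of the densities, and the result multiplied by $\mathrm{dVol}$). Insertion. For a $k$-vector $\xi$ ($k\ge1$), $\xi(p)=\iota_p(\xi)$ is the $(k-1)$-vector $$\xi(p)(b)=\xi(b,\dots,b,p)=\frac1k\sum_{j=1}^k(-1)^{k-j}\,\xi(b,\dots,b,p,b,\dots,b)\quad(p\text{ in the }j\text{-th slot}),$$ meaning that in each monomial of the density the $j$-th factor $b_{\alpha,\sigma}$ from the left is replaced by the even $p_{\alpha,\sigma}$. *)

theory Defs
  imports "HOL-Analysis.Analysis" "HOL-Library.Groups_Big_Fun"
begin

section \<open>Smooth functions of indexed coordinates\<close>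

text \<open>Coordinate spaces are function types \<open>'v \<Rightarrow> real\<close> with the product topology. For finite \<open>'v\<close>
  this is Euclidean space; the infinite jet space uses an infinite \<open>'v\<close>.\<close>

definition pder :: "'v \<Rightarrow> (('v \<Rightarrow> real) \<Rightarrow> real) \<Rightarrow> ('v \<Rightarrow> real) \<Rightarrow> real" where
  "pder v F z = deriv (\<lambda>t. F (z(v := t))) (z v)"

text \<open>All iterated partial derivatives exist and are continuous on the (open) set \<open>D\<close>. Over
  infinitely many coordinates this is only used together with dependence on finitely many of them.\<close>

definition smooth_fun :: "('v \<Rightarrow> real) set \<Rightarrow> (('v \<Rightarrow> real) \<Rightarrow> real) \<Rightarrow> bool" where
  "smooth_fun D F \<longleftrightarrow>
     (\<forall>vs. continuous_on D (foldr pder vs F) \<and>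
           (\<forall>z\<in>D. \<forall>v. (\<lambda>t. foldr pder vs F (z(v := t))) differentiable (at (z v))))"

text \<open>A multi-index is a function \<open>\<sigma> :: 'n \<Rightarrow> nat\<close>. The composition \<open>op_power Op \<sigma>\<close> is taken in an arbitrary
  fixed order of the indices; the operators it is applied to commute on smooth functions.\<close>

definition msize :: "('n::finite \<Rightarrow> nat) \<Rightarrow> nat" where
  "msize \<sigma> = (\<Sum>i\<in>UNIV. \<sigma> i)"

definition bump :: "'n \<Rightarrow> ('n \<Rightarrow> nat) \<Rightarrow> ('n \<Rightarrow> nat)" where
  "bump i \<sigma> = \<sigma>(i := Suc (\<sigma> i))"

definition index_list :: "'n::finite list" where
  "index_list = (SOME is. distinct is \<and> set is = UNIV)"

definition op_power :: "('n::finite \<Rightarrow> 'f \<Rightarrow> 'f) \<Rightarrow> ('n \<Rightarrow> nat) \<Rightarrow> 'f \<Rightarrow> 'f" where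
  "op_power Op \<sigma> F = foldr (\<lambda>i. Op i ^^ \<sigma> i) index_list F"


section \<open>Oriented vector bundles\<close>

text \<open>An adapted chart consists of an open set of the base, coordinates on it, and linear fibre
  coordinates on the part of the total space above it.\<close>

record ('a, 'e, 'n, 'm) adapted_chart =
  cdom :: "'a set"
  cbase :: "'a \<Rightarrow> 'n \<Rightarrow> real"
  cfib :: "'e \<Rightarrow> 'm \<Rightarrow> real"

record ('a, 'e, 'n, 'm) vbundle =
  base_space :: "'a topology"
  total_space :: "'e topology"
  proj :: "'e \<Rightarrow> 'a"
  charts :: "('a, 'e, 'n, 'm) adapted_chart set"

definition over :: "('a, 'e, 'n, 'm) vbundle \<Rightarrow> ('a, 'e, 'n, 'm) adapted_chart \<Rightarrow> 'e set" where
  "over B c = {e \<in> topspace (total_space B). proj B e \<in> cdom c}"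

definition triv :: "('a, 'e, 'n, 'm) vbundle \<Rightarrow> ('a, 'e, 'n, 'm) adapted_chart
    \<Rightarrow> 'e \<Rightarrow> ('n \<Rightarrow> real) \<times> ('m \<Rightarrow> real)" where
  "triv B c e = (cbase c (proj B e), cfib c e)"

definition overlap :: "('a, 'e, 'n, 'm) adapted_chart \<Rightarrow> ('a, 'e, 'n, 'm) adapted_chart
    \<Rightarrow> ('n \<Rightarrow> real) set" where
  "overlap c d = cbase c ` (cdom c \<inter> cdom d)"

definition base_trans :: "('a, 'e, 'n, 'm) adapted_chart \<Rightarrow> ('a, 'e, 'n, 'm) adapted_chart
    \<Rightarrow> ('n \<Rightarrow> real) \<Rightarrow> ('n \<Rightarrow> real)" where
  "base_trans c d x = cbase d (inv_into (cdom c) (cbase c) x)"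

definition jacobian :: "('a, 'e, 'n::finite, 'm) adapted_chart \<Rightarrow> ('a, 'e, 'n, 'm) adapted_chart
    \<Rightarrow> ('n \<Rightarrow> real) \<Rightarrow> real^'n^'n" where
  "jacobian c d x = (\<chi> j i. pder i (\<lambda>y. base_trans c d y j) x)"

text \<open>The matrix of the change of fibre coordinates; column \<open>b\<close> is the image of the \<open>b\<close>-th basis vector.\<close>

definition fib_trans :: "('a, 'e, 'n, 'm::finite) vbundle \<Rightarrow> ('a, 'e, 'n, 'm) adapted_chart
    \<Rightarrow> ('a, 'e, 'n, 'm) adapted_chart \<Rightarrow> ('n \<Rightarrow> real) \<Rightarrow> real^'m^'m" where
  "fib_trans B c d x = (\<chi> a b. cfib d (inv_into (over B c) (triv B c) (x, \<lambda>b'. of_bool (b' = b))) a)"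

text \<open>A smooth vector bundle of rank \<open>CARD('m)\<close> over a smooth oriented manifold of dimension
  \<open>CARD('n)\<close>, given by an oriented atlas of adapted charts.\<close>

definition oriented_vector_bundle :: "('a, 'e, 'n::finite, 'm::finite) vbundle \<Rightarrow> bool" where
  "oriented_vector_bundle B \<longleftrightarrow>
     Hausdorff_space (base_space B) \<and> second_countable (base_space B) \<and>
     continuous_map (total_space B) (base_space B) (proj B) \<and>
     (\<Union>c\<in>charts B. cdom c) = topspace (base_space B) \<and>
     (\<forall>c\<in>charts B.
        openin (base_space B) (cdom c) \<and>
        open (cbase c ` cdom c) \<and>
        homeomorphic_map (subtopology (base_space B) (cdom c)) (top_of_set (cbase c ` cdom c)) (cbase c) \<and>
        homeomorphic_map (subtopology (total_space B) (over B c))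
          (top_of_set ((cbase c ` cdom c) \<times> UNIV)) (triv B c)) \<and>
     (\<forall>c\<in>charts B. \<forall>d\<in>charts B.
        (\<forall>j. smooth_fun (overlap c d) (\<lambda>x. base_trans c d x j)) \<and>
        (\<forall>x\<in>overlap c d. det (jacobian c d x) > 0) \<and>
        (\<forall>a b. smooth_fun (overlap c d) (\<lambda>x. fib_trans B c d x $ a $ b)) \<and>
        (\<forall>e\<in>over B c \<inter> over B d. \<forall>a.
           cfib d e a = (\<Sum>b\<in>UNIV. fib_trans B c d (cbase c (proj B e)) $ a $ b * cfib c e b)))"


section \<open>Functions and odd polynomials on the jet space\<close>

text \<open>The even coordinates in a chart: \<open>Xv i\<close> is \<open>x\<^sup>i\<close>, \<open>Qv a \<sigma>\<close> is the jet coordinate of \<open>q\<^sup>a\<close>, and \<open>Pv s a \<sigma>\<close> is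
  the jet coordinate of the \<open>s\<close>-th inserted even variable \<open>p\<close>. Several \<open>p\<close> are provided, since densities
  may already depend on previously inserted ones. The odd coordinate with indices \<open>a, \<sigma>\<close> is the pair \<open>(a, \<sigma>)\<close>.\<close>

datatype ('n, 'm) evar = Xv 'n | Qv 'm "'n \<Rightarrow> nat" | Pv nat 'm "'n \<Rightarrow> nat"

type_synonym ('n, 'm) jet = "('n, 'm) evar \<Rightarrow> real"
type_synonym ('n, 'm) ovar = "'m \<times> ('n \<Rightarrow> nat)"

text \<open>A polynomial in the odd coordinates is written as a combination of words in them: \<open>f w z\<close> is the
  coefficient, at the jet \<open>z\<close>, of the monomial whose factors from left to right are the letters of \<open>w\<close>.
  The anticommutation relations are imposed below by \<open>anticomm_null\<close>; until then words are kept as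
  they stand.\<close>

type_synonym ('n, 'm) density = "('n, 'm) ovar list \<Rightarrow> ('n, 'm) jet \<Rightarrow> real"
type_synonym ('a, 'e, 'n, 'm) densities = "('a, 'e, 'n, 'm) adapted_chart \<Rightarrow> ('n, 'm) density"

definition jet_dom :: "('a, 'e, 'n, 'm) adapted_chart \<Rightarrow> ('n, 'm) jet set" where
  "jet_dom c = {z. (\<lambda>i. z (Xv i)) \<in> cbase c ` cdom c}"

definition jet_vars :: "nat \<Rightarrow> ('n::finite, 'm) evar set" where
  "jet_vars r = range Xv \<union> {Qv a \<sigma> | a \<sigma>. msize \<sigma> \<le> r} \<union> {Pv s a \<sigma> | s a \<sigma>. s \<le> r \<and> msize \<sigma> \<le> r}"

text \<open>Smooth functions on the infinite jet space are smooth functions on some finite jet space.\<close>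

definition jet_fun :: "('n::finite, 'm) jet set \<Rightarrow> nat \<Rightarrow> (('n, 'm) jet \<Rightarrow> real) \<Rightarrow> bool" where
  "jet_fun D r F \<longleftrightarrow>
     smooth_fun D F \<and> (\<forall>z\<in>D. \<forall>z'\<in>D. (\<forall>v\<in>jet_vars r. z v = z' v) \<longrightarrow> F z = F z')"

definition finite_order :: "('a, 'e, 'n::finite, 'm) vbundle \<Rightarrow> ('a, 'e, 'n, 'm) densities \<Rightarrow> bool" where
  "finite_order B f \<longleftrightarrow>
     (\<exists>r. \<forall>c\<in>charts B. \<forall>w. jet_fun (jet_dom c) r (f c w) \<and>
        (length w > r \<or> (\<exists>g\<in>set w. msize (snd g) > r) \<longrightarrow> (\<forall>z\<in>jet_dom c. f c w z = 0)))"

definition homogeneous :: "('a, 'e, 'n, 'm) vbundle \<Rightarrow> nat \<Rightarrow> ('a, 'e, 'n, 'm) densities \<Rightarrow> bool" where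
  "homogeneous B k f \<longleftrightarrow>
     (\<forall>c\<in>charts B. \<forall>w. \<forall>z\<in>jet_dom c. length w \<noteq> k \<longrightarrow> f c w z = 0)"

text \<open>The two-sided ideal generated by the elements \<open>g h + h g\<close> for odd coordinates \<open>g, h\<close>.\<close>

inductive anticomm_null :: "('n::finite, 'm) jet set \<Rightarrow> ('n, 'm) density \<Rightarrow> bool" for D where
  zero: "(\<And>w z. z \<in> D \<Longrightarrow> f w z = 0) \<Longrightarrow> anticomm_null D f"
| step: "anticomm_null D f \<Longrightarrow> jet_fun D r C \<Longrightarrow>
    (\<And>w z. z \<in> D \<Longrightarrow>
       f' w z = f w z + C z * (of_bool (w = u @ [g, h] @ v) + of_bool (w = u @ [h, g] @ v))) \<Longrightarrow>
    anticomm_null D f'"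

definition mult :: "('n, 'm) density \<Rightarrow> ('n, 'm) density \<Rightarrow> ('n, 'm) density" where
  "mult f g w z = (\<Sum>i\<le>length w. f (take i w) z * g (drop i w) z)"


section \<open>Total and variational derivatives, bracket and insertion of densities\<close>

definition del :: "nat \<Rightarrow> 'b list \<Rightarrow> 'b list" where
  "del j w = take j w @ drop (Suc j) w"

text \<open>The value of \<open>D\<^sub>i\<close> on an even coordinate.\<close>

fun total_coord :: "'n \<Rightarrow> ('n, 'm) evar \<Rightarrow> ('n, 'm) jet \<Rightarrow> real" where
  "total_coord i (Xv j) z = of_bool (j = i)"
| "total_coord i (Qv a \<sigma>) z = z (Qv a (bump i \<sigma>))"
| "total_coord i (Pv s a \<sigma>) z = z (Pv s a (bump i \<sigma>))"

text \<open>\<open>Sum_any\<close> is the sum over all finitely many arguments with nonzero summand. The sums over words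
  \<open>w'\<close> below extend linearly a map given on monomials: the inner sum is the coefficient of \<open>w\<close> in the
  image of the monomial \<open>w'\<close>.\<close>

definition total_der :: "'n \<Rightarrow> ('n, 'm) density \<Rightarrow> ('n, 'm) density" where
  "total_der i f w z =
     Sum_any (\<lambda>v. total_coord i v z * pder v (f w) z) +
     Sum_any (\<lambda>w'. (\<Sum>j<length w'. of_bool (w = w'[j := map_prod id (bump i) (w' ! j)])) * f w' z)"

definition odd_der_left :: "('n, 'm) ovar \<Rightarrow> ('n, 'm) density \<Rightarrow> ('n, 'm) density" where
  "odd_der_left g f w z =
     Sum_any (\<lambda>w'. (\<Sum>j<length w'. of_bool (w' ! j = g \<and> w = del j w') * (-1) ^ j) * f w' z)"

definition odd_der_right :: "('n, 'm) ovar \<Rightarrow> ('n, 'm) density \<Rightarrow> ('n, 'm) density" where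
  "odd_der_right g f w z =
     Sum_any (\<lambda>w'. (\<Sum>j<length w'. of_bool (w' ! j = g \<and> w = del j w') * (-1) ^ (length w' - Suc j)) * f w' z)"

definition euler_sum :: "(('n::finite \<Rightarrow> nat) \<Rightarrow> ('n, 'm) density) \<Rightarrow> ('n, 'm) density" where
  "euler_sum F w z = Sum_any (\<lambda>\<sigma>. (-1) ^ msize \<sigma> * op_power total_der \<sigma> (F \<sigma>) w z)"

definition var_q :: "'m \<Rightarrow> ('n::finite, 'm) density \<Rightarrow> ('n, 'm) density" where
  "var_q a f = euler_sum (\<lambda>\<sigma> w. pder (Qv a \<sigma>) (f w))"

definition var_b_left :: "'m \<Rightarrow> ('n::finite, 'm) density \<Rightarrow> ('n, 'm) density" where
  "var_b_left a f = euler_sum (\<lambda>\<sigma>. odd_der_left (a, \<sigma>) f)"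

definition var_b_right :: "'m \<Rightarrow> ('n::finite, 'm) density \<Rightarrow> ('n, 'm) density" where
  "var_b_right a f = euler_sum (\<lambda>\<sigma>. odd_der_right (a, \<sigma>) f)"

definition bracket_density :: "('n::finite, 'm::finite) density \<Rightarrow> ('n, 'm) density \<Rightarrow> ('n, 'm) density" where
  "bracket_density f g w z =
     (\<Sum>a\<in>UNIV. mult (var_q a f) (var_b_left a g) w z - mult (var_b_right a f) (var_q a g) w z)"

text \<open>Insertion of the \<open>s\<close>-th even variable; it sends a monomial of degree \<open>0\<close> to \<open>0\<close>. Positions \<open>j\<close> count from \<open>0\<close>.\<close>

definition insert_density :: "nat \<Rightarrow> ('n, 'm) density \<Rightarrow> ('n, 'm) density" where
  "insert_density s f w z =
     Sum_any (\<lambda>w'. (1 / real (length w')) *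
       (\<Sum>j<length w'. of_bool (w = del j w') * (-1) ^ (length w' - Suc j)
          * z (Pv s (fst (w' ! j)) (snd (w' ! j)))) * f w' z)"


section \<open>Global densities and horizontal forms\<close>

text \<open>In a chart, the horizontal \<open>n\<close>-form with density \<open>f\<close> is \<open>f dx\<^sup>1 \<and> \<dots> \<and> dx\<^sup>n\<close>, and the horizontal
  \<open>(n - 1)\<close>-form with components \<open>g i\<close> is \<open>\<Sum>\<^sub>i g i \<iota>(\<partial>/\<partial>x\<^sup>i) (dx\<^sup>1 \<and> \<dots> \<and> dx\<^sup>n)\<close>, whose horizontal differential
  has density \<open>\<Sum>\<^sub>i D\<^sub>i (g i)\<close>. That local expressions in different charts define the same form is
  tested on sections: \<open>q\<close> on sections of \<open>E\<close>, and \<open>p, b\<close> on sections of \<open>E\<^sup>* \<otimes> \<Lambda>\<^sup>n(M)\<close>.\<close>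

definition related_field :: "('a, 'e, 'n::finite, 'm::finite) vbundle \<Rightarrow> ('a, 'e, 'n, 'm) adapted_chart
    \<Rightarrow> ('a, 'e, 'n, 'm) adapted_chart \<Rightarrow> (('n \<Rightarrow> real) \<Rightarrow> 'm \<Rightarrow> real) \<Rightarrow> (('n \<Rightarrow> real) \<Rightarrow> 'm \<Rightarrow> real) \<Rightarrow> bool" where
  "related_field B c d u u' \<longleftrightarrow>
     (\<forall>a. smooth_fun (overlap c d) (\<lambda>x. u x a)) \<and> (\<forall>a. smooth_fun (overlap d c) (\<lambda>x. u' x a)) \<and>
     (\<forall>x\<in>overlap c d. \<forall>a. u' (base_trans c d x) a = (\<Sum>b\<in>UNIV. fib_trans B c d x $ a $ b * u x b))"

text \<open>Here \<open>v, v'\<close> are the components of one section with respect to the dual frame of \<open>E\<^sup>*\<close> tensored with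
  the coordinate volume form, so that \<open>(\<Sum>\<^sub>b v\<^sub>b q\<^sup>b) dx\<close> is independent of the chart.\<close>

definition related_dual :: "('a, 'e, 'n::finite, 'm::finite) vbundle \<Rightarrow> ('a, 'e, 'n, 'm) adapted_chart
    \<Rightarrow> ('a, 'e, 'n, 'm) adapted_chart \<Rightarrow> (('n \<Rightarrow> real) \<Rightarrow> 'm \<Rightarrow> real) \<Rightarrow> (('n \<Rightarrow> real) \<Rightarrow> 'm \<Rightarrow> real) \<Rightarrow> bool" where
  "related_dual B c d v v' \<longleftrightarrow>
     (\<forall>a. smooth_fun (overlap c d) (\<lambda>x. v x a)) \<and> (\<forall>a. smooth_fun (overlap d c) (\<lambda>x. v' x a)) \<and>
     (\<forall>x\<in>overlap c d. \<forall>b.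
        v x b = det (jacobian c d x) * (\<Sum>a\<in>UNIV. fib_trans B c d x $ a $ b * v' (base_trans c d x) a))"

definition even_jet :: "('n::finite \<Rightarrow> real) \<Rightarrow> (('n \<Rightarrow> real) \<Rightarrow> 'm \<Rightarrow> real)
    \<Rightarrow> (nat \<Rightarrow> ('n \<Rightarrow> real) \<Rightarrow> 'm \<Rightarrow> real) \<Rightarrow> ('n, 'm) jet" where
  "even_jet x u \<rho> v = (case v of
       Xv i \<Rightarrow> x i
     | Qv a \<sigma> \<Rightarrow> op_power pder \<sigma> (\<lambda>y. u y a) x
     | Pv s a \<sigma> \<Rightarrow> op_power pder \<sigma> (\<lambda>y. \<rho> s y a) x)"

definition odd_jet :: "('n::finite \<Rightarrow> real) \<Rightarrow> (('n \<Rightarrow> real) \<Rightarrow> 'm \<Rightarrow> real) \<Rightarrow> ('n, 'm) ovar \<Rightarrow> real" where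
  "odd_jet x v g = op_power pder (snd g) (\<lambda>y. v y (fst g)) x"

definition same_jets :: "('a, 'e, 'n::finite, 'm::finite) vbundle \<Rightarrow> ('a, 'e, 'n, 'm) adapted_chart
    \<Rightarrow> ('a, 'e, 'n, 'm) adapted_chart
    \<Rightarrow> (('n \<Rightarrow> real) \<times> ('n, 'm) jet \<times> (('n, 'm) ovar \<Rightarrow> real) list
          \<times> ('n, 'm) jet \<times> (('n, 'm) ovar \<Rightarrow> real) list) set" where
  "same_jets B c d =
     {(x, even_jet x u \<rho>, map (odd_jet x) vs,
          even_jet (base_trans c d x) u' \<rho>', map (odd_jet (base_trans c d x)) vs')
      | x u \<rho> vs u' \<rho>' vs'.
        x \<in> overlap c d \<and> related_field B c d u u' \<and> (\<forall>s. related_dual B c d (\<rho> s) (\<rho>' s)) \<and>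
        list_all2 (related_dual B c d) vs vs'}"

text \<open>The value of a monomial on a list of even covectors as an alternating form. It is the determinant
  of the matrix of the values \<open>\<beta> (w ! j)\<close>, up to a sign depending only on the degree, expanded
  along the first covector.\<close>

primrec alt_value :: "('g \<Rightarrow> real) list \<Rightarrow> 'g list \<Rightarrow> real" where
  "alt_value [] w = of_bool (w = [])"
| "alt_value (\<beta> # \<beta>s) w =
     (\<Sum>j<length w. (-1) ^ (length w - Suc j) * \<beta> (w ! j) * alt_value \<beta>s (del j w))"

definition density_value :: "('n, 'm) density \<Rightarrow> ('n, 'm) jet \<Rightarrow> (('n, 'm) ovar \<Rightarrow> real) list \<Rightarrow> real" where
  "density_value f z \<beta>s = Sum_any (\<lambda>w. f w z * alt_value \<beta>s w)"

definition global_top_form :: "('a, 'e, 'n::finite, 'm::finite) vbundle \<Rightarrow> ('a, 'e, 'n, 'm) densities \<Rightarrow> bool" where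
  "global_top_form B f \<longleftrightarrow>
     finite_order B f \<and>
     (\<forall>c\<in>charts B. \<forall>d\<in>charts B. \<forall>(x, z, \<beta>s, z', \<beta>s')\<in>same_jets B c d.
        density_value (f c) z \<beta>s = det (jacobian c d x) * density_value (f d) z' \<beta>s')"

definition global_subtop_form :: "('a, 'e, 'n::finite, 'm::finite) vbundle
    \<Rightarrow> ('n \<Rightarrow> ('a, 'e, 'n, 'm) densities) \<Rightarrow> bool" where
  "global_subtop_form B g \<longleftrightarrow>
     (\<forall>i. finite_order B (g i)) \<and>
     (\<forall>c\<in>charts B. \<forall>d\<in>charts B. \<forall>(x, z, \<beta>s, z', \<beta>s')\<in>same_jets B c d. \<forall>j.
        (\<Sum>i\<in>UNIV. jacobian c d x $ j $ i * density_value (g i c) z \<beta>s) =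
        det (jacobian c d x) * density_value (g j d) z' \<beta>s')"

definition horizontally_exact :: "('a, 'e, 'n::finite, 'm::finite) vbundle
    \<Rightarrow> ('a, 'e, 'n, 'm) densities \<Rightarrow> bool" where
  "horizontally_exact B h \<longleftrightarrow>
     (\<exists>g. global_subtop_form B g \<and>
        (\<forall>c\<in>charts B. anticomm_null (jet_dom c)
           (\<lambda>w z. h c w z - (\<Sum>i\<in>UNIV. total_der i (g i c) w z))))"


section \<open>Variational multivectors\<close>

text \<open>The class of \<open>f\<close> modulo anticommutation of the odd coordinates and globally horizontally exact forms.\<close>

definition var_class :: "('a, 'e, 'n::finite, 'm::finite) vbundle \<Rightarrow> ('a, 'e, 'n, 'm) densities
    \<Rightarrow> ('a, 'e, 'n, 'm) densities set" where
  "var_class B f =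
     {f'. finite_order B f' \<and> horizontally_exact B (\<lambda>c w z. f' c w z - f c w z)}"

definition multivectors :: "('a, 'e, 'n::finite, 'm::finite) vbundle \<Rightarrow> nat
    \<Rightarrow> ('a, 'e, 'n, 'm) densities set set" where
  "multivectors B k = {var_class B f | f. global_top_form B f \<and> homogeneous B k f}"

definition var_plus :: "('a, 'e, 'n::finite, 'm::finite) vbundle \<Rightarrow> ('a, 'e, 'n, 'm) densities set
    \<Rightarrow> ('a, 'e, 'n, 'm) densities set \<Rightarrow> ('a, 'e, 'n, 'm) densities set" where
  "var_plus B \<xi> \<eta> = (\<Union>f\<in>\<xi>. \<Union>g\<in>\<eta>. var_class B (\<lambda>c w z. f c w z + g c w z))"

definition var_scale :: "('a, 'e, 'n::finite, 'm::finite) vbundle \<Rightarrow> real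
    \<Rightarrow> ('a, 'e, 'n, 'm) densities set \<Rightarrow> ('a, 'e, 'n, 'm) densities set" where
  "var_scale B t \<xi> = (\<Union>f\<in>\<xi>. var_class B (\<lambda>c w z. t * f c w z))"

definition schouten :: "('a, 'e, 'n::finite, 'm::finite) vbundle \<Rightarrow> ('a, 'e, 'n, 'm) densities set
    \<Rightarrow> ('a, 'e, 'n, 'm) densities set \<Rightarrow> ('a, 'e, 'n, 'm) densities set" where
  "schouten B \<xi> \<eta> = (\<Union>f\<in>\<xi>. \<Union>g\<in>\<eta>. var_class B (\<lambda>c. bracket_density (f c) (g c)))"

definition insertion :: "('a, 'e, 'n::finite, 'm::finite) vbundle \<Rightarrow> nat
    \<Rightarrow> ('a, 'e, 'n, 'm) densities set \<Rightarrow> ('a, 'e, 'n, 'm) densities set" where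
  "insertion B s \<xi> = (\<Union>f\<in>\<xi>. var_class B (\<lambda>c. insert_density s (f c)))"

end

theory Submission
  imports Defs
begin

text \<open>The identity already holds for densities, before the passage to classes and even before the odd
coordinates anticommute. Write \<open>\<iota>\<close> for the insertion without the factor \<open>1 / k\<close> (\<open>contraction\<close>
below), that is \<open>\<iota> = \<Sum> p\<^sub>g \<partial>/\<partial>b\<^sub>g\<close> with the right odd derivatives. Two facts about \<open>\<iota>\<close> carry
the proof.

 \<^item> \<open>\<iota>\<close> commutes with \<open>D\<^sub>i\<close> (\<open>contraction_total_der\<close>). The commutator of \<open>D\<^sub>i\<close> with \<open>\<partial>/\<partial>b\<^sub>\<sigma>\<close> is
   minus the derivative along the index lowered in direction \<open>i\<close>, while \<open>D\<^sub>i p\<^sub>\<sigma>\<close> raises the index of \<open>p\<close>; the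
   two contributions cancel after a shift of the summation index. Since the \<open>p\<close> do not depend on the \<open>q\<close>, and
   since left and right odd derivatives commute while two right ones anticommute, \<open>\<iota>\<close> commutes with
   \<open>\<delta>/\<delta>q\<close> and with the left \<open>\<delta>/\<delta>b\<close>, and anticommutes with the right one (\<open>var_contraction\<close>).

 \<^item> \<open>\<iota>\<close> is an odd derivation acting from the right (\<open>contraction_mult\<close>), so applied to
   the products that make up the bracket it gives \<open>\<iota>[f, g] = [f, \<iota> g] - (-1)\<^sup>l [\<iota> f, g]\<close> for \<open>g\<close> of degree \<open>l\<close>
   (\<open>bracket_contraction\<close>).

On a density of degree \<open>k\<close> the operator \<open>\<iota>\<close> is \<open>k\<close> times the insertion, also for \<open>k = 0\<close>,
where both vanish. Dividing by the degree \<open>k + l - 1\<close> of the bracket gives the coefficients of the theorem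
(\<open>insert_bracket\<close>).

It remains to see that each union over representatives in the definitions of bracket, insertion, sum and
scaling is one single class. The variational derivatives annihilate every \<open>D\<^sub>i g\<close>
(\<open>variation_total_der\<close>), again because the sum over multi-indices telescopes; this uses
that the \<open>D\<^sub>i\<close> commute, hence that second partial derivatives are symmetric. All operators and the product
respect the ideal generated by the anticommutators. Thus the bracket of densities depends on the
representatives only up to that ideal (\<open>bracket_exact\<close>). Insertion maps \<open>D\<^sub>i g\<close> to \<open>D\<^sub>i\<close> of the
insertion into \<open>g\<close>, and the latter is again a global form, because inserting \<open>p\<close> amounts to evaluating
on one more covector, the jet of \<open>p\<close> itself (\<open>density_value_insert\<close>, \<open>global_subtop_form_insert\<close>).

Coefficients of densities matter only over the chart domain \<open>D\<close>. Everything local is therefore stated for an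
open set \<open>D\<close> of jets, with equality on \<open>D\<close> (\<open>agree\<close>) and with explicit bounds for the order
(\<open>of_order\<close>); the bounds make the formally infinite sums finite, and they have to be independent of the chart.\<close>

section \<open>Partial derivatives of smooth functions\<close>

lemma continuous_on_if_const:
  "continuous_on A f \<Longrightarrow> continuous_on A g \<Longrightarrow> continuous_on A (\<lambda>x. if P then f x else g x)"
  by (cases P) auto

lemma eventually_update_mem:
  fixes D :: "('v \<Rightarrow> real) set"
  assumes "open D" "z \<in> D"
  shows "\<forall>\<^sub>F t in nhds (z v). z(v := t) \<in> D"
proof -
  have "continuous_on UNIV (\<lambda>t. z(v := t))"
    unfolding fun_upd_def
    by (intro continuous_on_coordinatewise_then_product continuous_on_if_const continuous_intros)
  then have "((\<lambda>t. z(v := t)) \<longlongrightarrow> z(v := z v)) (at (z v))"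
    by (simp add: continuous_on_def del: fun_upd_triv)
  then have "((\<lambda>t. z(v := t)) \<longlongrightarrow> z) (nhds (z v))"
    by (metis fun_upd_triv tendsto_at_iff_tendsto_nhds)
  then show ?thesis
    using assms topological_tendstoD by blast
qed

lemma pder_cong:
  assumes "open D" "\<And>z. z \<in> D \<Longrightarrow> F z = G z" "z \<in> D"
  shows "pder v F z = pder v G z"
  unfolding pder_def
  by (rule deriv_cong_ev[OF eventually_mono[OF eventually_update_mem[OF assms(1,3)]]])
     (use assms(2) in auto)

lemma foldr_pder_cong:
  assumes "open D" "\<And>z. z \<in> D \<Longrightarrow> F z = G z" "z \<in> D"
  shows "foldr pder vs F z = foldr pder vs G z"
  using assms(3)
proof (induction vs arbitrary: z)
  case Nil
  then show ?case using assms(2) by simp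
next
  case (Cons v vs)
  show ?case using pder_cong[OF assms(1) Cons.IH Cons.prems] by simp
qed

abbreviation partial_differentiable :: "'v \<Rightarrow> (('v \<Rightarrow> real) \<Rightarrow> real) \<Rightarrow> ('v \<Rightarrow> real) \<Rightarrow> bool" where
  "partial_differentiable v F z \<equiv> (\<lambda>t. F (z(v := t))) differentiable (at (z v))"

lemma partial_differentiable_cong:
  assumes "open D" "\<And>z. z \<in> D \<Longrightarrow> F z = G z" "z \<in> D" "partial_differentiable v F z"
  shows "partial_differentiable v G z"
proof -
  obtain c where "((\<lambda>t. F (z(v := t))) has_field_derivative c) (at (z v))"
    using assms(4) real_differentiable_def by blast
  moreover have "\<forall>\<^sub>F t in nhds (z v). F (z(v := t)) = G (z(v := t))"
    by (rule eventually_mono[OF eventually_update_mem[OF assms(1,3)]]) (use assms(2) in auto)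
  ultimately have "((\<lambda>t. G (z(v := t))) has_field_derivative c) (at (z v))"
    by (simp only: DERIV_cong_ev[OF refl _ refl])
  then show ?thesis
    using real_differentiable_def by blast
qed

lemma DERIV_pder:
  assumes "partial_differentiable v F z"
  shows "((\<lambda>t. F (z(v := t))) has_real_derivative pder v F z) (at (z v))"
  using assms unfolding pder_def
  using DERIV_imp_deriv real_differentiable_def by blast

lemma pder_eqI:
  "((\<lambda>t. F (z(v := t))) has_real_derivative c) (at (z v)) \<Longrightarrow> pder v F z = c"
  unfolding pder_def by (rule DERIV_imp_deriv)

lemma pder_const [simp]: "pder v (\<lambda>_. c) z = 0"
  by (rule pder_eqI) auto

lemma pder_coordinate: "pder v (\<lambda>z. z u) = (\<lambda>_. of_bool (u = v))"
  by (rule ext, rule pder_eqI) (cases "u = v", auto)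

lemma pder_add:
  assumes "partial_differentiable v F z" "partial_differentiable v G z"
  shows "pder v (\<lambda>z. F z + G z) z = pder v F z + pder v G z"
  by (rule pder_eqI) (rule DERIV_add[OF assms[THEN DERIV_pder]])

lemma pder_mult:
  assumes "partial_differentiable v F z" "partial_differentiable v G z"
  shows "pder v (\<lambda>z. F z * G z) z = pder v F z * G z + F z * pder v G z"
  using DERIV_mult[OF assms[THEN DERIV_pder]]
  by (intro pder_eqI) (simp only: fun_upd_triv mult.commute add.commute)

lemma smooth_fun_cong:
  assumes "open D" "\<And>z. z \<in> D \<Longrightarrow> F z = G z" "smooth_fun D F"
  shows "smooth_fun D G"
  unfolding smooth_fun_def
proof (intro allI conjI ballI)
  fix vs
  have eq: "\<And>z. z \<in> D \<Longrightarrow> foldr pder vs F z = foldr pder vs G z"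
    using foldr_pder_cong[OF assms(1,2)] .
  have "continuous_on D (foldr pder vs F)"
    using assms(3) unfolding smooth_fun_def by blast
  then show "continuous_on D (foldr pder vs G)"
    using continuous_on_cong[of D D "foldr pder vs F" "foldr pder vs G"] eq by simp
  fix z v assume "z \<in> D"
  then show "partial_differentiable v (foldr pder vs G) z"
    by (intro partial_differentiable_cong[OF assms(1) eq, of "\<lambda>z. z"])
       (use assms(3) in \<open>auto simp: smooth_fun_def\<close>)
qed

text \<open>This replaces the quantification over lists of derivatives by an unfolding rule in which a single derivative is taken first.\<close>

lemma smooth_fun_step:
  "smooth_fun D F \<longleftrightarrow>
     continuous_on D F \<and> (\<forall>z\<in>D. \<forall>v. partial_differentiable v F z) \<and> (\<forall>v. smooth_fun D (pder v F))"
proof (intro iffI conjI allI)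
  assume F: "smooth_fun D F"
  then show "continuous_on D F" "\<forall>z\<in>D. \<forall>v. partial_differentiable v F z"
    unfolding smooth_fun_def by (force dest: spec[of _ "[]"])+
  fix v
  show "smooth_fun D (pder v F)"
    unfolding smooth_fun_def
  proof
    fix vs
    show "continuous_on D (foldr pder vs (pder v F)) \<and>
           (\<forall>z\<in>D. \<forall>u. partial_differentiable u (foldr pder vs (pder v F)) z)"
      using F[unfolded smooth_fun_def, rule_format, of "vs @ [v]"] by simp
  qed
next
  assume *: "continuous_on D F \<and> (\<forall>z\<in>D. \<forall>v. partial_differentiable v F z) \<and> (\<forall>v. smooth_fun D (pder v F))"
  show "smooth_fun D F"
    unfolding smooth_fun_def
  proof
    fix vs
    show "continuous_on D (foldr pder vs F) \<and> (\<forall>z\<in>D. \<forall>v. partial_differentiable v (foldr pder vs F) z)"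
      by (cases vs rule: rev_cases) (use * in \<open>auto simp: smooth_fun_def\<close>)
  qed
qed

lemma smooth_fun_imp_continuous: "smooth_fun D F \<Longrightarrow> continuous_on D F"
  and smooth_fun_imp_differentiable: "smooth_fun D F \<Longrightarrow> z \<in> D \<Longrightarrow> partial_differentiable v F z"
  and smooth_fun_pder: "smooth_fun D F \<Longrightarrow> smooth_fun D (pder v F)"
  by (simp_all add: smooth_fun_step[of D F])

text \<open>Smoothness is proved by exhibiting a class of functions that is closed under partial derivatives, up to
equality on \<open>D\<close>, and whose members are continuous and partially differentiable.\<close>

lemma smooth_fun_coinduct:
  assumes "open D" and "S F"
    and "\<And>F. S F \<Longrightarrow> continuous_on D F"
    and "\<And>F z v. S F \<Longrightarrow> z \<in> D \<Longrightarrow> partial_differentiable v F z"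
    and "\<And>F v. S F \<Longrightarrow> \<exists>G. S G \<and> (\<forall>z\<in>D. pder v F z = G z)"
  shows "smooth_fun D F"
proof -
  have *: "\<exists>G. S G \<and> (\<forall>z\<in>D. foldr pder vs F z = G z)" for vs
  proof (induction vs)
    case Nil
    then show ?case using assms(2) by auto
  next
    case (Cons v vs)
    then obtain G where G: "S G" "\<forall>z\<in>D. foldr pder vs F z = G z" by blast
    obtain H where "S H" "\<forall>z\<in>D. pder v G z = H z" using assms(5) G(1) by blast
    moreover have "\<forall>z\<in>D. pder v (foldr pder vs F) z = pder v G z"
      using pder_cong[OF assms(1)] G(2) by blast
    ultimately show ?case by auto
  qed
  show ?thesis unfolding smooth_fun_def
  proof (intro allI conjI ballI)
    fix vs
    obtain G where G: "S G" "\<forall>z\<in>D. foldr pder vs F z = G z" using * by blast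
    show "continuous_on D (foldr pder vs F)"
      using assms(3)[OF G(1)] G(2) continuous_on_cong[of D D "foldr pder vs F" G] by simp
    fix z v assume "z \<in> D"
    then show "partial_differentiable v (foldr pder vs F) z"
      by (intro partial_differentiable_cong[OF assms(1) _ _ assms(4)[OF G(1)]]) (use G(2) in auto)
  qed
qed

lemma smooth_fun_const: "open D \<Longrightarrow> smooth_fun D (\<lambda>_. c)"
  by (rule smooth_fun_coinduct[where S = "\<lambda>F. \<exists>c. F = (\<lambda>_. c)"]) (force simp: continuous_on_const)+

lemma smooth_fun_coordinate:
  assumes "open D" shows "smooth_fun D (\<lambda>z. z u)"
proof (subst smooth_fun_step, intro conjI ballI allI)
  show "continuous_on D (\<lambda>z. z u)"
    by (rule continuous_on_subset[OF continuous_on_product_coordinates]) simp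
  fix v
  show "smooth_fun D (pder v (\<lambda>z. z u))"
    unfolding pder_coordinate by (rule smooth_fun_const[OF assms])
  fix z :: "'a \<Rightarrow> real"
  show "partial_differentiable v (\<lambda>z. z u) z"
    by (cases "u = v") simp_all
qed

lemma smooth_fun_add:
  assumes "open D" "smooth_fun D F" "smooth_fun D G"
  shows "smooth_fun D (\<lambda>z. F z + G z)"
proof (rule smooth_fun_coinduct[OF assms(1),
    where S = "\<lambda>H. \<exists>F G. H = (\<lambda>z. F z + G z) \<and> smooth_fun D F \<and> smooth_fun D G"])
  fix H v
  assume "\<exists>F G. H = (\<lambda>z. F z + G z) \<and> smooth_fun D F \<and> smooth_fun D G"
  then obtain F G where H: "H = (\<lambda>z. F z + G z)" "smooth_fun D F" "smooth_fun D G" by blast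
  have "\<forall>z\<in>D. pder v H z = pder v F z + pder v G z"
    using H by (simp add: pder_add smooth_fun_imp_differentiable)
  moreover have "smooth_fun D (pder v F)" "smooth_fun D (pder v G)"
    by (rule H(2,3)[THEN smooth_fun_pder])+
  ultimately show "\<exists>G. (\<exists>F Ga. G = (\<lambda>z. F z + Ga z) \<and> smooth_fun D F \<and> smooth_fun D Ga) \<and> (\<forall>z\<in>D. pder v H z = G z)"
    by blast
next
  show "\<exists>F' G'. (\<lambda>z. F z + G z) = (\<lambda>z. F' z + G' z) \<and> smooth_fun D F' \<and> smooth_fun D G'"
    using assms by blast
qed (elim exE conjE, simp add: continuous_on_add differentiable_add smooth_fun_imp_continuous smooth_fun_imp_differentiable)+

text \<open>The products \<open>F G\<close> themselves are not closed under partial derivatives, but their finite sums are.\<close>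

inductive product_span :: "('v \<Rightarrow> real) set \<Rightarrow> (('v \<Rightarrow> real) \<Rightarrow> real) \<Rightarrow> bool" for D where
  product: "smooth_fun D F \<Longrightarrow> smooth_fun D G \<Longrightarrow> product_span D (\<lambda>z. F z * G z)"
| sum: "product_span D F \<Longrightarrow> product_span D G \<Longrightarrow> product_span D (\<lambda>z. F z + G z)"

lemma smooth_fun_mult:
  assumes "open D" "smooth_fun D F" "smooth_fun D G"
  shows "smooth_fun D (\<lambda>z. F z * G z)"
proof (rule smooth_fun_coinduct[OF assms(1), where S = "product_span D"])
  show "product_span D (\<lambda>z. F z * G z)"
    using assms product_span.product by blast
  fix H assume H: "product_span D H"
  show "continuous_on D H"
    using H by induction (auto intro: continuous_on_add continuous_on_mult dest: smooth_fun_imp_continuous)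
  have diff: "partial_differentiable v H z" if "product_span D H" "z \<in> D" for H z v
    using that(1)
  proof induction
    case (product F G)
    then show ?case
      by (intro differentiable_mult smooth_fun_imp_differentiable[OF _ that(2)])
  next
    case (sum F G)
    then show ?case
      by (intro differentiable_add)
  qed
  then show "partial_differentiable v H z" if "z \<in> D" for z v
    using that H by blast
  show "\<exists>G. product_span D G \<and> (\<forall>z\<in>D. pder v H z = G z)" for v
    using H
  proof induction
    case (product F G)
    show ?case
    proof (intro exI conjI ballI)
      show "product_span D (\<lambda>z. pder v F z * G z + F z * pder v G z)"
        by (intro product_span.intros smooth_fun_pder product)
    qed (use product in \<open>simp add: pder_mult smooth_fun_imp_differentiable\<close>)
  next
    case (sum F G)
    then obtain F' G' where FG: "product_span D F'" "\<forall>z\<in>D. pder v F z = F' z"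
      "product_span D G'" "\<forall>z\<in>D. pder v G z = G' z" by blast
    show ?case
    proof (intro exI conjI ballI)
      show "product_span D (\<lambda>z. F' z + G' z)"
        by (intro product_span.intros FG)
    qed (use sum.hyps FG in \<open>simp add: pder_add diff\<close>)
  qed
qed

text \<open>The second difference over a square, computed by the mean value theorem in one variable and then in the
other. The left-hand side is symmetric in the two variables, the right-hand side is a mixed derivative
taken in one of the two orders.\<close>

lemma second_difference:
  fixes \<phi> :: "real \<Rightarrow> real \<Rightarrow> real"
  assumes h: "h > 0"
    and d1: "\<And>s t. s \<in> {a..a + h} \<Longrightarrow> t \<in> {b..b + h} \<Longrightarrow> ((\<lambda>s. \<phi> s t) has_real_derivative \<psi> s t) (at s)"
    and d2: "\<And>s t. s \<in> {a..a + h} \<Longrightarrow> t \<in> {b..b + h} \<Longrightarrow> ((\<lambda>t. \<psi> s t) has_real_derivative \<theta> s t) (at t)"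
  shows "\<exists>s\<in>{a..a + h}. \<exists>t\<in>{b..b + h}.
    \<phi> (a + h) (b + h) - \<phi> (a + h) b - \<phi> a (b + h) + \<phi> a b = h * h * \<theta> s t"
proof -
  have "\<exists>s>a. s < a + h \<and> (\<phi> (a + h) (b + h) - \<phi> (a + h) b) - (\<phi> a (b + h) - \<phi> a b)
      = (a + h - a) * (\<psi> s (b + h) - \<psi> s b)"
    using h d1 by (intro MVT2 DERIV_diff) auto
  then obtain s where s: "a < s" "s < a + h" "(\<phi> (a + h) (b + h) - \<phi> (a + h) b) - (\<phi> a (b + h) - \<phi> a b)
      = h * (\<psi> s (b + h) - \<psi> s b)" by auto
  have "\<exists>t>b. t < b + h \<and> \<psi> s (b + h) - \<psi> s b = (b + h - b) * \<theta> s t"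
    using h d2 s by (intro MVT2) auto
  then obtain t where "b < t" "t < b + h" "\<psi> s (b + h) - \<psi> s b = h * \<theta> s t" by auto
  then show ?thesis
    using s by (intro bexI[of _ s] bexI[of _ t]) (auto simp: algebra_simps)
qed

text \<open>In the product topology a neighbourhood contains all small changes of any two coordinates.\<close>

lemma small_square:
  fixes N :: "('v \<Rightarrow> real) set"
  assumes "open N" "z \<in> N"
  shows "\<exists>h>0. \<forall>s\<in>{z u..z u + h}. \<forall>t\<in>{z v..z v + h}. z(u := s, v := t) \<in> N"
proof -
  have "continuous_on UNIV (\<lambda>p :: real \<times> real. z(u := fst p, v := snd p))"
    unfolding fun_upd_def
    by (intro continuous_on_coordinatewise_then_product continuous_on_if_const continuous_intros)
  then have "open ((\<lambda>p :: real \<times> real. z(u := fst p, v := snd p)) -` N)"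
    by (intro open_vimage assms(1))
  moreover have "(z u, z v) \<in> (\<lambda>p. z(u := fst p, v := snd p)) -` N"
    using assms(2) by auto
  ultimately obtain A B where AB: "open A" "open B" "(z u, z v) \<in> A \<times> B"
    "A \<times> B \<subseteq> (\<lambda>p. z(u := fst p, v := snd p)) -` N"
    by (rule open_prod_elim)
  obtain d where d: "d > 0" "\<And>s. \<bar>s - z u\<bar> < d \<Longrightarrow> s \<in> A"
    using AB by (auto simp: open_dist dist_real_def)
  obtain e where e: "e > 0" "\<And>s. \<bar>s - z v\<bar> < e \<Longrightarrow> s \<in> B"
    using AB by (auto simp: open_dist dist_real_def)
  show ?thesis
  proof (intro exI conjI ballI)
    show "min d e / 2 > 0" using d e by auto
    fix s t assume "s \<in> {z u..z u + min d e / 2}" "t \<in> {z v..z v + min d e / 2}"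
    then have "s \<in> A" "t \<in> B"
      using d e by auto
    then show "z(u := s, v := t) \<in> N" using AB(4) by auto
  qed
qed

text \<open>If the two mixed derivatives differed at \<open>z\<close>, continuity would keep them apart on a small square, whereas
the second difference over that square equals a value of either of them times the area.\<close>

lemma pder_commute:
  assumes "open D" "smooth_fun D F" "z \<in> D"
  shows "pder u (pder v F) z = pder v (pder u F) z"
proof (cases "u = v")
  case False
  show ?thesis
  proof (rule ccontr)
    define e where "e = \<bar>pder u (pder v F) z - pder v (pder u F) z\<bar> / 2"
    assume "pder u (pder v F) z \<noteq> pder v (pder u F) z"
    then have e: "e > 0" by (simp add: e_def)
    define N where "N u v = D \<inter> pder v (pder u F) -` ball (pder v (pder u F) z) e" for u v
    have N: "open (N u v)" "z \<in> N u v" for u v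
      using smooth_fun_pder[OF smooth_fun_pder[OF assms(2)]] assms(1,3) e unfolding N_def
      by (auto intro!: continuous_open_preimage smooth_fun_imp_continuous)
    then obtain h where h: "h > 0"
      "\<forall>s\<in>{z u..z u + h}. \<forall>t\<in>{z v..z v + h}. z(u := s, v := t) \<in> N u v \<inter> N v u"
      using small_square[of "N u v \<inter> N v u" z u v] by blast
    have D: "z(u := s, v := t) \<in> D" if "s \<in> {z u..z u + h}" "t \<in> {z v..z v + h}" for s t
      using h(2) that unfolding N_def by blast
    \<comment> \<open>Writing the perturbed points always as \<open>z(u := s, v := t)\<close> lets both one-variable derivatives refer to one function of \<open>(s, t)\<close>.\<close>
    have twist: "z(u := s, v := t, u := s') = z(u := s', v := t)" "z(u := s, v := t, v := t') = z(u := s, v := t')" for s t s' t'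
      using False by auto
    have der: "((\<lambda>s. G (z(u := s, v := t))) has_real_derivative pder u G (z(u := s, v := t))) (at s)"
      "((\<lambda>t. G (z(u := s, v := t))) has_real_derivative pder v G (z(u := s, v := t))) (at t)"
      if G: "smooth_fun D G" and st: "s \<in> {z u..z u + h}" "t \<in> {z v..z v + h}" for G s t
      using DERIV_pder[OF smooth_fun_imp_differentiable[OF G D[OF st], of u]]
        DERIV_pder[OF smooth_fun_imp_differentiable[OF G D[OF st], of v]]
      unfolding twist by (simp_all only: fun_upd_same fun_upd_other[OF False] twist)
    define \<Delta> where "\<Delta> = F (z(u := z u + h, v := z v + h)) - F (z(u := z u + h, v := z v))
      - F (z(u := z u, v := z v + h)) + F (z(u := z u, v := z v))"
    have "\<exists>s\<in>{z u..z u + h}. \<exists>t\<in>{z v..z v + h}. \<Delta> = h * h * pder v (pder u F) (z(u := s, v := t))"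
      unfolding \<Delta>_def
      by (rule second_difference[where \<phi> = "\<lambda>s t. F (z(u := s, v := t))" and \<psi> = "\<lambda>s t. pder u F (z(u := s, v := t))"])
        (fact h(1), fact der(1)[OF assms(2)], fact der(2)[OF smooth_fun_pder[OF assms(2)]])
    then obtain s t where 1: "s\<in>{z u..z u + h}" "t\<in>{z v..z v + h}"
      "\<Delta> = h * h * pder v (pder u F) (z(u := s, v := t))" by blast
    have "\<exists>t\<in>{z v..z v + h}. \<exists>s\<in>{z u..z u + h}. F (z(u := z u + h, v := z v + h)) - F (z(u := z u, v := z v + h))
      - F (z(u := z u + h, v := z v)) + F (z(u := z u, v := z v))
      = h * h * pder u (pder v F) (z(u := s, v := t))"
      by (rule second_difference[where \<phi> = "\<lambda>t s. F (z(u := s, v := t))" and \<psi> = "\<lambda>t s. pder v F (z(u := s, v := t))"])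
        (rule h(1), (rule der(2)[OF assms(2)]; assumption), (rule der(1)[OF smooth_fun_pder[OF assms(2)]]; assumption))
    then obtain s' t' where 2: "s'\<in>{z u..z u + h}" "t'\<in>{z v..z v + h}"
      "\<Delta> = h * h * pder u (pder v F) (z(u := s', v := t'))"
      unfolding \<Delta>_def by (auto simp: algebra_simps)
    have "pder v (pder u F) (z(u := s, v := t)) = pder u (pder v F) (z(u := s', v := t'))"
      using 1(3) 2(3) h(1) by simp
    moreover have "dist (pder v (pder u F) z) (pder v (pder u F) (z(u := s, v := t))) < e"
      using h(2) 1(1,2) unfolding N_def by auto
    moreover have "dist (pder u (pder v F) z) (pder u (pder v F) (z(u := s', v := t'))) < e"
      using h(2) 2(1,2) unfolding N_def by auto
    ultimately show False
      unfolding e_def dist_real_def by argo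
  qed
qed simp

section \<open>Multi-indices\<close>

lemma finite_multiindices: "finite {\<sigma> :: 'n::finite \<Rightarrow> nat. msize \<sigma> \<le> r}"
proof (rule finite_subset)
  have "\<sigma> i \<le> r" if "msize \<sigma> \<le> r" for \<sigma> :: "'n \<Rightarrow> nat" and i
    using that member_le_sum[of i UNIV \<sigma>] by (simp add: msize_def)
  then show "{\<sigma> :: 'n \<Rightarrow> nat. msize \<sigma> \<le> r} \<subseteq> (\<Pi>\<^sub>E i\<in>UNIV. {..r})"
    by (auto simp: PiE_def)
qed (auto intro: finite_PiE)

lemma msize_bump [simp]: "msize (bump i \<sigma>) = Suc (msize \<sigma>)"
  unfolding msize_def bump_def by (subst (1 2) sum.remove[of _ i]) auto

definition unbump :: "'n \<Rightarrow> ('n \<Rightarrow> nat) \<Rightarrow> ('n \<Rightarrow> nat)" where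
  "unbump i \<sigma> = \<sigma>(i := \<sigma> i - 1)"

lemma bump_at [simp]: "bump i \<sigma> i = Suc (\<sigma> i)"
  and unbump_bump [simp]: "unbump i (bump i \<sigma>) = \<sigma>"
  and bump_unbump: "0 < \<sigma> i \<Longrightarrow> bump i (unbump i \<sigma>) = \<sigma>"
  by (auto simp: bump_def unbump_def)

lemma bump_commute: "bump i (bump j \<sigma>) = bump j (bump i \<sigma>)"
  by (auto simp: bump_def)

lemma bump_eq_iff: "bump i \<sigma> = \<tau> \<longleftrightarrow> 0 < \<tau> i \<and> \<sigma> = unbump i \<tau>"
  using bump_unbump[of \<tau> i] by auto

lemma finite_jet_vars: "finite (jet_vars r :: ('n::finite, 'm::finite) evar set)"
proof (rule finite_subset)
  show "finite (range Xv \<union> (\<Union>a. Qv a ` {\<sigma>. msize \<sigma> \<le> r})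
    \<union> (\<Union>s\<in>{..r}. \<Union>a. Pv s a ` {\<sigma>. msize \<sigma> \<le> r}) :: ('n, 'm) evar set)"
    by (simp add: finite_multiindices)
qed (auto simp: jet_vars_def)

lemma jet_vars_mono: "r \<le> r' \<Longrightarrow> jet_vars r \<subseteq> jet_vars r'"
  by (force simp: jet_vars_def)

section \<open>Functions on finite jet spaces\<close>

locale open_jets =
  fixes D :: "('n::finite, 'm::finite) jet set"
  assumes open_D: "open D"
begin

abbreviation "jetf \<equiv> jet_fun D"

lemma jetf_smooth: "jetf r F \<Longrightarrow> smooth_fun D F"
  and jetf_differentiable: "jetf r F \<Longrightarrow> z \<in> D \<Longrightarrow> partial_differentiable v F z"
  by (auto simp: jet_fun_def smooth_fun_imp_differentiable)

lemma jetf_mono: "jetf r F \<Longrightarrow> r \<le> r' \<Longrightarrow> jetf r' F"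
  unfolding jet_fun_def using jet_vars_mono[of r r'] by blast

lemma jetf_cong:
  assumes "jetf r F" "\<And>z. z \<in> D \<Longrightarrow> G z = F z"
  shows "jetf r G"
  unfolding jet_fun_def
proof (intro conjI ballI impI)
  show "smooth_fun D G"
    by (rule smooth_fun_cong[OF open_D _ jetf_smooth[OF assms(1)]]) (simp add: assms(2))
  fix z z' assume "z \<in> D" "z' \<in> D" "\<forall>v\<in>jet_vars r. z v = z' v"
  then show "G z = G z'"
    using assms unfolding jet_fun_def by metis
qed

lemma jetf_const [simp]: "jetf r (\<lambda>_. c)"
  by (simp add: jet_fun_def smooth_fun_const[OF open_D])

lemma jetf_coordinate: "v \<in> jet_vars r \<Longrightarrow> jetf r (\<lambda>z. z v)"
  by (simp add: jet_fun_def smooth_fun_coordinate[OF open_D])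

lemma jetf_add: "jetf r F \<Longrightarrow> jetf r G \<Longrightarrow> jetf r (\<lambda>z. F z + G z)"
  unfolding jet_fun_def by (metis smooth_fun_add[OF open_D])

lemma jetf_mult: "jetf r F \<Longrightarrow> jetf r G \<Longrightarrow> jetf r (\<lambda>z. F z * G z)"
  unfolding jet_fun_def by (metis smooth_fun_mult[OF open_D])

lemma jetf_sum: "(\<And>i. i \<in> I \<Longrightarrow> jetf r (F i)) \<Longrightarrow> jetf r (\<lambda>z. \<Sum>i\<in>I. F i z)"
  by (induction I rule: infinite_finite_induct) (simp_all add: jetf_add)

text \<open>Moving a coordinate that is not among the variables of order \<open>r\<close> stays inside the open set \<open>D\<close> for a short
while and does not change the value there.\<close>

lemma jetf_pder_outside:
  assumes "jetf r F" "v \<notin> jet_vars r" "z \<in> D"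
  shows "pder v F z = 0"
proof (rule pder_eqI)
  have "\<forall>\<^sub>F t in nhds (z v). F (z(v := t)) = F z"
    using eventually_update_mem[OF open_D assms(3), of v]
  proof (rule eventually_mono)
    fix t assume "z(v := t) \<in> D"
    moreover have "\<forall>u\<in>jet_vars r. (z(v := t)) u = z u"
      using assms(2) by auto
    ultimately show "F (z(v := t)) = F z"
      using assms(1,3) unfolding jet_fun_def by blast
  qed
  then show "((\<lambda>t. F (z(v := t))) has_real_derivative 0) (at (z v))"
    by (subst DERIV_cong_ev[OF refl _ refl, of _ "\<lambda>_. F z"]) auto
qed

lemma jetf_pder:
  assumes "jetf r F"
  shows "jetf r (pder v F)"
  unfolding jet_fun_def
proof (intro conjI ballI impI)
  show "smooth_fun D (pder v F)"
    by (rule smooth_fun_pder[OF jetf_smooth[OF assms]])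
  fix z z' assume z: "z \<in> D" "z' \<in> D" and eq: "\<forall>v\<in>jet_vars r. z v = z' v"
  show "pder v F z = pder v F z'"
  proof (cases "v \<in> jet_vars r")
    case True
    then have zv: "z v = z' v" using eq by blast
    have "\<forall>\<^sub>F t in nhds (z v). z(v := t) \<in> D \<and> z'(v := t) \<in> D"
      using eventually_update_mem[OF open_D z(1), of v] eventually_update_mem[OF open_D z(2), of v] zv
      by (simp add: eventually_conj)
    then have "\<forall>\<^sub>F t in nhds (z v). F (z(v := t)) = F (z'(v := t))"
    proof (rule eventually_mono)
      fix t assume D: "z(v := t) \<in> D \<and> z'(v := t) \<in> D"
      have "\<forall>u\<in>jet_vars r. (z(v := t)) u = (z'(v := t)) u" using eq by auto
      then show "F (z(v := t)) = F (z'(v := t))"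
        using assms D unfolding jet_fun_def by blast
    qed
    then show ?thesis
      unfolding pder_def by (rule deriv_cong_ev[OF _ zv])
  next
    case False
    then show ?thesis using jetf_pder_outside[OF assms] z by simp
  qed
qed

lemma pder_scale:
  assumes "jetf r F" "z \<in> D"
  shows "pder v (\<lambda>z. c * F z) z = c * pder v F z"
  by (subst pder_mult) (use assms jetf_differentiable in auto)

lemma pder_sum:
  assumes "\<And>i. i \<in> I \<Longrightarrow> jetf r (F i)" "z \<in> D"
  shows "pder v (\<lambda>z. \<Sum>i\<in>I. F i z) z = (\<Sum>i\<in>I. pder v (F i) z)"
  using assms(1)
proof (induction I rule: infinite_finite_induct)
  case (insert i I)
  have "jetf r (\<lambda>z. \<Sum>i\<in>I. F i z)"
    by (rule jetf_sum) (simp add: insert.prems)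
  then have "pder v (\<lambda>z. F i z + (\<Sum>i\<in>I. F i z)) z = pder v (F i) z + pder v (\<lambda>z. \<Sum>i\<in>I. F i z) z"
    by (intro pder_add jetf_differentiable[OF _ assms(2)]) (auto intro: insert.prems)
  then show ?case
    using insert by simp
qed simp_all

section \<open>Total derivatives of functions\<close>

definition dtot :: "'n \<Rightarrow> (('n, 'm) jet \<Rightarrow> real) \<Rightarrow> ('n, 'm) jet \<Rightarrow> real" where
  "dtot i F z = Sum_any (\<lambda>v. total_coord i v z * pder v F z)"

lemma dtot_eq_sum:
  assumes "jetf r F" "z \<in> D"
  shows "dtot i F z = (\<Sum>v\<in>jet_vars r. total_coord i v z * pder v F z)"
  unfolding dtot_def
  by (rule Sum_any.expand_superset[OF finite_jet_vars])
     (use jetf_pder_outside[OF assms(1) _ assms(2)] in auto)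

lemma dtot_cong:
  assumes "\<And>z. z \<in> D \<Longrightarrow> F z = G z" "z \<in> D"
  shows "dtot i F z = dtot i G z"
  unfolding dtot_def by (simp add: pder_cong[OF open_D assms])

lemma jetf_total_coord: "v \<in> jet_vars r \<Longrightarrow> jetf (Suc r) (total_coord i v)"
  by (cases v) (auto simp: jet_vars_def total_coord.simps[abs_def] intro!: jetf_coordinate)

lemma jetf_dtot:
  assumes "jetf r F" shows "jetf (Suc r) (dtot i F)"
proof (rule jetf_cong)
  show "jetf (Suc r) (\<lambda>z. \<Sum>v\<in>jet_vars r. total_coord i v z * pder v F z)"
    using assms by (intro jetf_sum jetf_mult jetf_total_coord jetf_mono[OF jetf_pder]) auto
qed (simp add: dtot_eq_sum[OF assms])

lemma dtot_add:
  assumes "jetf r F" "jetf r G" "z \<in> D"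
  shows "dtot i (\<lambda>z. F z + G z) z = dtot i F z + dtot i G z"
  using assms by (simp add: dtot_eq_sum[of r] jetf_add pder_add jetf_differentiable sum.distrib algebra_simps)

lemma dtot_mult:
  assumes "jetf r F" "jetf r G" "z \<in> D"
  shows "dtot i (\<lambda>z. F z * G z) z = dtot i F z * G z + F z * dtot i G z"
  using assms
  by (simp add: dtot_eq_sum[of r] jetf_mult pder_mult jetf_differentiable sum.distrib sum_distrib_left algebra_simps)

lemma dtot_const [simp]: "dtot i (\<lambda>_. c) z = 0"
  by (simp add: dtot_def)

lemma dtot_scale:
  assumes "jetf r F" "z \<in> D"
  shows "dtot i (\<lambda>z. c * F z) z = c * dtot i F z"
  using dtot_mult[OF jetf_const assms] by simp

lemma dtot_sum:
  assumes "\<And>i. i \<in> I \<Longrightarrow> jetf r (F i)" "z \<in> D"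
  shows "dtot j (\<lambda>z. \<Sum>i\<in>I. F i z) z = (\<Sum>i\<in>I. dtot j (F i) z)"
  using assms(1)
proof (induction I rule: infinite_finite_induct)
  case (insert i I)
  then show ?case
    using dtot_add[of r "F i" "\<lambda>z. \<Sum>i\<in>I. F i z" z] jetf_sum[of I r F] assms(2)
    by simp
qed simp_all

lemma dtot_coordinate: "dtot i (\<lambda>z. z v) z = total_coord i v z"
  by (simp add: dtot_def pder_coordinate of_bool_def if_distrib[of "\<lambda>x. _ * x"] cong: if_cong)

lemma dtot_total_coord: "dtot i (total_coord j v) z = dtot j (total_coord i v) z"
proof (cases v)
  case (Xv x1)
  then show ?thesis by (simp add: total_coord.simps[abs_def])
qed (simp_all add: total_coord.simps[abs_def] dtot_coordinate bump_commute)

lemma pder_total_coord: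
  "pder (Qv a \<sigma>) (total_coord i v) z = of_bool (0 < \<sigma> i \<and> v = Qv a (unbump i \<sigma>))"
proof (cases v)
  case (Xv x1)
  then show ?thesis by (simp add: total_coord.simps[abs_def])
qed (auto simp: total_coord.simps[abs_def] pder_coordinate bump_eq_iff)

text \<open>Expanding both sides leaves a double sum, symmetric because second partial derivatives are, and the terms with
\<open>D\<^sub>i\<close> applied to the coefficients of \<open>D\<^sub>j\<close>, which are symmetric because raising a multi-index in
two directions is.\<close>

lemma dtot_commute:
  assumes F: "jetf r F" and z: "z \<in> D"
  shows "dtot i (dtot j F) z = dtot j (dtot i F) z"
proof -
  have expand: "dtot i (dtot j F) z = (\<Sum>v\<in>jet_vars r. dtot i (total_coord j v) z * pder v F z)
    + (\<Sum>v\<in>jet_vars r. \<Sum>u\<in>jet_vars r. total_coord j v z * total_coord i u z * pder u (pder v F) z)" for i j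
  proof -
    have "dtot i (dtot j F) z = dtot i (\<lambda>z. \<Sum>v\<in>jet_vars r. total_coord j v z * pder v F z) z"
      by (rule dtot_cong[OF _ z]) (rule dtot_eq_sum[OF F])
    also have "\<dots> = (\<Sum>v\<in>jet_vars r. dtot i (\<lambda>z. total_coord j v z * pder v F z) z)"
      by (rule dtot_sum[OF _ z, of _ "Suc r"])
         (auto intro!: jetf_mult jetf_total_coord jetf_mono[OF jetf_pder[OF F]])
    also have "\<dots> = (\<Sum>v\<in>jet_vars r. dtot i (total_coord j v) z * pder v F z + total_coord j v z * dtot i (pder v F) z)"
      by (intro sum.cong refl dtot_mult[OF _ _ z, of "Suc r"])
         (auto intro!: jetf_total_coord jetf_mono[OF jetf_pder[OF F]])
    finally show ?thesis
      by (simp add: dtot_eq_sum[OF jetf_pder[OF F] z] sum.distrib sum_distrib_left mult.assoc)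
  qed
  show ?thesis
    unfolding expand[of i j] expand[of j i] dtot_total_coord[of i j]
    by (subst (2) sum.swap)
       (simp add: pder_commute[OF open_D jetf_smooth[OF F] z] mult.commute mult.left_commute)
qed

text \<open>The extra term arises because \<open>q\<^sub>\<sigma>\<close> occurs in the coefficient of at most one partial derivative in \<open>D\<^sub>i\<close>:
the one along the coordinate with \<open>\<sigma>\<close> lowered in direction \<open>i\<close>.\<close>

lemma pder_dtot:
  assumes F: "jetf r F" and z: "z \<in> D"
  shows "pder (Qv a \<sigma>) (dtot i F) z =
    dtot i (pder (Qv a \<sigma>) F) z + of_bool (0 < \<sigma> i) * pder (Qv a (unbump i \<sigma>)) F z"
proof -
  let ?v = "Qv a \<sigma>"
  have "pder ?v (dtot i F) z = pder ?v (\<lambda>z. \<Sum>v\<in>jet_vars r. total_coord i v z * pder v F z) z"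
    by (rule pder_cong[OF open_D _ z]) (rule dtot_eq_sum[OF F])
  also have "\<dots> = (\<Sum>v\<in>jet_vars r. pder ?v (\<lambda>z. total_coord i v z * pder v F z) z)"
    by (rule pder_sum[OF _ z, of _ "Suc r"])
       (auto intro!: jetf_mult jetf_total_coord jetf_mono[OF jetf_pder[OF F]])
  also have "\<dots> = (\<Sum>v\<in>jet_vars r. pder ?v (total_coord i v) z * pder v F z + total_coord i v z * pder ?v (pder v F) z)"
    by (intro sum.cong refl pder_mult jetf_differentiable[OF _ z, of "Suc r"])
       (auto intro!: jetf_total_coord jetf_mono[OF jetf_pder[OF F]])
  also have "\<dots> = (\<Sum>v\<in>jet_vars r. of_bool (0 < \<sigma> i) * (of_bool (v = Qv a (unbump i \<sigma>)) * pder v F z))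
      + dtot i (pder ?v F) z"
    by (simp add: dtot_eq_sum[OF jetf_pder[OF F] z] sum.distrib pder_total_coord
        pder_commute[OF open_D jetf_smooth[OF F] z, of ?v] of_bool_conj mult.assoc)
  also have "(\<Sum>v\<in>jet_vars r. of_bool (v = Qv a (unbump i \<sigma>)) * pder v F z) = pder (Qv a (unbump i \<sigma>)) F z"
    using jetf_pder_outside[OF F _ z, of "Qv a (unbump i \<sigma>)"]
    by (simp add: of_bool_def if_distrib[of "\<lambda>x. x * _"] sum.delta finite_jet_vars cong: if_cong)
  then have "(\<Sum>v\<in>jet_vars r. of_bool (0 < \<sigma> i) * (of_bool (v = Qv a (unbump i \<sigma>)) * pder v F z))
      = of_bool (0 < \<sigma> i) * pder (Qv a (unbump i \<sigma>)) F z"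
    by (simp add: sum_distrib_left[symmetric])
  finally show ?thesis by simp
qed

end

section \<open>Finite linear functionals on word functions\<close>

text \<open>The coefficient of a word \<open>w\<close> in the image of a density depends on finitely many coefficients of the
density. Viewing it as a functional of the coefficient function removes the formally infinite sums from the
operators, and makes all identities between them provable by recursion on \<open>w\<close>.\<close>

definition word_functional :: "(('g list \<Rightarrow> real) \<Rightarrow> real) \<Rightarrow> bool" where
  "word_functional \<Lambda> \<longleftrightarrow> (\<exists>ps. \<forall>\<phi>. \<Lambda> \<phi> = (\<Sum>(k, x)\<leftarrow>ps. k * \<phi> x))"

lemma word_functional_eval: "word_functional (\<lambda>\<phi>. \<phi> x)"
  unfolding word_functional_def by (rule exI[of _ "[(1, x)]"]) simp

lemma word_functional_zero: "word_functional (\<lambda>\<phi>. 0)"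
  unfolding word_functional_def by (rule exI[of _ "[]"]) simp

lemma word_functional_add:
  assumes "word_functional \<Lambda>" "word_functional M"
  shows "word_functional (\<lambda>\<phi>. \<Lambda> \<phi> + M \<phi>)"
proof -
  obtain ps qs where "\<And>\<phi>. \<Lambda> \<phi> = (\<Sum>(k, x)\<leftarrow>ps. k * \<phi> x)" "\<And>\<phi>. M \<phi> = (\<Sum>(k, x)\<leftarrow>qs. k * \<phi> x)"
    using assms unfolding word_functional_def by blast
  then show ?thesis
    unfolding word_functional_def by (intro exI[of _ "ps @ qs"]) simp
qed

lemma word_functional_minus:
  assumes "word_functional \<Lambda>"
  shows "word_functional (\<lambda>\<phi>. - \<Lambda> \<phi>)"
proof -
  obtain ps where ps: "\<And>\<phi>. \<Lambda> \<phi> = (\<Sum>(k, x)\<leftarrow>ps. k * \<phi> x)"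
    using assms unfolding word_functional_def by blast
  have "- (\<Sum>(k, x)\<leftarrow>ps. k * \<phi> x) = (\<Sum>(k, x)\<leftarrow>map (map_prod uminus id) ps. k * \<phi> x)" for \<phi>
    by (induction ps) auto
  then show ?thesis
    unfolding word_functional_def ps by blast
qed

lemma word_functional_precompose:
  assumes "word_functional \<Lambda>"
  shows "word_functional (\<lambda>\<phi>. \<Lambda> (\<lambda>x. \<phi> (m x)))"
proof -
  obtain ps where ps: "\<And>\<phi>. \<Lambda> \<phi> = (\<Sum>(k, x)\<leftarrow>ps. k * \<phi> x)"
    using assms unfolding word_functional_def by blast
  have "(\<Sum>(k, x)\<leftarrow>ps. k * \<phi> (m x)) = (\<Sum>(k, x)\<leftarrow>map (map_prod id m) ps. k * \<phi> x)" for \<phi>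
    by (induction ps) auto
  then show ?thesis
    unfolding word_functional_def ps by blast
qed

lemma word_functional_linear:
  assumes "word_functional \<Lambda>"
  shows "\<Lambda> (\<lambda>x. a * \<phi> x + b * \<psi> x) = a * \<Lambda> \<phi> + b * \<Lambda> \<psi>"
proof -
  obtain ps where ps: "\<And>\<phi>. \<Lambda> \<phi> = (\<Sum>(k, x)\<leftarrow>ps. k * \<phi> x)"
    using assms unfolding word_functional_def by blast
  show ?thesis
    unfolding ps by (induction ps) (auto simp: algebra_simps)
qed

lemma word_functional_sum:
  assumes "word_functional \<Lambda>"
  shows "\<Lambda> (\<lambda>x. \<Sum>i\<in>I. \<phi> i x) = (\<Sum>i\<in>I. \<Lambda> (\<phi> i))"
proof (induction I rule: infinite_finite_induct)
  case (insert i I)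
  then show ?case using word_functional_linear[OF assms, of 1 "\<phi> i" 1] by simp
qed (use word_functional_linear[OF assms, of 0 "\<lambda>_. 0" 0] in simp_all)

text \<open>A functional is the sum over all words of its values on unit functions, and only finitely many words
contribute. This turns an operator given on monomials into its dual description by functionals.\<close>

lemma Sum_any_word_functional:
  assumes "word_functional \<Lambda>"
  shows "Sum_any (\<lambda>u. \<Lambda> (\<lambda>x. of_bool (x = u)) * \<phi> u) = \<Lambda> \<phi>"
proof -
  obtain ps where ps: "\<And>\<phi>. \<Lambda> \<phi> = (\<Sum>(k, x)\<leftarrow>ps. k * \<phi> x)"
    using assms unfolding word_functional_def by blast
  define U where "U = snd ` set ps"
  have zero: "\<Lambda> (\<lambda>x. of_bool (x = u)) = 0" if "u \<notin> U" for u
    using that unfolding ps U_def by (induction ps) auto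
  have "Sum_any (\<lambda>u. \<Lambda> (\<lambda>x. of_bool (x = u)) * \<phi> u) = (\<Sum>u\<in>U. \<Lambda> (\<lambda>x. of_bool (x = u)) * \<phi> u)"
    using zero by (intro Sum_any.expand_superset) (auto simp: U_def)
  also have "\<dots> = (\<Sum>u\<in>U. \<phi> u * \<Lambda> (\<lambda>x. of_bool (x = u)))"
    by (simp add: mult.commute)
  also have "\<dots> = \<Lambda> (\<lambda>x. \<Sum>u\<in>U. \<phi> u * of_bool (x = u))"
    unfolding word_functional_sum[OF assms]
    using word_functional_linear[OF assms, of _ _ 0 "\<lambda>_. 0"] by simp
  also have "\<dots> = \<Lambda> \<phi>"
  proof -
    have "(\<Sum>u\<in>U. \<phi> u * of_bool (x = u)) = \<phi> x" if "x \<in> U" for x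
    proof -
      have "U \<inter> {u. x = u} = {x}" "finite U" using that by (auto simp: U_def)
      then show ?thesis by (simp only: sum_mult_of_bool_eq) simp
    qed
    then show ?thesis
      unfolding ps
      by (intro arg_cong[of _ _ sum_list] map_cong refl)
        (simp add: U_def case_prod_unfold del: sum_mult_of_bool_eq)
  qed
  finally show ?thesis .
qed

context open_jets
begin

lemma
  assumes \<Lambda>: "word_functional \<Lambda>" and f: "\<And>u. jetf r (f u)"
  shows jetf_word_functional: "jetf r (\<lambda>z. \<Lambda> (\<lambda>u. f u z))"
    and pder_word_functional: "z \<in> D \<Longrightarrow> pder v (\<lambda>z. \<Lambda> (\<lambda>u. f u z)) z = \<Lambda> (\<lambda>u. pder v (f u) z)"
    and dtot_word_functional: "z \<in> D \<Longrightarrow> dtot i (\<lambda>z. \<Lambda> (\<lambda>u. f u z)) z = \<Lambda> (\<lambda>u. dtot i (f u) z)"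
proof -
  obtain ps where ps: "\<And>\<phi>. \<Lambda> \<phi> = (\<Sum>(k, x)\<leftarrow>ps. k * \<phi> x)"
    using \<Lambda> unfolding word_functional_def by blast
  have c: "jetf r (\<lambda>z. k * f x z)" for k x
    by (rule jetf_mult[OF jetf_const f])
  have s: "jetf r (\<lambda>z. \<Sum>(k, x)\<leftarrow>ps. k * f x z)" for ps
    by (induction ps) (auto intro!: jetf_add c)
  then show "jetf r (\<lambda>z. \<Lambda> (\<lambda>u. f u z))"
    unfolding ps .
  assume z: "z \<in> D"
  have "pder v (\<lambda>z. \<Sum>(k, x)\<leftarrow>ps. k * f x z) z = (\<Sum>(k, x)\<leftarrow>ps. k * pder v (f x) z)" for ps
  proof (induction ps)
    case (Cons p ps)
    have "pder v (\<lambda>z. fst p * f (snd p) z + (\<Sum>(k, x)\<leftarrow>ps. k * f x z)) z =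
      pder v (\<lambda>z. fst p * f (snd p) z) z + pder v (\<lambda>z. \<Sum>(k, x)\<leftarrow>ps. k * f x z) z"
      by (rule pder_add) (rule jetf_differentiable[OF c z] jetf_differentiable[OF s z])+
    then show ?case
      using Cons by (simp add: case_prod_unfold pder_scale[OF f z])
  qed simp
  then show "pder v (\<lambda>z. \<Lambda> (\<lambda>u. f u z)) z = \<Lambda> (\<lambda>u. pder v (f u) z)"
    unfolding ps .
  have "dtot i (\<lambda>z. \<Sum>(k, x)\<leftarrow>ps. k * f x z) z = (\<Sum>(k, x)\<leftarrow>ps. k * dtot i (f x) z)" for ps
  proof (induction ps)
    case (Cons p ps)
    have "dtot i (\<lambda>z. fst p * f (snd p) z + (\<Sum>(k, x)\<leftarrow>ps. k * f x z)) z =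
      dtot i (\<lambda>z. fst p * f (snd p) z) z + dtot i (\<lambda>z. \<Sum>(k, x)\<leftarrow>ps. k * f x z) z"
      by (rule dtot_add[OF c s z])
    then show ?case
      using Cons by (simp add: case_prod_unfold dtot_scale[OF f z])
  qed simp
  then show "dtot i (\<lambda>z. \<Lambda> (\<lambda>u. f u z)) z = \<Lambda> (\<lambda>u. dtot i (f u) z)"
    unfolding ps .
qed

end

section \<open>Contractions and shifts of words\<close>

text \<open>The coefficient of \<open>w\<close> after the left derivative along \<open>g\<close>: the alternating sum of the
coefficients of all words that arise by putting \<open>g\<close> into \<open>w\<close>.\<close>

primrec contract :: "'g \<Rightarrow> 'g list \<Rightarrow> ('g list \<Rightarrow> real) \<Rightarrow> real" where
  "contract g [] \<phi> = \<phi> [g]"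
| "contract g (h # w) \<phi> = \<phi> (g # h # w) - contract g w (\<lambda>x. \<phi> (h # x))"

definition lower :: "'n \<Rightarrow> ('n, 'm) ovar \<Rightarrow> ('n, 'm) ovar" where
  "lower i g = (fst g, unbump i (snd g))"

text \<open>The coefficient of \<open>w\<close> after \<open>D\<^sub>i\<close> has acted on the odd letters: the words mapped to \<open>w\<close> are
those with one letter of \<open>w\<close> lowered in direction \<open>i\<close>, provided that this is possible.\<close>

primrec shift :: "'n \<Rightarrow> ('n, 'm) ovar list \<Rightarrow> (('n, 'm) ovar list \<Rightarrow> real) \<Rightarrow> real" where
  "shift i [] \<phi> = 0"
| "shift i (h # w) \<phi> = of_bool (0 < snd h i) * \<phi> (lower i h # w) + shift i w (\<lambda>x. \<phi> (h # x))"

lemma word_functional_contract: "word_functional (contract g w)"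
proof (induction w)
  case Nil
  then show ?case using word_functional_eval by simp
next
  case (Cons h w)
  have "word_functional (\<lambda>\<phi>. \<phi> (g # h # w) + - contract g w (\<lambda>x. \<phi> (h # x)))"
    by (intro word_functional_add word_functional_minus word_functional_eval
        word_functional_precompose[OF Cons])
  then show ?case by simp
qed

lemma word_functional_shift: "word_functional (shift i w)"
proof (induction w)
  case Nil
  then show ?case using word_functional_zero by simp
next
  case (Cons h w)
  have "word_functional (\<lambda>\<phi>. of_bool (0 < snd h i) * \<phi> (lower i h # w))"
    using word_functional_eval word_functional_zero by (cases "0 < snd h i") simp_all
  then have "word_functional (\<lambda>\<phi>. of_bool (0 < snd h i) * \<phi> (lower i h # w) + shift i w (\<lambda>x. \<phi> (h # x)))"
    by (rule word_functional_add[OF _ word_functional_precompose[OF Cons]])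
  then show ?case by simp
qed

lemmas contract_linear = word_functional_linear[OF word_functional_contract]
lemmas shift_linear = word_functional_linear[OF word_functional_shift]

lemma contract_add: "contract g w (\<lambda>x. \<phi> x + \<psi> x) = contract g w \<phi> + contract g w \<psi>"
  and contract_diff: "contract g w (\<lambda>x. \<phi> x - \<psi> x) = contract g w \<phi> - contract g w \<psi>"
  and contract_scale: "contract g w (\<lambda>x. a * \<phi> x) = a * contract g w \<phi>"
  and contract_zero: "contract g w (\<lambda>x. 0) = 0"
  using contract_linear[of g w 1 \<phi> 1 \<psi>] contract_linear[of g w 1 \<phi> "-1" \<psi>]
    contract_linear[of g w a \<phi> 0 \<phi>] contract_linear[of g w 0 \<phi> 0 \<phi>] by simp_all

lemma shift_add: "shift i w (\<lambda>x. \<phi> x + \<psi> x) = shift i w \<phi> + shift i w \<psi>"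
  and shift_diff: "shift i w (\<lambda>x. \<phi> x - \<psi> x) = shift i w \<phi> - shift i w \<psi>"
  and shift_scale: "shift i w (\<lambda>x. a * \<phi> x) = a * shift i w \<phi>"
  and shift_zero: "shift i w (\<lambda>x. 0) = 0"
  using shift_linear[of i w 1 \<phi> 1 \<psi>] shift_linear[of i w 1 \<phi> "-1" \<psi>]
    shift_linear[of i w a \<phi> 0 \<phi>] shift_linear[of i w 0 \<phi> 0 \<phi>] by simp_all

text \<open>Only words one letter longer than \<open>w\<close>, with the letters of \<open>w\<close> and \<open>g\<close>, are inspected; all bounds on degrees and orders rest on this.\<close>

lemma contract_cong:
  assumes "\<And>x. length x = Suc (length w) \<Longrightarrow> insert g (set w) \<subseteq> set x \<Longrightarrow> \<phi> x = \<psi> x"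
  shows "contract g w \<phi> = contract g w \<psi>"
  using assms
proof (induction w arbitrary: \<phi> \<psi>)
  case (Cons h w)
  have "contract g w (\<lambda>x. \<phi> (h # x)) = contract g w (\<lambda>x. \<psi> (h # x))"
    by (intro Cons.IH Cons.prems) auto
  then show ?case using Cons.prems[of "g # h # w"] by auto
qed simp

lemma shift_cong:
  assumes "\<And>x. length x = length w \<Longrightarrow> (\<forall>g\<in>set w. \<exists>h\<in>set x. msize (snd g) \<le> Suc (msize (snd h))) \<Longrightarrow> \<phi> x = \<psi> x"
  shows "shift i w \<phi> = shift i w (\<psi> :: ('n::finite, 'm) ovar list \<Rightarrow> real)"
  using assms
proof (induction w arbitrary: \<phi> \<psi>)
  case (Cons h w)
  have "shift i w (\<lambda>x. \<phi> (h # x)) = shift i w (\<lambda>x. \<psi> (h # x))"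
    by (intro Cons.IH Cons.prems) force+
  moreover have "\<phi> (lower i h # w) = \<psi> (lower i h # w)" if "0 < snd h i"
  proof (rule Cons.prems)
    have "msize (snd h) = Suc (msize (snd (lower i h)))"
      using that msize_bump[of i "unbump i (snd h)"] by (simp add: lower_def bump_unbump)
    then show "\<forall>g\<in>set (h # w). \<exists>k\<in>set (lower i h # w). msize (snd g) \<le> Suc (msize (snd k))"
      by (auto intro: le_SucI)
  qed simp
  ultimately show ?case by auto
qed simp

lemma contract_contract:
  "contract g w (\<lambda>x. contract h x \<phi>) = - contract h w (\<lambda>x. contract g x \<phi>)"
  by (induction w arbitrary: \<phi>) (simp_all add: contract_diff)

lemma shift_shift: "shift i w (\<lambda>x. shift j x \<phi>) = shift j w (\<lambda>x. shift i x \<phi>)"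
proof (induction w arbitrary: \<phi>)
  case (Cons h w)
  have *: "0 < snd (lower i h) j \<and> 0 < snd h i \<longleftrightarrow> 0 < snd (lower j h) i \<and> 0 < snd h j"
    "lower i (lower j h) = lower j (lower i h)"
    by (auto simp: lower_def unbump_def)
  show ?case
    using * by (auto simp: shift_add shift_scale Cons)
qed simp

text \<open>The shift acts on the letters of \<open>w\<close> or on the letter \<open>g\<close> put into it; the latter gives the contraction with
the lowered letter.\<close>

lemma contract_shift:
  "contract g w (\<lambda>u. shift i u \<phi>) =
   shift i w (\<lambda>u. contract g u \<phi>) + of_bool (0 < snd g i) * contract (lower i g) w \<phi>"
  by (induction w arbitrary: \<phi>)
     (simp_all add: contract_add contract_scale contract_zero shift_diff algebra_simps)

definition word_conv :: "('g list \<Rightarrow> real) \<Rightarrow> ('g list \<Rightarrow> real) \<Rightarrow> 'g list \<Rightarrow> real" where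
  "word_conv \<phi> \<psi> w = (\<Sum>i\<le>length w. \<phi> (take i w) * \<psi> (drop i w))"

lemma word_conv_simps [simp]:
  "word_conv \<phi> \<psi> [] = \<phi> [] * \<psi> []"
  "word_conv \<phi> \<psi> (h # w) = \<phi> [] * \<psi> (h # w) + word_conv (\<lambda>x. \<phi> (h # x)) \<psi> w"
  by (simp_all add: word_conv_def sum.atMost_Suc_shift del: sum.atMost_Suc)

lemma word_conv_diff: "word_conv (\<lambda>x. \<phi> x - \<theta> x) \<psi> w = word_conv \<phi> \<psi> w - word_conv \<theta> \<psi> w"
  by (simp add: word_conv_def sum_subtractf algebra_simps)

lemma word_conv_minus: "word_conv (\<lambda>x. - \<phi> x) \<psi> w = - word_conv \<phi> \<psi> w"
  by (simp add: word_conv_def sum_negf)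

text \<open>The letter \<open>g\<close> is put either into the first factor or into the second one, and in the second case it has passed all
letters of the first factor.\<close>

lemma contract_word_conv:
  "contract g w (word_conv \<phi> \<psi>) =
   word_conv (\<lambda>x. contract g x \<phi>) \<psi> w + word_conv (\<lambda>x. (-1) ^ length x * \<phi> x) (\<lambda>x. contract g x \<psi>) w"
  by (induction w arbitrary: \<phi>)
     (simp_all add: contract_add contract_scale word_conv_diff word_conv_minus algebra_simps)

lemma contract_delta_Nil: "contract g w (\<lambda>x. of_bool (x = [])) = 0"
  by (cases w) (simp_all add: contract_zero)

lemma contract_delta_Cons:
  "contract g w (\<lambda>x. of_bool (x = a # u)) =
   of_bool (g = a \<and> w = u) -
   (case w of [] \<Rightarrow> 0 | b # w' \<Rightarrow> of_bool (b = a) * contract g w' (\<lambda>x. of_bool (x = u)))"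
  by (cases w) (auto simp: of_bool_conj contract_scale)

lemma shift_delta_Nil: "shift i w (\<lambda>x. of_bool (x = [])) = 0"
  by (cases w) (simp_all add: shift_zero)

definition raise :: "'n \<Rightarrow> ('n, 'm) ovar \<Rightarrow> ('n, 'm) ovar" where
  "raise i = map_prod id (bump i)"

lemma lower_eq_iff: "0 < snd g i \<and> lower i g = h \<longleftrightarrow> g = raise i h"
  by (cases g; cases h) (auto simp: lower_def raise_def bump_unbump)

lemma shift_delta_Cons:
  "shift i w (\<lambda>x. of_bool (x = a # u)) =
   of_bool (w = raise i a # u) +
   (case w of [] \<Rightarrow> 0 | b # w' \<Rightarrow> of_bool (b = a) * shift i w' (\<lambda>x. of_bool (x = u)))"
proof (cases w)
  case (Cons b w')
  have "of_bool (0 < snd b i) * of_bool (lower i b = a) = (of_bool (b = raise i a) :: real)"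
    using lower_eq_iff[of b i a] by (auto simp flip: of_bool_conj)
  then show ?thesis
    using Cons by (simp add: of_bool_conj shift_scale mult.assoc[symmetric])
qed simp

text \<open>The functional evaluated on the unit function of \<open>u\<close> is the matrix entry by which the left derivative was defined on monomials.\<close>

lemma contract_delta:
  "contract g w (\<lambda>x. of_bool (x = u)) = (\<Sum>j<length u. of_bool (u ! j = g \<and> w = del j u) * (-1) ^ j)"
proof (induction u arbitrary: w)
  case (Cons a u)
  have "(\<Sum>j<length (a # u). of_bool ((a # u) ! j = g \<and> w = del j (a # u)) * (-1) ^ j) =
    of_bool (g = a \<and> w = u) - (\<Sum>j<length u. of_bool (u ! j = g \<and> w = a # del j u) * (-1) ^ j :: real)"
    by (simp add: sum.lessThan_Suc_shift del_def eq_commute[of g] flip: sum_negf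
        del: sum.lessThan_Suc sum_of_bool_mult_eq)
  also have "(\<Sum>j<length u. of_bool (u ! j = g \<and> w = a # del j u) * (-1) ^ j :: real) =
    (case w of [] \<Rightarrow> 0 | b # w' \<Rightarrow> of_bool (b = a) * (\<Sum>j<length u. of_bool (u ! j = g \<and> w' = del j u) * (-1) ^ j))"
    unfolding sum_distrib_left by (cases w) (auto intro!: sum.cong)
  finally show ?case
    unfolding contract_delta_Cons Cons by simp
qed (simp add: contract_delta_Nil)

lemma shift_delta:
  "shift i w (\<lambda>x. of_bool (x = u)) = (\<Sum>j<length u. of_bool (w = u[j := map_prod id (bump i) (u ! j)]))"
proof (induction u arbitrary: w)
  case (Cons a u)
  have "(\<Sum>j<length (a # u). of_bool (w = (a # u)[j := map_prod id (bump i) ((a # u) ! j)])) =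
    of_bool (w = raise i a # u) + (\<Sum>j<length u. of_bool (w = a # u[j := map_prod id (bump i) (u ! j)]) :: real)"
    by (simp only: length_Cons sum.lessThan_Suc_shift list_update_code nth_Cons_0 nth_Cons_Suc raise_def)
  also have "(\<Sum>j<length u. of_bool (w = a # u[j := map_prod id (bump i) (u ! j)]) :: real) =
    (case w of [] \<Rightarrow> 0 | b # w' \<Rightarrow> of_bool (b = a) * (\<Sum>j<length u. of_bool (w' = u[j := map_prod id (bump i) (u ! j)])))"
    unfolding sum_distrib_left by (cases w) (auto intro!: sum.cong)
  finally show ?case
    unfolding shift_delta_Cons Cons by simp
qed (simp add: shift_delta_Nil)

lemma odd_der_left_eq: "odd_der_left g f w z = contract g w (\<lambda>u. f u z)"
  unfolding odd_der_left_def contract_delta[symmetric]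
  by (rule Sum_any_word_functional[OF word_functional_contract])

text \<open>Moving the derivative to the right end instead of the left end costs a sign that depends only on the length of the
result, so everything about right derivatives follows from left ones.\<close>

lemma odd_der_right_eq: "odd_der_right g f w z = (-1) ^ length w * contract g w (\<lambda>u. f u z)"
proof -
  have "(\<Sum>j<length u. of_bool (u ! j = g \<and> w = del j u) * (-1) ^ (length u - Suc j)) =
    (-1) ^ length w * (\<Sum>j<length u. of_bool (u ! j = g \<and> w = del j u) * (-1) ^ j :: real)" for u
    unfolding sum_distrib_left
  proof (intro sum.cong refl)
    fix j assume "j \<in> {..<length u}"
    then have "length (del j u) = j + (length u - Suc j)" by (simp add: del_def)
    then have "(-1) ^ (length u - Suc j) = (-1) ^ length (del j u) * ((-1) ^ j :: real)"
      by (simp add: power_add)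
    then show "of_bool (u ! j = g \<and> w = del j u) * (-1) ^ (length u - Suc j) =
        (-1) ^ length w * (of_bool (u ! j = g \<and> w = del j u) * (-1) ^ j :: real)"
      by auto
  qed
  then have "odd_der_right g f w z = Sum_any (\<lambda>u. contract g w (\<lambda>x. of_bool (x = u)) * ((-1) ^ length w * f u z))"
    unfolding odd_der_right_def contract_delta by (simp add: mult.assoc mult.left_commute)
  also have "\<dots> = contract g w (\<lambda>u. (-1) ^ length w * f u z)"
    by (rule Sum_any_word_functional[OF word_functional_contract])
  finally show ?thesis by (simp add: contract_scale)
qed

lemma (in open_jets) total_der_eq: "total_der i f w z = dtot i (f w) z + shift i w (\<lambda>u. f u z)"
  unfolding total_der_def dtot_def shift_delta[symmetric]
  by (simp add: Sum_any_word_functional[OF word_functional_shift])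

section \<open>Densities of bounded order and operators on them\<close>

definition of_order :: "('n::finite, 'm) jet set \<Rightarrow> nat \<Rightarrow> ('n, 'm) density \<Rightarrow> bool" where
  "of_order D r f \<longleftrightarrow> (\<forall>w. jet_fun D r (f w) \<and>
     (length w > r \<or> (\<exists>g\<in>set w. msize (snd g) > r) \<longrightarrow> (\<forall>z\<in>D. f w z = 0)))"

definition agree :: "('n, 'm) jet set \<Rightarrow> ('n, 'm) density \<Rightarrow> ('n, 'm) density \<Rightarrow> bool" where
  "agree D f g \<longleftrightarrow> (\<forall>w. \<forall>z\<in>D. f w z = g w z)"

text \<open>The second clause contains additivity, homogeneity and also locality: with \<open>b = 0\<close> it says that the
values of \<open>S h\<close> on \<open>D\<close> depend on the values of \<open>h\<close> on \<open>D\<close> only. The order bound \<open>q\<close> is a function so that it can be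
the same for all charts.\<close>

definition density_operator :: "('n::finite, 'm) jet set \<Rightarrow> (nat \<Rightarrow> nat) \<Rightarrow> (('n, 'm) density \<Rightarrow> ('n, 'm) density) \<Rightarrow> bool" where
  "density_operator D q S \<longleftrightarrow>
     (\<forall>r f. of_order D r f \<longrightarrow> of_order D (q r) (S f)) \<and>
     (\<forall>r a b f g h. of_order D r f \<longrightarrow> of_order D r g \<longrightarrow>
        agree D h (\<lambda>w z. a * f w z + b * g w z) \<longrightarrow> agree D (S h) (\<lambda>w z. a * S f w z + b * S g w z))"

text \<open>The generators \<open>C u (g h + h g) v\<close> of the anticommutation ideal.\<close>

definition swap_gen :: "(('n, 'm) jet \<Rightarrow> real) \<Rightarrow> ('n, 'm) ovar list \<Rightarrow> ('n, 'm) ovar \<Rightarrow> ('n, 'm) ovar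
    \<Rightarrow> ('n, 'm) ovar list \<Rightarrow> ('n, 'm) density" where
  "swap_gen C u g h v w z = C z * (of_bool (w = u @ [g, h] @ v) + of_bool (w = u @ [h, g] @ v))"

definition words :: "nat \<Rightarrow> ('n::finite, 'm) ovar list set" where
  "words r = {w. length w \<le> r \<and> (\<forall>g\<in>set w. msize (snd g) \<le> r)}"

lemma finite_letters: "finite {g :: ('n::finite, 'm::finite) ovar. msize (snd g) \<le> r}"
proof -
  have "{g :: ('n, 'm) ovar. msize (snd g) \<le> r} = UNIV \<times> {\<sigma>. msize \<sigma> \<le> r}" by auto
  then show ?thesis by (simp add: finite_multiindices)
qed

lemma finite_words: "finite (words r :: ('n::finite, 'm::finite) ovar list set)"
proof -
  have "words r = {w :: ('n, 'm) ovar list. set w \<subseteq> {g. msize (snd g) \<le> r} \<and> length w \<le> r}"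
    by (auto simp: words_def)
  then show ?thesis using finite_lists_length_le[OF finite_letters] by simp
qed

lemma agree_refl [simp]: "agree D f f"
  and agree_sym: "agree D f g \<Longrightarrow> agree D g f"
  and agree_trans [trans]: "agree D f g \<Longrightarrow> agree D g h \<Longrightarrow> agree D f h"
  and agreeD: "agree D f g \<Longrightarrow> z \<in> D \<Longrightarrow> f w z = g w z"
  by (auto simp: agree_def)

lemma density_operator_order: "density_operator D q S \<Longrightarrow> of_order D r f \<Longrightarrow> of_order D (q r) (S f)"
  and density_operator_linear: "density_operator D q S \<Longrightarrow> of_order D r f \<Longrightarrow> of_order D r g \<Longrightarrow>
    agree D h (\<lambda>w z. a * f w z + b * g w z) \<Longrightarrow> agree D (S h) (\<lambda>w z. a * S f w z + b * S g w z)"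
  unfolding density_operator_def by blast+

lemma density_operator_cong:
  assumes "density_operator D q S" "of_order D r f" "agree D h f"
  shows "agree D (S h) (S f)"
  using density_operator_linear[OF assms(1,2,2), of h 1 0] assms(3) by (simp add: agree_def)

lemma sum_lessThan_add: "(\<Sum>j<m + n :: nat. F j) = (\<Sum>j<m. F j) + (\<Sum>j<n. F (m + j :: nat) :: real)"
  by (induction n) auto

lemma sum_positions_around:
  "(\<Sum>j<length (u @ [g, h] @ v). F j) =
   (\<Sum>j<length u. F j) + F (length u) + F (Suc (length u)) + (\<Sum>j<length v. F (length u + (2 + j)) :: real)"
proof -
  have "length (u @ [g, h] @ v) = length u + (2 + length v)" by simp
  then show ?thesis
    by (simp only: sum_lessThan_add) (simp add: numeral_2_eq_2)
qed

lemma distinct_index_list: "distinct (index_list :: 'n::finite list)"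
  and set_index_list: "set (index_list :: 'n::finite list) = UNIV"
proof -
  have "distinct (index_list :: 'n list) \<and> set (index_list :: 'n list) = UNIV"
    unfolding index_list_def by (rule someI_ex) (metis finite_distinct_list finite)
  then show "distinct (index_list :: 'n list)" "set (index_list :: 'n list) = UNIV" by auto
qed

text \<open>Induction over the factors of a power of operators. Three operators at once, together with a counter, suffice to
transport orders, equations and linear combinations.\<close>

lemma foldr_power_rel:
  assumes "R n f g h"
    and step: "\<And>n i f g h. R n f g h \<Longrightarrow> R (Suc n) (Op i f) (Op' i g) (Op'' i h)"
  shows "R (n + (\<Sum>i\<leftarrow>js. \<sigma> i)) (foldr (\<lambda>i. Op i ^^ \<sigma> i) js f)
    (foldr (\<lambda>i. Op' i ^^ \<sigma> i) js g) (foldr (\<lambda>i. Op'' i ^^ \<sigma> i) js h)"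
proof (induction js)
  case (Cons i js)
  have "R (n + k) ((Op i ^^ k) f) ((Op' i ^^ k) g) ((Op'' i ^^ k) h)" if "R n f g h" for n i f g h k
    using that by (induction k) (auto intro: step)
  from this[OF Cons, where i = i and k = "\<sigma> i"] show ?case
    by (simp add: add.assoc add.commute[of "\<sigma> i"])
qed (simp add: assms(1))

lemma op_power_rel:
  fixes \<sigma> :: "'n::finite \<Rightarrow> nat"
  assumes "R n f g h"
    and "\<And>n i f g h. R n f g h \<Longrightarrow> R (Suc n) (Op i f) (Op' i g) (Op'' i h)"
  shows "R (n + msize \<sigma>) (op_power Op \<sigma> f) (op_power Op' \<sigma> g) (op_power Op'' \<sigma> h)"
proof -
  have "(\<Sum>i\<leftarrow>index_list. \<sigma> i) = msize \<sigma>"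
    by (simp add: msize_def sum_list_distinct_conv_sum_set distinct_index_list set_index_list)
  then show ?thesis
    unfolding op_power_def using foldr_power_rel[of R, OF assms, where js = index_list and \<sigma> = \<sigma>] by simp
qed

lemma anticomm_null_agree: "anticomm_null D f \<Longrightarrow> agree D g f \<Longrightarrow> anticomm_null D g"
proof (erule anticomm_null.cases)
  fix f' assume "agree D g f" "f = f'" "\<And>w z. z \<in> D \<Longrightarrow> f' w z = 0"
  then show "anticomm_null D g"
    by (intro anticomm_null.zero) (simp add: agree_def)
next
  fix f1 r C f' u g' h v
  assume "agree D g f" "f = f'" "anticomm_null D f1" "jet_fun D r C"
    "\<And>w z. z \<in> D \<Longrightarrow> f' w z = f1 w z + C z * (of_bool (w = u @ [g', h] @ v) + of_bool (w = u @ [h, g'] @ v))"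
  then show "anticomm_null D g"
    by (intro anticomm_null.step[of D f1 r C g u g' h v]) (auto simp: agree_def)
qed

lemma anticomm_null_swap_gen:
  "jet_fun D r C \<Longrightarrow> anticomm_null D (swap_gen C u g h v)"
  by (rule anticomm_null.step[of D "\<lambda>w z. 0" r C _ u g h v])
     (auto intro: anticomm_null.zero simp: swap_gen_def)

context open_jets
begin

abbreviation "of_ord \<equiv> of_order D"
abbreviation "agr \<equiv> agree D"
abbreviation "null \<equiv> anticomm_null D"

lemma of_order_jetf: "of_ord r f \<Longrightarrow> jetf r (f w)"
  by (simp add: of_order_def)

lemma of_order_zero: "of_ord r f \<Longrightarrow> length w > r \<or> (\<exists>g\<in>set w. msize (snd g) > r) \<Longrightarrow> z \<in> D \<Longrightarrow> f w z = 0"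
  unfolding of_order_def by blast

lemma of_order_outside_words: "of_ord r f \<Longrightarrow> w \<notin> words r \<Longrightarrow> z \<in> D \<Longrightarrow> f w z = 0"
  unfolding words_def using of_order_zero[of r f w z] by (auto simp: not_le)

lemma of_order_mono: "of_ord r f \<Longrightarrow> r \<le> r' \<Longrightarrow> of_ord r' f"
  unfolding of_order_def using jetf_mono[of r _ r'] by (meson le_less_trans)

lemma of_order_cong: "of_ord r f \<Longrightarrow> agr g f \<Longrightarrow> of_ord r g"
  unfolding of_order_def agree_def using jetf_cong by metis

lemma of_order_lin: "of_ord r f \<Longrightarrow> of_ord r g \<Longrightarrow> of_ord r (\<lambda>w z. a * f w z + b * g w z)"
  unfolding of_order_def by (auto intro!: jetf_add jetf_mult)

lemma of_order_const_zero: "of_ord r (\<lambda>w z. 0)"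
  by (simp add: of_order_def)

lemma of_order_scale: "of_ord r f \<Longrightarrow> of_ord r (\<lambda>w z. a * f w z)"
  using of_order_lin[of r f f a 0] by simp

lemma of_order_add: "of_ord r f \<Longrightarrow> of_ord r g \<Longrightarrow> of_ord r (\<lambda>w z. f w z + g w z)"
  using of_order_lin[of r f g 1 1] by simp

lemma of_order_diff: "of_ord r f \<Longrightarrow> of_ord r g \<Longrightarrow> of_ord r (\<lambda>w z. f w z - g w z)"
  using of_order_lin[of r f g 1 "-1"] by simp

lemma of_order_sum: "(\<And>i. i \<in> I \<Longrightarrow> of_ord r (f i)) \<Longrightarrow> of_ord r (\<lambda>w z. \<Sum>i\<in>I. f i w z)"
  by (induction I rule: infinite_finite_induct) (auto intro: of_order_add of_order_const_zero)

lemma of_order_grade: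
  assumes "of_ord r f" shows "of_ord r (\<lambda>w z. c (length w) * f w z)"
  using assms unfolding of_order_def by (auto intro: jetf_mult)

lemma of_order_swap_gen:
  assumes "jetf r C" shows "\<exists>r. of_ord r (swap_gen C u g h v)"
proof -
  let ?m = "r + length (u @ [g, h] @ v) + (\<Sum>g\<leftarrow>u @ [g, h] @ v. msize (snd g))"
  have big: "msize (snd x) \<le> ?m" if "x \<in> set (u @ [g, h] @ v)" for x
    using member_le_sum_list[of "msize (snd x)" "map (\<lambda>g. msize (snd g)) (u @ [g, h] @ v)"] that by auto
  have "of_ord ?m (swap_gen C u g h v)"
    unfolding of_order_def swap_gen_def
  proof (intro allI conjI impI ballI)
    fix w
    show "jetf ?m (\<lambda>z. C z * (of_bool (w = u @ [g, h] @ v) + of_bool (w = u @ [h, g] @ v)))"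
      by (intro jetf_mult jetf_const jetf_mono[OF assms]) simp
    fix z assume "?m < length w \<or> (\<exists>x\<in>set w. ?m < msize (snd x))"
    then have "w \<noteq> u @ [g, h] @ v" "w \<noteq> u @ [h, g] @ v"
      using big by (fastforce simp: not_less)+
    then show "C z * (of_bool (w = u @ [g, h] @ v) + of_bool (w = u @ [h, g] @ v)) = 0" by simp
  qed
  then show ?thesis by blast
qed

lemma of_order_max2:
  assumes "\<exists>r. of_ord r f" "\<exists>r. of_ord r g"
  obtains r where "of_ord r f" "of_ord r g"
  using assms of_order_mono max.cobounded1 max.cobounded2 by metis

lemma null_of_order: "null f \<Longrightarrow> \<exists>r. of_ord r f"
proof (induction rule: anticomm_null.induct)
  case (zero f)
  then have "agr f (\<lambda>w z. 0)" by (simp add: agree_def)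
  then show ?case using of_order_cong[OF of_order_const_zero] by blast
next
  case (step f r C f' u g h v)
  obtain r' where "of_ord r' f" "of_ord r' (swap_gen C u g h v)"
    using of_order_max2[OF step.IH of_order_swap_gen[OF step.hyps(2)]] .
  then have "of_ord r' (\<lambda>w z. f w z + swap_gen C u g h v w z)" by (rule of_order_add)
  then have "of_ord r' f'"
    by (rule of_order_cong) (simp add: agree_def swap_gen_def step.hyps)
  then show ?case by blast
qed

lemma null_add:
  assumes f: "null f" and g: "null g"
  shows "null (\<lambda>w z. f w z + g w z)"
  using g
proof (induction g rule: anticomm_null.induct)
  case (zero g)
  then show ?case by (intro anticomm_null_agree[OF f]) (simp add: agree_def)
next
  case (step f1 r C f' u g h v)
  show ?case
    by (rule anticomm_null.step[OF step.IH step.hyps(2), of _ u g h v]) (simp add: step.hyps)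
qed

text \<open>The ideal is homogeneous, so it is stable under rescaling by the degree; both the signs of right derivatives and the factor \<open>1 / k\<close> of insertion are of this kind.\<close>

lemma null_grade: "null f \<Longrightarrow> null (\<lambda>w z. c (length w) * f w z)"
proof (induction f rule: anticomm_null.induct)
  case (zero g)
  then show ?case by (auto intro: anticomm_null.zero)
next
  case (step f1 r C f' u g h v)
  show ?case
    by (rule anticomm_null.step[OF step.IH jetf_mult[OF jetf_const[of _ "c (length (u @ [g, h] @ v))"] step.hyps(2)], of _ u g h v])
       (simp add: step.hyps algebra_simps of_bool_def)
qed

lemma null_scale: "null f \<Longrightarrow> null (\<lambda>w z. a * f w z)"
  using null_grade[of f "\<lambda>_. a"] .

lemma null_diff: "null f \<Longrightarrow> null g \<Longrightarrow> null (\<lambda>w z. f w z - g w z)"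
  using null_add[of f "\<lambda>w z. -1 * g w z"] null_scale[of g "-1"] by simp

lemma null_zero: "null (\<lambda>w z. 0)"
  by (rule anticomm_null.zero) simp

lemma null_sum: "(\<And>i. i \<in> I \<Longrightarrow> null (f i)) \<Longrightarrow> null (\<lambda>w z. \<Sum>i\<in>I. f i w z)"
  by (induction I rule: infinite_finite_induct) (auto intro: null_add null_zero)

lemma density_operator_zero:
  assumes "density_operator D q S" "agr f (\<lambda>w z. 0)"
  shows "agr (S f) (\<lambda>w z. 0)"
  using density_operator_linear[OF assms(1) of_order_const_zero of_order_const_zero, of f 0 0] assms(2)
  by simp

lemma density_operator_null:
  assumes S: "density_operator D q S"
    and gen: "\<And>r C u g h v. jetf r C \<Longrightarrow> null (S (swap_gen C u g h v))"
    and "null f"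
  shows "null (S f)"
  using assms(3)
proof (induction f rule: anticomm_null.induct)
  case (zero f)
  then have "agr (S f) (\<lambda>w z. 0)"
    by (intro density_operator_zero[OF S]) (simp add: agree_def)
  then show ?case using anticomm_null_agree null_zero by blast
next
  case (step f r C f' u g h v)
  obtain r' where r': "of_ord r' f" "of_ord r' (swap_gen C u g h v)"
    using of_order_max2[OF null_of_order[OF step.hyps(1)] of_order_swap_gen[OF step.hyps(2)]] .
  have "agr (S f') (\<lambda>w z. 1 * S f w z + 1 * S (swap_gen C u g h v) w z)"
    by (rule density_operator_linear[OF S r']) (simp add: agree_def swap_gen_def step.hyps)
  then show ?case
    using anticomm_null_agree[OF null_add[OF step.IH gen[OF step.hyps(2)]]] by simp
qed

lemma density_operator_sum:
  assumes S: "density_operator D q S" and f: "\<And>i. i \<in> I \<Longrightarrow> of_ord r (f i)"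
  shows "agr (S (\<lambda>w z. \<Sum>i\<in>I. f i w z)) (\<lambda>w z. \<Sum>i\<in>I. S (f i) w z)"
  using f
proof (induction I rule: infinite_finite_induct)
  case (insert i I)
  have "agr (S (\<lambda>w z. \<Sum>i\<in>insert i I. f i w z)) (\<lambda>w z. 1 * S (f i) w z + 1 * S (\<lambda>w z. \<Sum>i\<in>I. f i w z) w z)"
    by (rule density_operator_linear[OF S, of r]) (use insert in \<open>auto intro: of_order_sum simp: agree_def\<close>)
  then show ?case using insert by (simp add: agree_def)
qed (simp_all add: density_operator_zero[OF S])

section \<open>Coordinate derivatives and total derivatives of densities\<close>

definition der :: "('n, 'm) evar \<Rightarrow> ('n, 'm) density \<Rightarrow> ('n, 'm) density" where
  "der v f = (\<lambda>w. pder v (f w))"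

lemma density_operator_der: "density_operator D (\<lambda>r. r) (der v)"
  unfolding density_operator_def
proof (intro conjI allI impI)
  fix r f assume f: "of_ord r f"
  show "of_ord r (der v f)"
    unfolding of_order_def der_def
  proof (intro allI conjI impI ballI)
    fix w :: "('n, 'm) ovar list" and z assume w: "length w > r \<or> (\<exists>g\<in>set w. msize (snd g) > r)" and z: "z \<in> D"
    have "pder v (f w) z = pder v (\<lambda>_. 0) z"
      by (rule pder_cong[OF open_D _ z]) (rule of_order_zero[OF f w])
    then show "pder v (f w) z = 0" by simp
  qed (rule jetf_pder[OF of_order_jetf[OF f]])
next
  fix r a b f g h assume f: "of_ord r f" "of_ord r g" and h: "agr h (\<lambda>w z. a * f w z + b * g w z)"
  show "agr (der v h) (\<lambda>w z. a * der v f w z + b * der v g w z)"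
    unfolding agree_def der_def
  proof (intro allI ballI)
    fix w z assume z: "z \<in> D"
    have c: "jetf r (\<lambda>z. a * f w z)" "jetf r (\<lambda>z. b * g w z)"
      using f of_order_jetf jetf_mult jetf_const by blast+
    have "pder v (h w) z = pder v (\<lambda>z. a * f w z + b * g w z) z"
      by (rule pder_cong[OF open_D _ z]) (rule agreeD[OF h])
    also have "\<dots> = pder v (\<lambda>z. a * f w z) z + pder v (\<lambda>z. b * g w z) z"
      by (intro pder_add jetf_differentiable[OF _ z, of r] c)
    finally show "pder v (h w) z = a * pder v (f w) z + b * pder v (g w) z"
      by (simp add: pder_scale[OF of_order_jetf[OF f(1)] z] pder_scale[OF of_order_jetf[OF f(2)] z])
  qed
qed

lemma density_operator_total_der: "density_operator D Suc (total_der i)"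
  unfolding density_operator_def
proof (intro conjI allI impI)
  fix r f assume f: "of_ord r f"
  show "of_ord (Suc r) (total_der i f)"
    unfolding of_order_def
  proof (intro allI conjI impI ballI)
    fix w
    have "jetf (Suc r) (\<lambda>z. dtot i (f w) z + shift i w (\<lambda>u. f u z))"
      by (intro jetf_add jetf_dtot jetf_mono[OF jetf_word_functional[OF word_functional_shift]])
         (auto intro: of_order_jetf[OF f])
    then show "jetf (Suc r) (total_der i f w)"
      by (rule jetf_cong) (simp add: total_der_eq)
    fix z assume w: "length w > Suc r \<or> (\<exists>g\<in>set w. msize (snd g) > Suc r)" and z: "z \<in> D"
    have "dtot i (f w) z = dtot i (\<lambda>_. 0) z"
      by (rule dtot_cong[OF _ z], rule of_order_zero[OF f]) (use w Suc_lessD in blast)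
    moreover have "shift i w (\<lambda>u. f u z) = shift i w (\<lambda>u. 0)"
    proof (rule shift_cong)
      fix x :: "('n, 'm) ovar list" assume x: "length x = length w" "\<forall>g\<in>set w. \<exists>h\<in>set x. msize (snd g) \<le> Suc (msize (snd h))"
      show "f x z = 0"
      proof (rule of_order_zero[OF f _ z])
        show "length x > r \<or> (\<exists>h\<in>set x. msize (snd h) > r)"
          using w
        proof
          assume "\<exists>g\<in>set w. msize (snd g) > Suc r"
          then obtain g h where "g \<in> set w" "msize (snd g) > Suc r" "h \<in> set x" "msize (snd g) \<le> Suc (msize (snd h))"
            using x(2) by blast
          then show ?thesis by (auto intro!: bexI[of _ h])
        qed (simp add: x(1))
      qed
    qed
    ultimately show "total_der i f w z = 0" by (simp add: total_der_eq shift_zero)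
  qed
next
  fix r a b f g h assume f: "of_ord r f" "of_ord r g" and h: "agr h (\<lambda>w z. a * f w z + b * g w z)"
  show "agr (total_der i h) (\<lambda>w z. a * total_der i f w z + b * total_der i g w z)"
    unfolding agree_def total_der_eq
  proof (intro allI ballI)
    fix w z assume z: "z \<in> D"
    have c: "jetf r (\<lambda>z. a * f w z)" "jetf r (\<lambda>z. b * g w z)"
      using f of_order_jetf jetf_mult jetf_const by blast+
    have "dtot i (h w) z = dtot i (\<lambda>z. a * f w z + b * g w z) z"
      by (rule dtot_cong[OF _ z]) (rule agreeD[OF h])
    also have "\<dots> = a * dtot i (f w) z + b * dtot i (g w) z"
      using dtot_add[OF c z] f by (simp add: dtot_scale[OF of_order_jetf z])
    finally show "dtot i (h w) z + shift i w (\<lambda>u. h u z) =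
      a * (dtot i (f w) z + shift i w (\<lambda>u. f u z)) + b * (dtot i (g w) z + shift i w (\<lambda>u. g u z))"
      by (simp add: agreeD[OF h z] shift_linear algebra_simps)
  qed
qed

lemma density_operator_odd_der_left: "density_operator D (\<lambda>r. r) (odd_der_left g)"
  unfolding density_operator_def
proof (intro conjI allI impI)
  fix r f assume f: "of_ord r f"
  show "of_ord r (odd_der_left g f)"
    unfolding of_order_def
  proof (intro allI conjI impI ballI)
    fix w
    have "jetf r (\<lambda>z. contract g w (\<lambda>u. f u z))"
      by (rule jetf_word_functional[OF word_functional_contract of_order_jetf[OF f]])
    then show "jetf r (odd_der_left g f w)"
      by (rule jetf_cong) (rule odd_der_left_eq)
    fix z assume w: "length w > r \<or> (\<exists>g\<in>set w. msize (snd g) > r)" and z: "z \<in> D"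
    have "contract g w (\<lambda>u. f u z) = contract g w (\<lambda>u. 0)"
      by (rule contract_cong, rule of_order_zero[OF f _ z]) (use w in auto)
    then show "odd_der_left g f w z = 0"
      by (simp add: odd_der_left_eq contract_zero)
  qed
next
  fix r a b f f' h assume h: "agr h (\<lambda>w z. a * f w z + b * f' w z)"
  show "agr (odd_der_left g h) (\<lambda>w z. a * odd_der_left g f w z + b * odd_der_left g f' w z)"
    by (simp add: agree_def odd_der_left_eq agreeD[OF h] contract_linear)
qed

lemma odd_der_right_left: "odd_der_right g f w z = (-1) ^ length w * odd_der_left g f w z"
  by (simp add: odd_der_left_eq odd_der_right_eq)

lemma density_operator_odd_der_right: "density_operator D (\<lambda>r. r) (odd_der_right g)"
  unfolding density_operator_def
proof (intro conjI allI impI)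
  fix r f assume f: "of_ord r f"
  show "of_ord r (odd_der_right g f)"
    by (rule of_order_cong[OF of_order_grade[OF density_operator_order[OF density_operator_odd_der_left[of g] f],
        of "\<lambda>n. (-1) ^ n"]]) (simp add: agree_def odd_der_right_left)
next
  fix r a b f f' h assume h: "agr h (\<lambda>w z. a * f w z + b * f' w z)"
  show "agr (odd_der_right g h) (\<lambda>w z. a * odd_der_right g f w z + b * odd_der_right g f' w z)"
    by (simp add: agree_def odd_der_right_eq agreeD[OF h] contract_linear algebra_simps)
qed

lemma der_outside: "of_ord r f \<Longrightarrow> r < msize \<sigma> \<Longrightarrow> agr (der (Qv a \<sigma>) f) (\<lambda>w z. 0)"
  unfolding agree_def der_def
  by (auto intro!: jetf_pder_outside[OF of_order_jetf] simp: jet_vars_def)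

lemma odd_der_left_outside:
  assumes "of_ord r f" "r < msize (snd g)"
  shows "agr (odd_der_left g f) (\<lambda>w z. 0)"
proof -
  have "contract g w (\<lambda>u. f u z) = contract g w (\<lambda>u. 0)" if "z \<in> D" for w z
    by (rule contract_cong, rule of_order_zero[OF assms(1) _ that]) (use assms(2) in auto)
  then show ?thesis by (simp add: agree_def odd_der_left_eq contract_zero)
qed

lemma odd_der_right_outside: "of_ord r f \<Longrightarrow> r < msize (snd g) \<Longrightarrow> agr (odd_der_right g f) (\<lambda>w z. 0)"
  using odd_der_left_outside[of r f g] by (simp add: agree_def odd_der_right_left)

lemma null_der: "null f \<Longrightarrow> null (der v f)"
proof (rule density_operator_null[OF density_operator_der])
  fix r C u g h w assume C: "jetf r C"
  have "agr (der v (swap_gen C u g h w)) (swap_gen (pder v C) u g h w)"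
    unfolding agree_def der_def swap_gen_def
    using pder_scale[OF C] by (simp only: mult.commute[of "C _"] mult.commute[of "pder v C _"]) blast
  then show "null (der v (swap_gen C u g h w))"
    by (rule anticomm_null_agree[OF anticomm_null_swap_gen[OF jetf_pder[OF C]]])
qed

text \<open>Derivatives of the letters of \<open>u\<close> and \<open>v\<close> give generators again; removing \<open>g\<close> from
\<open>g h\<close> and from \<open>h g\<close> leaves the same word, from neighbouring positions and hence with opposite signs.\<close>

lemma null_odd_der_left: "null f \<Longrightarrow> null (odd_der_left x f)"
proof (rule density_operator_null[OF density_operator_odd_der_left])
  fix r C u g h v assume C: "jetf r C"
  let ?d = "\<lambda>k w j. of_bool (k ! j = x \<and> w = del j k) * (-1) ^ j :: real"
  let ?L = "\<lambda>w z. \<Sum>j<length u. swap_gen (\<lambda>z. (of_bool (u ! j = x) * (-1) ^ j) * C z) (del j u) g h v w z"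
  let ?R = "\<lambda>w z. \<Sum>j<length v. swap_gen (\<lambda>z. (of_bool (v ! j = x) * (-1) ^ (length u + j)) * C z) u g h (del j v) w z"
  have eq: "odd_der_left x (swap_gen C u g h v) w z = ?L w z + ?R w z" for w z
  proof -
    have "odd_der_left x (swap_gen C u g h v) w z =
      C z * ((\<Sum>j<length (u @ [g, h] @ v). ?d (u @ [g, h] @ v) w j) + (\<Sum>j<length (u @ [h, g] @ v). ?d (u @ [h, g] @ v) w j))"
      unfolding odd_der_left_eq swap_gen_def contract_scale contract_add contract_delta ..
    also have "\<dots> = ?L w z + ?R w z"
      unfolding sum_positions_around
      by (simp add: swap_gen_def del_def nth_append sum_distrib_left sum.distrib algebra_simps
          of_bool_conj numeral_3_eq_3 del: sum_of_bool_mult_eq sum_mult_of_bool_eq sum_of_bool_eq)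
    finally show ?thesis .
  qed
  have "null (\<lambda>w z. ?L w z + ?R w z)"
    by (intro null_add null_sum anticomm_null_swap_gen[of D r] jetf_mult[OF jetf_const C])
  then show "null (odd_der_left x (swap_gen C u g h v))"
    by (rule anticomm_null_agree) (simp add: agree_def eq)
qed

lemma null_odd_der_right: "null f \<Longrightarrow> null (odd_der_right x f)"
  by (rule anticomm_null_agree[OF null_grade[OF null_odd_der_left, of f "\<lambda>n. (-1) ^ n" x]])
     (simp_all add: agree_def odd_der_right_left)

text \<open>Shifting the letters of \<open>g h + h g\<close> gives \<open>g' h + h g'\<close> and \<open>g h' + h' g\<close>, which are generators again.\<close>

lemma null_total_der: "null f \<Longrightarrow> null (total_der i f)"
proof (rule density_operator_null[OF density_operator_total_der])
  fix r C u g h v assume C: "jetf r C"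
  let ?d = "\<lambda>k w j. of_bool (w = k[j := map_prod id (bump i) (k ! j)]) :: real"
  let ?L = "\<lambda>w z. \<Sum>j<length u. swap_gen C (u[j := map_prod id (bump i) (u ! j)]) g h v w z"
  let ?M = "\<lambda>w z. swap_gen C u (map_prod id (bump i) g) h v w z + swap_gen C u g (map_prod id (bump i) h) v w z"
  let ?R = "\<lambda>w z. \<Sum>j<length v. swap_gen C u g h (v[j := map_prod id (bump i) (v ! j)]) w z"
  let ?S = "swap_gen (dtot i C) u g h v"
  have eq: "total_der i (swap_gen C u g h v) w z = ?S w z + (?L w z + (?M w z + ?R w z))" if z: "z \<in> D" for w z
  proof -
    have "dtot i (swap_gen C u g h v w) z = ?S w z"
      unfolding swap_gen_def using dtot_scale[OF C z]
      by (simp only: mult.commute[of "C _"] mult.commute[of "dtot i C _"])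
    moreover have "shift i w (\<lambda>w. swap_gen C u g h v w z) =
      C z * ((\<Sum>j<length (u @ [g, h] @ v). ?d (u @ [g, h] @ v) w j) + (\<Sum>j<length (u @ [h, g] @ v). ?d (u @ [h, g] @ v) w j))"
      unfolding swap_gen_def shift_scale shift_add shift_delta ..
    moreover have "\<dots> = ?L w z + (?M w z + ?R w z)"
      unfolding sum_positions_around
      by (simp add: swap_gen_def list_update_append nth_append sum_distrib_left sum.distrib algebra_simps
          del: sum_of_bool_mult_eq sum_mult_of_bool_eq sum_of_bool_eq)
    ultimately show ?thesis by (simp add: total_der_eq)
  qed
  have "null (\<lambda>w z. ?S w z + (?L w z + (?M w z + ?R w z)))"
    by (intro null_add null_sum anticomm_null_swap_gen[of D "Suc r"] jetf_dtot jetf_mono[OF C]) (auto intro: C)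
  then show "null (total_der i (swap_gen C u g h v))"
    by (rule anticomm_null_agree) (simp add: agree_def eq)
qed

section \<open>Commutation with total derivatives\<close>

lemma total_der_commute:
  assumes f: "of_ord r f"
  shows "agr (total_der i (total_der j f)) (total_der j (total_der i f))"
proof -
  have expand: "total_der i (total_der j f) w z = dtot i (dtot j (f w)) z + shift j w (\<lambda>u. dtot i (f u) z)
      + (shift i w (\<lambda>u. dtot j (f u) z) + shift i w (\<lambda>u. shift j u (\<lambda>x. f x z)))" if z: "z \<in> D" for i j w z
  proof -
    have "dtot i (total_der j f w) z = dtot i (\<lambda>z. dtot j (f w) z + shift j w (\<lambda>u. f u z)) z"
      by (rule dtot_cong[OF _ z]) (rule total_der_eq)
    also have "\<dots> = dtot i (dtot j (f w)) z + dtot i (\<lambda>z. shift j w (\<lambda>u. f u z)) z"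
      using of_order_jetf[OF f]
      by (intro dtot_add[OF _ _ z, of "Suc r"] jetf_dtot jetf_mono[OF jetf_word_functional[OF word_functional_shift]]) auto
    also have "dtot i (\<lambda>z. shift j w (\<lambda>u. f u z)) z = shift j w (\<lambda>u. dtot i (f u) z)"
      by (rule dtot_word_functional[OF word_functional_shift of_order_jetf[OF f] z])
    moreover have "shift i w (\<lambda>u. total_der j f u z) =
        shift i w (\<lambda>u. dtot j (f u) z) + shift i w (\<lambda>u. shift j u (\<lambda>x. f x z))"
      by (simp only: total_der_eq shift_add)
    ultimately show ?thesis
      unfolding total_der_eq[of i "total_der j f" w z] by (simp only:)
  qed
  show ?thesis
    by (simp add: agree_def expand dtot_commute[OF of_order_jetf[OF f], of _ i j] shift_shift[of i _ j])
qed

lemma der_total_der: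
  assumes f: "of_ord r f"
  shows "agr (der (Qv a \<sigma>) (total_der i f))
    (\<lambda>w z. total_der i (der (Qv a \<sigma>) f) w z + of_bool (0 < \<sigma> i) * der (Qv a (unbump i \<sigma>)) f w z)"
  unfolding agree_def
proof (intro allI ballI)
  fix w z assume z: "z \<in> D"
  let ?v = "Qv a \<sigma>"
  have "der ?v (total_der i f) w z = pder ?v (\<lambda>z. dtot i (f w) z + shift i w (\<lambda>u. f u z)) z"
    unfolding der_def by (rule pder_cong[OF open_D _ z]) (rule total_der_eq)
  also have "\<dots> = pder ?v (dtot i (f w)) z + pder ?v (\<lambda>z. shift i w (\<lambda>u. f u z)) z"
    by (rule pder_add)
       (rule jetf_differentiable[OF _ z] jetf_dtot jetf_word_functional[OF word_functional_shift] of_order_jetf[OF f])+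
  also have "pder ?v (\<lambda>z. shift i w (\<lambda>u. f u z)) z = shift i w (\<lambda>u. pder ?v (f u) z)"
    by (rule pder_word_functional[OF word_functional_shift of_order_jetf[OF f] z])
  finally show "der ?v (total_der i f) w z =
    total_der i (der ?v f) w z + of_bool (0 < \<sigma> i) * der (Qv a (unbump i \<sigma>)) f w z"
    unfolding total_der_eq[of i "der ?v f" w z] pder_dtot[OF of_order_jetf[OF f] z]
    by (simp add: der_def)
qed

lemma odd_der_left_total_der:
  assumes f: "of_ord r f"
  shows "agr (odd_der_left (a, \<sigma>) (total_der i f))
    (\<lambda>w z. total_der i (odd_der_left (a, \<sigma>) f) w z + of_bool (0 < \<sigma> i) * odd_der_left (a, unbump i \<sigma>) f w z)"
  unfolding agree_def
proof (intro allI ballI)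
  fix w z assume z: "z \<in> D"
  have "dtot i (odd_der_left (a, \<sigma>) f w) z = dtot i (\<lambda>z. contract (a, \<sigma>) w (\<lambda>u. f u z)) z"
    by (rule dtot_cong[OF _ z]) (rule odd_der_left_eq)
  also have "\<dots> = contract (a, \<sigma>) w (\<lambda>u. dtot i (f u) z)"
    by (rule dtot_word_functional[OF word_functional_contract of_order_jetf[OF f] z])
  finally show "odd_der_left (a, \<sigma>) (total_der i f) w z =
    total_der i (odd_der_left (a, \<sigma>) f) w z + of_bool (0 < \<sigma> i) * odd_der_left (a, unbump i \<sigma>) f w z"
    by (simp add: total_der_eq odd_der_left_eq contract_add contract_shift lower_def)
qed

lemma total_der_grade:
  assumes f: "of_ord r f"
  shows "agr (total_der i (\<lambda>w z. c (length w) * f w z)) (\<lambda>w z. c (length w) * total_der i f w z)"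
  unfolding agree_def
proof (intro allI ballI)
  fix w z assume z: "z \<in> D"
  have "shift i w (\<lambda>u. c (length u) * f u z) = shift i w (\<lambda>u. c (length w) * f u z)"
    by (rule shift_cong) simp
  then show "total_der i (\<lambda>w z. c (length w) * f w z) w z = c (length w) * total_der i f w z"
    by (simp add: total_der_eq shift_scale dtot_scale[OF of_order_jetf[OF f] z] algebra_simps)
qed

lemma odd_der_right_total_der:
  assumes f: "of_ord r f"
  shows "agr (odd_der_right (a, \<sigma>) (total_der i f))
    (\<lambda>w z. total_der i (odd_der_right (a, \<sigma>) f) w z + of_bool (0 < \<sigma> i) * odd_der_right (a, unbump i \<sigma>) f w z)"
proof -
  have "odd_der_right g f = (\<lambda>w z. (-1) ^ length w * odd_der_left g f w z)" for g f
    by (intro ext) (rule odd_der_right_left)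
  note right = this
  have "agr (total_der i (odd_der_right (a, \<sigma>) f)) (\<lambda>w z. (-1) ^ length w * total_der i (odd_der_left (a, \<sigma>) f) w z)"
    unfolding right
    by (rule total_der_grade[OF density_operator_order[OF density_operator_odd_der_left f]])
  then show ?thesis
    using odd_der_left_total_der[OF f, of a \<sigma> i]
    by (simp add: agree_def odd_der_right_left distrib_left)
qed

end

section \<open>Products of words\<close>

lemma word_conv_delta_left: "word_conv (\<lambda>x. of_bool (x = u)) (\<lambda>x. of_bool (x = v)) w = of_bool (w = u @ v)"
proof (induction u arbitrary: w)
  case Nil
  show ?case
  proof (cases w)
    case (Cons h w')
    then show ?thesis by (simp add: word_conv_def)
  qed simp
next
  case (Cons a u)
  have "word_conv (\<lambda>x. of_bool (h # x = a # u)) (\<lambda>x. of_bool (x = v)) w' = of_bool (h = a) * word_conv (\<lambda>x. of_bool (x = u)) (\<lambda>x. of_bool (x = v)) w'" for h w'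
    by (cases "h = a") (simp_all add: word_conv_def)
  then show ?case
    by (cases w) (auto simp: Cons simp del: list.inject)
qed

lemma word_conv_sum_left: "word_conv (\<lambda>x. \<Sum>i\<in>I. c i * \<phi> i x) \<psi> w = (\<Sum>i\<in>I. c i * word_conv (\<phi> i) \<psi> w)"
  unfolding word_conv_def sum_distrib_left sum_distrib_right by (subst sum.swap) (simp add: mult.assoc)

lemma word_conv_sum_right: "word_conv \<phi> (\<lambda>x. \<Sum>i\<in>I. c i * \<psi> i x) w = (\<Sum>i\<in>I. c i * word_conv \<phi> (\<psi> i) w)"
  unfolding word_conv_def sum_distrib_left by (subst sum.swap) (simp add: mult_ac)

lemma word_conv_grade:
  "(-1) ^ length w * word_conv \<phi> \<psi> w =
    word_conv (\<lambda>x. (-1) ^ length x * \<phi> x) (\<lambda>x. (-1) ^ length x * \<psi> x) w"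
proof -
  have "(-1) ^ length w = (-1 :: real) ^ i * (-1) ^ (length w - i)" if "i \<le> length w" for i
    using that by (simp flip: power_add)
  then show ?thesis
    unfolding word_conv_def sum_distrib_left by (intro sum.cong) (simp_all add: mult_ac)
qed

lemma mult_eq_word_conv: "mult f g w z = word_conv (\<lambda>u. f u z) (\<lambda>u. g u z) w"
  by (simp add: mult_def word_conv_def)

context open_jets
begin

section \<open>Powers of total derivatives\<close>

lemma of_order_total_der: "of_ord r f \<Longrightarrow> of_ord (Suc r) (total_der i f)"
  by (rule density_operator_order[OF density_operator_total_der])

lemma density_operator_op_power: "density_operator D (\<lambda>r. r + msize \<sigma>) (op_power total_der \<sigma>)"
  unfolding density_operator_def
proof (intro conjI allI impI)
  fix r a b f g h assume f: "of_ord r f" and g: "of_ord r g" and h: "agr h (\<lambda>w z. a * f w z + b * g w z)"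
  let ?R = "\<lambda>n f g h. of_ord n f \<and> of_ord n g \<and> agr h (\<lambda>w z. a * f w z + b * g w z)"
  have "?R (r + msize \<sigma>) (op_power total_der \<sigma> f) (op_power total_der \<sigma> g) (op_power total_der \<sigma> h)"
    by (rule op_power_rel[of ?R])
       (use f g h of_order_total_der density_operator_linear[OF density_operator_total_der] in auto)
  then show "agr (op_power total_der \<sigma> h) (\<lambda>w z. a * op_power total_der \<sigma> f w z + b * op_power total_der \<sigma> g w z)"
    by blast
next
  fix r f assume f: "of_ord r f"
  show "of_ord (r + msize \<sigma>) (op_power total_der \<sigma> f)"
    using op_power_rel[of "\<lambda>n f g h. of_ord n f", OF f of_order_total_der] .
qed

lemma null_op_power: "null f \<Longrightarrow> null (op_power total_der \<sigma> f)"
  using op_power_rel[of "\<lambda>n f g h. null f", OF _ null_total_der] .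

text \<open>As the total derivatives commute, the additional one can be moved from the innermost place to the place of the factors with
the same index.\<close>

lemma op_power_bump:
  assumes f: "of_ord r f"
  shows "agr (op_power total_der \<sigma> (total_der i f)) (op_power total_der (bump i \<sigma>) f)"
proof -
  let ?P = "\<lambda>\<sigma> js. foldr (\<lambda>i. total_der i ^^ \<sigma> i) js"
  let ?R = "\<lambda>n f g h. of_ord n f \<and> agr g (total_der i f)"
  have step: "?R (Suc n) (total_der j f) (total_der j g) (total_der j h)" if "?R n f g h" for n j f g and h :: "('n, 'm) density"
  proof
    have f: "of_ord n f" and g: "agr g (total_der i f)" using that by auto
    show "of_ord (Suc n) (total_der j f)" by (rule of_order_total_der[OF f])
    have "agr (total_der j g) (total_der j (total_der i f))"
      by (rule density_operator_cong[OF density_operator_total_der of_order_total_der[OF f] g])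
    also note total_der_commute[OF f, of j i]
    finally show "agr (total_der j g) (total_der i (total_der j f))" .
  qed
  have commute: "agr (?P \<sigma> js (total_der i f)) (total_der i (?P \<sigma> js f))" if "of_ord r f" for js f r
    using foldr_power_rel[of ?R r f "total_der i f" undefined total_der total_der total_der \<sigma> js, OF _ step] that
    by simp
  obtain xs ys where list: "index_list = xs @ i # ys"
    using set_index_list[where 'n = 'n] by (metis UNIV_I split_list)
  have "distinct (xs @ i # ys)"
    unfolding list[symmetric] by (rule distinct_index_list)
  then have i: "i \<notin> set xs" "i \<notin> set ys" by auto
  have same: "?P (bump i \<sigma>) js f = ?P \<sigma> js f" if "i \<notin> set js" for js and f :: "('n, 'm) density"
    using that by (induction js) (auto simp: bump_def)
  let ?Y = "(total_der i ^^ \<sigma> i) (?P \<sigma> ys f)"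
  have "op_power total_der (bump i \<sigma>) f = ?P \<sigma> xs (total_der i ?Y)"
    unfolding op_power_def list using same i by simp
  moreover have "op_power total_der \<sigma> f = ?P \<sigma> xs ?Y"
    unfolding op_power_def list by simp
  moreover have "of_ord (r + (\<Sum>i\<leftarrow>i # ys. \<sigma> i)) (?P \<sigma> (i # ys) f)"
    using foldr_power_rel[of "\<lambda>n f g h. of_ord n f" r f, OF f of_order_total_der] .
  then have "agr (?P \<sigma> xs (total_der i ?Y)) (total_der i (?P \<sigma> xs ?Y))"
    using commute[of _ ?Y xs] by simp
  moreover have "agr (op_power total_der \<sigma> (total_der i f)) (total_der i (op_power total_der \<sigma> f))"
    unfolding op_power_def using commute[OF f] .
  ultimately show ?thesis
    by (simp add: agree_def)
qed

section \<open>Variational derivatives\<close>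

text \<open>What the three kinds of derivatives along the jets of one field, \<open>\<partial>/\<partial>q\<^sub>\<sigma>\<close> and the left and right
\<open>\<partial>/\<partial>b\<^sub>\<sigma>\<close>, have in common. The third clause is the relation \<open>[\<partial>\<^sub>\<sigma>, D\<^sub>i] = \<partial>\<close> along \<open>\<sigma>\<close> lowered in
direction \<open>i\<close>, which makes total derivatives variationally trivial.\<close>

definition variation_family :: "(('n \<Rightarrow> nat) \<Rightarrow> ('n, 'm) density \<Rightarrow> ('n, 'm) density) \<Rightarrow> bool" where
  "variation_family A \<longleftrightarrow>
     (\<forall>\<sigma>. density_operator D (\<lambda>r. r) (A \<sigma>)) \<and>
     (\<forall>r f \<sigma>. of_ord r f \<longrightarrow> r < msize \<sigma> \<longrightarrow> agr (A \<sigma> f) (\<lambda>w z. 0)) \<and>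
     (\<forall>r f i \<sigma>. of_ord r f \<longrightarrow> agr (A \<sigma> (total_der i f))
        (\<lambda>w z. total_der i (A \<sigma> f) w z + of_bool (0 < \<sigma> i) * A (unbump i \<sigma>) f w z)) \<and>
     (\<forall>f \<sigma>. null f \<longrightarrow> null (A \<sigma> f))"

lemma variation_family_q: "variation_family (\<lambda>\<sigma>. der (Qv a \<sigma>))"
  and variation_family_left: "variation_family (\<lambda>\<sigma>. odd_der_left (a, \<sigma>))"
  and variation_family_right: "variation_family (\<lambda>\<sigma>. odd_der_right (a, \<sigma>))"
  unfolding variation_family_def
  using density_operator_der der_outside der_total_der null_der
    density_operator_odd_der_left odd_der_left_outside odd_der_left_total_der null_odd_der_left
    density_operator_odd_der_right odd_der_right_outside odd_der_right_total_der null_odd_der_right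
  by simp_all

definition variation :: "(('n \<Rightarrow> nat) \<Rightarrow> ('n, 'm) density \<Rightarrow> ('n, 'm) density) \<Rightarrow> ('n, 'm) density \<Rightarrow> ('n, 'm) density" where
  "variation A f = euler_sum (\<lambda>\<sigma>. A \<sigma> f)"

lemma var_q_eq: "var_q a = variation (\<lambda>\<sigma>. der (Qv a \<sigma>))"
  and var_b_left_eq: "var_b_left a = variation (\<lambda>\<sigma>. odd_der_left (a, \<sigma>))"
  and var_b_right_eq: "var_b_right a = variation (\<lambda>\<sigma>. odd_der_right (a, \<sigma>))"
  by (auto simp: variation_def var_q_def der_def var_b_left_def var_b_right_def)

context
  fixes A :: "('n \<Rightarrow> nat) \<Rightarrow> ('n, 'm) density \<Rightarrow> ('n, 'm) density"
  assumes A: "variation_family A"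
begin

lemma A_operator: "density_operator D (\<lambda>r. r) (A \<sigma>)"
  and A_outside: "of_ord r f \<Longrightarrow> r < msize \<sigma> \<Longrightarrow> agr (A \<sigma> f) (\<lambda>w z. 0)"
  and A_total_der: "of_ord r f \<Longrightarrow> agr (A \<sigma> (total_der i f))
        (\<lambda>w z. total_der i (A \<sigma> f) w z + of_bool (0 < \<sigma> i) * A (unbump i \<sigma>) f w z)"
  and A_null: "null f \<Longrightarrow> null (A \<sigma> f)"
  using A unfolding variation_family_def by blast+

lemma A_order: "of_ord r f \<Longrightarrow> of_ord r (A \<sigma> f)"
  using density_operator_order[OF A_operator] .

lemma A_power_outside: "of_ord r f \<Longrightarrow> r < msize \<sigma> \<Longrightarrow> z \<in> D \<Longrightarrow> op_power total_der \<tau> (A \<sigma> f) w z = 0"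
  using density_operator_zero[OF density_operator_op_power A_outside] by (auto simp: agree_def)

lemma variation_eq_sum:
  assumes f: "of_ord r f" and "r \<le> R" and z: "z \<in> D"
  shows "variation A f w z = (\<Sum>\<sigma>\<in>{\<sigma>. msize \<sigma> \<le> R}. (-1) ^ msize \<sigma> * op_power total_der \<sigma> (A \<sigma> f) w z)"
  unfolding variation_def euler_sum_def
proof (rule Sum_any.expand_superset[OF finite_multiindices], safe)
  fix \<sigma> :: "'n \<Rightarrow> nat" assume "(-1) ^ msize \<sigma> * op_power total_der \<sigma> (A \<sigma> f) w z \<noteq> 0"
  then show "msize \<sigma> \<le> R"
    using A_power_outside[OF f _ z, of \<sigma> \<sigma> w] assms(2) by (cases "r < msize \<sigma>") auto
qed

lemma density_operator_variation: "density_operator D (\<lambda>r. 2 * r) (variation A)"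
  unfolding density_operator_def
proof (intro conjI allI impI)
  fix r f assume f: "of_ord r f"
  have "of_ord (2 * r) (\<lambda>w z. \<Sum>\<sigma>\<in>{\<sigma>. msize \<sigma> \<le> r}. (-1) ^ msize \<sigma> * op_power total_der \<sigma> (A \<sigma> f) w z)"
    by (intro of_order_sum of_order_scale
        of_order_mono[OF density_operator_order[OF density_operator_op_power A_order[OF f]]]) auto
  then show "of_ord (2 * r) (variation A f)"
    by (rule of_order_cong) (simp add: agree_def variation_eq_sum[OF f])
next
  fix r a b f g h assume f: "of_ord r f" and g: "of_ord r g" and h: "agr h (\<lambda>w z. a * f w z + b * g w z)"
  have r: "of_ord r h" using of_order_cong[OF of_order_lin[OF f g] h] .
  have "agr (A \<sigma> h) (\<lambda>w z. a * A \<sigma> f w z + b * A \<sigma> g w z)" for \<sigma>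
    by (rule density_operator_linear[OF A_operator f g h])
  then have "agr (op_power total_der \<tau> (A \<sigma> h))
      (\<lambda>w z. a * op_power total_der \<tau> (A \<sigma> f) w z + b * op_power total_der \<tau> (A \<sigma> g) w z)" for \<sigma> \<tau>
    by (rule density_operator_linear[OF density_operator_op_power A_order[OF f] A_order[OF g]])
  then show "agr (variation A h) (\<lambda>w z. a * variation A f w z + b * variation A g w z)"
    by (simp add: agree_def variation_eq_sum[OF f le_refl] variation_eq_sum[OF g le_refl]
        variation_eq_sum[OF r le_refl] sum_distrib_left sum.distrib algebra_simps)
qed

lemma null_variation:
  assumes f: "null f" shows "null (variation A f)"
proof -
  obtain r where r: "of_ord r f" using null_of_order[OF f] by blast
  have "null (\<lambda>w z. \<Sum>\<sigma>\<in>{\<sigma>. msize \<sigma> \<le> r}. (-1) ^ msize \<sigma> * op_power total_der \<sigma> (A \<sigma> f) w z)"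
    by (intro null_sum null_scale null_op_power A_null f)
  then show ?thesis
    by (rule anticomm_null_agree) (simp add: agree_def variation_eq_sum[OF r])
qed

text \<open>With \<open>[A\<^sub>\<sigma>, D\<^sub>i]\<close> inserted, the term with \<open>\<sigma>\<close> is \<open>(-1)\<^bsup>|\<sigma>|\<^esup> D\<^sub>\<sigma> D\<^sub>i A\<^sub>\<sigma> f\<close> plus the same
expression for the lowered index with the opposite sign, so the alternating sum telescopes.\<close>

lemma variation_total_der:
  assumes f: "of_ord r f"
  shows "agr (variation A (total_der i f)) (\<lambda>w z. 0)"
  unfolding agree_def
proof (intro allI ballI)
  fix w z assume z: "z \<in> D"
  \<comment> \<open>\<open>Y\<close> at a raised index is \<open>X\<close> at the original one; the order of \<open>f\<close> kills \<open>X\<close> beyond \<open>r\<close>.\<close>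
  define X where "X \<sigma> = op_power total_der (bump i \<sigma>) (A \<sigma> f) w z" for \<sigma>
  define Y where "Y \<sigma> = op_power total_der \<sigma> (A (unbump i \<sigma>) f) w z" for \<sigma>
  let ?M = "\<lambda>r. {\<sigma> :: 'n \<Rightarrow> nat. msize \<sigma> \<le> r}"
  have expand: "op_power total_der \<sigma> (A \<sigma> (total_der i f)) w z = X \<sigma> + of_bool (0 < \<sigma> i) * Y \<sigma>" for \<sigma>
  proof -
    let ?P = "op_power total_der \<sigma>"
    have "of_ord (Suc r) (total_der i (A \<sigma> f))" "of_ord (Suc r) (A (unbump i \<sigma>) f)"
      using of_order_total_der[OF A_order[OF f]] of_order_mono[OF A_order[OF f]] by auto
    from density_operator_linear[OF density_operator_op_power this, of "A \<sigma> (total_der i f)" 1 "of_bool (0 < \<sigma> i)" \<sigma>]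
    have "?P (A \<sigma> (total_der i f)) w z =
        ?P (total_der i (A \<sigma> f)) w z + of_bool (0 < \<sigma> i) * ?P (A (unbump i \<sigma>) f) w z"
      using A_total_der[OF f] z by (simp add: agree_def)
    then show ?thesis
      using agreeD[OF op_power_bump[OF A_order[OF f]] z, of \<sigma> i \<sigma> w] by (simp add: X_def Y_def)
  qed
  have "variation A (total_der i f) w z =
    (\<Sum>\<sigma>\<in>?M (Suc r). (-1) ^ msize \<sigma> * X \<sigma>) + (\<Sum>\<sigma>\<in>?M (Suc r). of_bool (0 < \<sigma> i) * ((-1) ^ msize \<sigma> * Y \<sigma>))"
    by (simp only: variation_eq_sum[OF of_order_total_der[OF f] le_refl z] expand distrib_left sum.distrib mult.left_commute)
  also have "(\<Sum>\<sigma>\<in>?M (Suc r). (-1) ^ msize \<sigma> * X \<sigma>) = (\<Sum>\<sigma>\<in>?M r. (-1) ^ msize \<sigma> * X \<sigma>)"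
    by (rule sum.mono_neutral_right[OF finite_multiindices])
       (auto simp: X_def A_power_outside[OF f _ z])
  also have "(\<Sum>\<sigma>\<in>?M (Suc r). of_bool (0 < \<sigma> i) * ((-1) ^ msize \<sigma> * Y \<sigma>)) = (\<Sum>\<sigma>\<in>bump i ` ?M r. (-1) ^ msize \<sigma> * Y \<sigma>)"
  proof (rule sum.mono_neutral_cong_right[OF finite_multiindices])
    have "\<sigma> \<in> bump i ` ?M r" if "0 < \<sigma> i" "msize \<sigma> \<le> Suc r" for \<sigma>
      using that bump_unbump[of \<sigma> i] msize_bump[of i "unbump i \<sigma>"]
      by (intro image_eqI[of _ _ "unbump i \<sigma>"]) auto
    then show "\<forall>\<sigma>\<in>?M (Suc r) - bump i ` ?M r. of_bool (0 < \<sigma> i) * ((-1) ^ msize \<sigma> * Y \<sigma>) = 0"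
      by auto
  qed auto
  also have "\<dots> = (\<Sum>\<sigma>\<in>?M r. - ((-1) ^ msize \<sigma> * X \<sigma>))"
    by (subst sum.reindex) (auto simp: X_def Y_def intro: inj_on_inverseI[of _ "unbump i"])
  finally show "variation A (total_der i f) w z = 0"
    by (simp add: sum_negf)
qed

end

end

section \<open>Degrees\<close>

text \<open>A set of degrees is used because lowering the degree \<open>0\<close> leaves no admissible degree at all.\<close>

definition lengths_in :: "('n, 'm) jet set \<Rightarrow> nat set \<Rightarrow> ('n, 'm) density \<Rightarrow> bool" where
  "lengths_in D N f \<longleftrightarrow> (\<forall>w. \<forall>z\<in>D. length w \<notin> N \<longrightarrow> f w z = 0)"

text \<open>The insertion of \<open>p\<close> without its normalising factor, that is the right odd derivation that replaces each \<open>b\<close> by \<open>p\<close>.\<close>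

definition contraction :: "nat \<Rightarrow> ('n, 'm) density \<Rightarrow> ('n, 'm) density" where
  "contraction s f w z = Sum_any (\<lambda>g. z (Pv s (fst g) (snd g)) * odd_der_right g f w z)"

lemma lengths_in_mono: "lengths_in D M f \<Longrightarrow> M \<subseteq> N \<Longrightarrow> lengths_in D N f"
  by (auto simp: lengths_in_def)

lemma lengths_in_mult:
  assumes "lengths_in D M f" "lengths_in D N g" "\<And>m n. m \<in> M \<Longrightarrow> n \<in> N \<Longrightarrow> m + n \<in> K"
  shows "lengths_in D K (mult f g)"
  unfolding lengths_in_def mult_def
proof (intro allI ballI impI sum.neutral)
  fix w :: "('a, 'b) ovar list" and z i assume z: "z \<in> D" and w: "length w \<notin> K" and i: "i \<in> {..length w}"
  have "length (take i w) \<notin> M \<or> length (drop i w) \<notin> N"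
    using assms(3)[of "length (take i w)" "length (drop i w)"] w i by auto
  then show "f (take i w) z * g (drop i w) z = 0"
    using assms(1,2) z by (auto simp: lengths_in_def)
qed

lemma word_conv_lin_left:
    "word_conv (\<lambda>x. a * \<phi> x + b * \<psi> x) \<theta> w = a * word_conv \<phi> \<theta> w + b * word_conv \<psi> \<theta> w"
  and word_conv_lin_right:
    "word_conv \<theta> (\<lambda>x. a * \<phi> x + b * \<psi> x) w = a * word_conv \<theta> \<phi> w + b * word_conv \<theta> \<psi> w"
  by (simp_all add: word_conv_def sum.distrib sum_distrib_left algebra_simps)

context open_jets
begin

abbreviation "letters r \<equiv> {g :: ('n, 'm) ovar. msize (snd g) \<le> r}"

lemma lengths_in_der: "lengths_in D N f \<Longrightarrow> lengths_in D N (der v f)"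
  unfolding lengths_in_def der_def
proof (intro allI ballI impI)
  fix w :: "('n, 'm) ovar list" and z assume *: "\<forall>w. \<forall>z\<in>D. length w \<notin> N \<longrightarrow> f w z = 0" "z \<in> D" "length w \<notin> N"
  have "pder v (f w) z = pder v (\<lambda>_. 0) z"
    by (rule pder_cong[OF open_D]) (use * in auto)
  then show "pder v (f w) z = 0" by simp
qed

lemma lengths_in_total_der:
  assumes "lengths_in D N f" shows "lengths_in D N (total_der i f)"
  unfolding lengths_in_def total_der_eq
proof (intro allI ballI impI)
  fix w :: "('n, 'm) ovar list" and z assume *: "z \<in> D" "length w \<notin> N"
  have "dtot i (f w) z = dtot i (\<lambda>_. 0) z"
    by (rule dtot_cong) (use * assms in \<open>auto simp: lengths_in_def\<close>)
  moreover have "shift i w (\<lambda>u. f u z) = shift i w (\<lambda>u. 0)"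
    by (rule shift_cong) (use * assms in \<open>auto simp: lengths_in_def\<close>)
  ultimately show "dtot i (f w) z + shift i w (\<lambda>u. f u z) = 0"
    by (simp add: shift_zero)
qed

lemma lengths_in_odd_der_left:
  assumes "lengths_in D N f" shows "lengths_in D {n. Suc n \<in> N} (odd_der_left g f)"
  unfolding lengths_in_def
proof (intro allI ballI impI)
  fix w :: "('n, 'm) ovar list" and z assume *: "z \<in> D" "length w \<notin> {n. Suc n \<in> N}"
  have "contract g w (\<lambda>u. f u z) = contract g w (\<lambda>u. 0)"
    by (rule contract_cong) (use * assms in \<open>auto simp: lengths_in_def\<close>)
  then show "odd_der_left g f w z = 0"
    by (simp add: odd_der_left_eq contract_zero)
qed

lemma lengths_in_odd_der_right:
  assumes "lengths_in D N f" shows "lengths_in D {n. Suc n \<in> N} (odd_der_right g f)"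
  using lengths_in_odd_der_left[OF assms, of g] by (simp add: lengths_in_def odd_der_right_left)

lemma lengths_in_op_power: "lengths_in D N f \<Longrightarrow> lengths_in D N (op_power total_der \<sigma> f)"
  using op_power_rel[of "\<lambda>n f g h. lengths_in D N f", OF _ lengths_in_total_der] .

lemma lengths_in_variation:
  assumes A: "variation_family A" and f: "of_ord r f" and N: "\<And>\<sigma>. lengths_in D N (A \<sigma> f)"
  shows "lengths_in D N (variation A f)"
  using lengths_in_op_power[OF N] unfolding lengths_in_def
  by (auto simp: variation_eq_sum[OF A f le_refl])

lemma lengths_in_contraction:
  assumes "lengths_in D N f" shows "lengths_in D {n. Suc n \<in> N} (contraction s f)"
  using lengths_in_odd_der_right[OF assms] by (simp add: lengths_in_def contraction_def)

section \<open>Products of densities\<close>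

lemma of_order_mult:
  assumes f: "of_ord r f" and g: "of_ord r' g"
  shows "of_ord (r + r') (mult f g)"
  unfolding of_order_def mult_def
proof (intro allI conjI impI ballI)
  fix w
  show "jetf (r + r') (\<lambda>z. \<Sum>i\<le>length w. f (take i w) z * g (drop i w) z)"
    by (intro jetf_sum jetf_mult) (auto intro: jetf_mono[OF of_order_jetf[OF f]] jetf_mono[OF of_order_jetf[OF g]])
  fix z assume w: "length w > r + r' \<or> (\<exists>g\<in>set w. msize (snd g) > r + r')" and z: "z \<in> D"
  show "(\<Sum>i\<le>length w. f (take i w) z * g (drop i w) z) = 0"
  proof (rule sum.neutral, rule ballI)
    fix i assume i: "i \<in> {..length w}"
    have "(length (take i w) > r \<or> (\<exists>g\<in>set (take i w). msize (snd g) > r)) \<or>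
      (length (drop i w) > r' \<or> (\<exists>g\<in>set (drop i w). msize (snd g) > r'))"
      using w
    proof
      assume "\<exists>g\<in>set w. msize (snd g) > r + r'"
      then obtain g where g: "g \<in> set w" "msize (snd g) > r + r'" by blast
      then have "g \<in> set (take i w) \<or> g \<in> set (drop i w)"
        by (metis Un_iff append_take_drop_id set_append)
      moreover have "msize (snd g) > r" "msize (snd g) > r'" using g(2) by auto
      ultimately show ?thesis by blast
    qed (use i in auto)
    then show "f (take i w) z * g (drop i w) z = 0"
      using of_order_zero[OF f _ z, of "take i w"] of_order_zero[OF g _ z, of "drop i w"] by auto
  qed
qed

lemma word_expansion:
  assumes "of_ord r f" "z \<in> D"
  shows "f y z = (\<Sum>x\<in>words r. f x z * of_bool (y = x))"
proof (cases "y \<in> words r")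
  case True
  then have "words r \<inter> {x. y = x} = {y}" by auto
  then show ?thesis by (simp add: finite_words)
next
  case False
  then have "words r \<inter> {x. y = x} = {}" by auto
  then show ?thesis using of_order_outside_words[OF assms(1) False assms(2)] by (simp add: finite_words)
qed

lemma density_operator_mult:
  assumes "of_ord r p"
  shows "density_operator D (\<lambda>k. k + r) (\<lambda>f. mult f p)" "density_operator D (\<lambda>k. r + k) (mult p)"
  unfolding density_operator_def using of_order_mult[OF _ assms] of_order_mult[OF assms]
  by (simp_all add: agree_def mult_def sum.distrib sum_distrib_left algebra_simps)

text \<open>Multiplying the generator \<open>C u (g h + h g) v\<close> by the monomial \<open>p\<^sub>x x\<close> gives the generator with \<open>v x\<close> and coefficient \<open>C p\<^sub>x\<close>.\<close>

lemma null_mult: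
  assumes f: "null f" and p: "of_ord r p"
  shows "null (mult f p)" "null (mult p f)"
proof -
  have gens: "null (mult (swap_gen C u g h v) p) \<and> null (mult p (swap_gen C u g h v))"
    if C: "jetf k C" for k C u g h v
  proof -
    have gen: "null (\<lambda>w z. \<Sum>x\<in>words r. swap_gen (\<lambda>z. C z * p x z) (a x) g h (b x) w z)" for a b
      by (intro null_sum anticomm_null_swap_gen[of D "max k r"] jetf_mult
          jetf_mono[OF C] jetf_mono[OF of_order_jetf[OF p]]) auto
    let ?G = "\<lambda>z y. C z * of_bool (y = u @ [g, h] @ v) + C z * of_bool (y = u @ [h, g] @ v)"
    let ?P = "\<lambda>z y. \<Sum>x\<in>words r. p x z * of_bool (y = x)"
    have "mult (swap_gen C u g h v) p w z = word_conv (?G z) (?P z) w"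
      "mult p (swap_gen C u g h v) w z = word_conv (?P z) (?G z) w" if z: "z \<in> D" for w z
      unfolding mult_eq_word_conv swap_gen_def distrib_left
      by (subst (1) word_expansion[OF p z], rule refl)+
    then have "mult (swap_gen C u g h v) p w z = (\<Sum>x\<in>words r. swap_gen (\<lambda>z. C z * p x z) u g h (v @ x) w z)"
      "mult p (swap_gen C u g h v) w z = (\<Sum>x\<in>words r. swap_gen (\<lambda>z. C z * p x z) (x @ u) g h v w z)"
      if "z \<in> D" for w z
      using that
      by (simp_all only: word_conv_sum_left word_conv_sum_right word_conv_lin_left word_conv_lin_right
          word_conv_delta_left swap_gen_def)
         (simp_all add: algebra_simps del: sum_of_bool_mult_eq sum_mult_of_bool_eq)
    then show ?thesis
      by (intro conjI anticomm_null_agree[OF gen[of "\<lambda>_. u" "\<lambda>x. v @ x"]]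
          anticomm_null_agree[OF gen[of "\<lambda>x. x @ u" "\<lambda>_. v"]]) (simp_all add: agree_def)
  qed
  show "null (mult f p)"
    by (rule density_operator_null[OF density_operator_mult(1)[OF p] _ f], rule gens[THEN conjunct1])
  show "null (mult p f)"
    by (rule density_operator_null[OF density_operator_mult(2)[OF p] _ f], rule gens[THEN conjunct2])
qed

section \<open>Contraction with the inserted variable\<close>

lemma contraction_eq_sum:
  assumes f: "of_ord r f" and "r \<le> R" and z: "z \<in> D"
  shows "contraction s f w z = (\<Sum>g\<in>letters R. z (Pv s (fst g) (snd g)) * odd_der_right g f w z)"
  unfolding contraction_def
proof (rule Sum_any.expand_superset[OF finite_letters], safe)
  fix a and \<sigma> :: "'n \<Rightarrow> nat"
  assume "z (Pv s (fst (a, \<sigma>)) (snd (a, \<sigma>))) * odd_der_right (a, \<sigma>) f w z \<noteq> 0"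
  then show "msize (snd (a, \<sigma>)) \<le> R"
    using odd_der_right_outside[OF f, of "(a, \<sigma>)"] z assms(2) by (cases "r < msize \<sigma>") (auto simp: agree_def)
qed

lemma of_order_coeff:
  "jetf r c \<Longrightarrow> of_ord r f \<Longrightarrow> of_ord r (\<lambda>w z. c z * f w z)"
  unfolding of_order_def by (auto intro: jetf_mult)

lemma jetf_p: "msize \<sigma> \<le> r \<Longrightarrow> jetf (max r s) (\<lambda>z. z (Pv s a \<sigma>))"
  by (intro jetf_coordinate) (auto simp: jet_vars_def)

lemma density_operator_contraction: "density_operator D (\<lambda>r. max r s) (contraction s)"
  unfolding density_operator_def
proof (intro conjI allI impI)
  fix r f assume f: "of_ord r f"
  have "of_ord (max r s) (\<lambda>w z. \<Sum>g\<in>letters r. z (Pv s (fst g) (snd g)) * odd_der_right g f w z)"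
    by (intro of_order_sum of_order_coeff jetf_p
        of_order_mono[OF density_operator_order[OF density_operator_odd_der_right f]]) auto
  then show "of_ord (max r s) (contraction s f)"
    by (rule of_order_cong) (simp add: agree_def contraction_eq_sum[OF f])
next
  fix r a b f g h assume f: "of_ord r f" and g: "of_ord r g" and h: "agr h (\<lambda>w z. a * f w z + b * g w z)"
  have r: "of_ord r h" using of_order_cong[OF of_order_lin[OF f g] h] .
  show "agr (contraction s h) (\<lambda>w z. a * contraction s f w z + b * contraction s g w z)"
    using density_operator_linear[OF density_operator_odd_der_right f g h]
    by (simp add: agree_def contraction_eq_sum[OF f le_refl] contraction_eq_sum[OF g le_refl]
        contraction_eq_sum[OF r le_refl] sum_distrib_left sum.distrib algebra_simps)
qed

lemma null_coeff:
  assumes "null f" and c: "jetf r c"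
  shows "null (\<lambda>w z. c z * f w z)"
proof (rule density_operator_null[OF _ _ assms(1)])
  show "density_operator D (max r) (\<lambda>f w z. c z * f w z)"
    unfolding density_operator_def
  proof (intro conjI allI impI)
    fix k f assume "of_ord k f"
    then show "of_ord (max r k) (\<lambda>w z. c z * f w z)"
      by (intro of_order_coeff jetf_mono[OF c]) (auto intro: of_order_mono)
  qed (simp add: agree_def algebra_simps)
  fix k C u g h v assume C: "jetf k C"
  have "jetf (max r k) (\<lambda>z. c z * C z)"
    by (intro jetf_mult jetf_mono[OF c] jetf_mono[OF C]) auto
  from anticomm_null_swap_gen[OF this, of u g h v] show "null (\<lambda>w z. c z * swap_gen C u g h v w z)"
    by (rule anticomm_null_agree) (simp add: agree_def swap_gen_def mult.assoc)
qed

lemma null_contraction: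
  assumes f: "null f" shows "null (contraction s f)"
proof -
  obtain r where r: "of_ord r f" using null_of_order[OF f] by blast
  have "null (\<lambda>w z. \<Sum>g\<in>letters r. z (Pv s (fst g) (snd g)) * odd_der_right g f w z)"
    by (intro null_sum null_coeff[OF null_odd_der_right[OF f], where r = "max r s"] jetf_p) auto
  then show ?thesis
    by (rule anticomm_null_agree) (simp add: agree_def contraction_eq_sum[OF r])
qed

lemma total_der_coeff:
  assumes "jetf r c" "of_ord r f" "z \<in> D"
  shows "total_der i (\<lambda>w z. c z * f w z) w z = dtot i c z * f w z + c z * total_der i f w z"
  using dtot_mult[OF assms(1) of_order_jetf[OF assms(2)] assms(3)]
  by (simp add: total_der_eq shift_scale distrib_left)

text \<open>The commutator of \<open>\<partial>/\<partial>b\<^sub>\<sigma>\<close> with \<open>D\<^sub>i\<close> contributes \<open>p\<^sub>\<sigma>\<close> times the derivative along the lowered index, and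
the derivative of the coefficient \<open>p\<^sub>\<sigma>\<close> contributes the raised \<open>p\<close> times the derivative along \<open>\<sigma>\<close>. These are the same sums up
to a change of index.\<close>

lemma contraction_total_der:
  assumes f: "of_ord r f"
  shows "agr (contraction s (total_der i f)) (total_der i (contraction s f))"
  unfolding agree_def
proof (intro allI ballI)
  fix w z assume z: "z \<in> D"
  let ?p = "\<lambda>g z. z (Pv s (fst g) (snd g)) :: real"
  let ?L = "letters (Suc r)"
  have R: "of_ord (Suc r) (odd_der_right g f)" for g
    by (rule of_order_mono[OF density_operator_order[OF density_operator_odd_der_right f]]) simp
  \<comment> \<open>\<open>Y\<close> comes from the commutator and \<open>X\<close> from the total derivative of \<open>p\<close>; \<open>Y\<close> at a raised letter is \<open>X\<close> at the letter.\<close>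
  define X where "X g = ?p (raise i g) z * odd_der_right g f w z" for g
  define Y where "Y g = ?p g z * odd_der_right (lower i g) f w z" for g
  define Z where "Z = (\<Sum>g\<in>?L. ?p g z * total_der i (odd_der_right g f) w z)"
  have "contraction s (total_der i f) w z = (\<Sum>g\<in>?L. ?p g z * odd_der_right g (total_der i f) w z)"
    by (rule contraction_eq_sum[OF of_order_total_der[OF f] le_refl z])
  also have "\<dots> = Z + (\<Sum>g\<in>?L. of_bool (0 < snd g i) * Y g)"
    unfolding Z_def Y_def sum.distrib[symmetric]
    by (intro sum.cong refl)
       (use agreeD[OF odd_der_right_total_der[OF f] z] in \<open>auto simp: lower_def distrib_left\<close>)
  also have "(\<Sum>g\<in>?L. of_bool (0 < snd g i) * Y g) = (\<Sum>g\<in>raise i ` letters r. Y g)"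
  proof (rule sum.mono_neutral_cong_right[OF finite_letters])
    show "raise i ` letters r \<subseteq> ?L" by (auto simp: raise_def)
    have "g \<in> raise i ` letters r" if "0 < snd g i" "msize (snd g) \<le> Suc r" for g :: "('n, 'm) ovar"
      using that lower_eq_iff[of g i "lower i g"] msize_bump[of i "unbump i (snd g)"]
      by (intro image_eqI[of _ _ "lower i g"]) (auto simp: lower_def bump_unbump)
    then show "\<forall>g\<in>?L - raise i ` letters r. of_bool (0 < snd g i) * Y g = 0" by auto
  qed (auto simp: raise_def)
  also have "\<dots> = (\<Sum>g\<in>letters r. X g)"
    by (subst sum.reindex)
       (auto simp: X_def Y_def lower_def raise_def intro!: inj_on_inverseI[of _ "lower i"])
  also have "\<dots> = (\<Sum>g\<in>?L. X g)"
    by (rule sum.mono_neutral_left[OF finite_letters])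
       (auto simp: X_def agreeD[OF odd_der_right_outside[OF f] z])
  also have "Z + (\<Sum>g\<in>?L. X g) = (\<Sum>g\<in>?L. total_der i (\<lambda>w z. ?p g z * odd_der_right g f w z) w z)"
    unfolding Z_def sum.distrib[symmetric]
  proof (rule sum.cong[OF refl])
    fix g assume "g \<in> ?L"
    then have p: "jetf (max (Suc r) s) (?p g)" by (intro jetf_p) auto
    show "?p g z * total_der i (odd_der_right g f) w z + X g = total_der i (\<lambda>w z. ?p g z * odd_der_right g f w z) w z"
      using total_der_coeff[OF p of_order_mono[OF R] z, where i = i and w = w]
      by (simp add: dtot_coordinate X_def raise_def)
  qed
  also have "\<dots> = total_der i (contraction s f) w z"
  proof -
    let ?C = "\<lambda>w z. \<Sum>g\<in>?L. ?p g z * odd_der_right g f w z"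
    have terms: "of_ord (max (Suc r) s) (\<lambda>w z. ?p g z * odd_der_right g f w z)" if "g \<in> ?L" for g
      using that by (intro of_order_coeff jetf_p of_order_mono[OF R]) auto
    have "agr (total_der i (contraction s f)) (total_der i ?C)"
      by (rule density_operator_cong[OF density_operator_total_der of_order_sum[OF terms]])
         (simp_all add: agree_def contraction_eq_sum[OF f, of "Suc r"])
    moreover have "agr (total_der i ?C) (\<lambda>w z. \<Sum>g\<in>?L. total_der i (\<lambda>w z. ?p g z * odd_der_right g f w z) w z)"
      by (rule density_operator_sum[OF density_operator_total_der terms])
    ultimately show ?thesis using z by (simp add: agree_def)
  qed
  finally show "contraction s (total_der i f) w z = total_der i (contraction s f) w z" .
qed

text \<open>This is where the independence of \<open>p\<close> and \<open>q\<close> enters: the coefficients of the contraction have no \<open>q\<close>-derivatives.\<close>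

lemma contraction_der:
  assumes f: "of_ord r f"
  shows "agr (der (Qv a \<sigma>) (contraction s f)) (contraction s (der (Qv a \<sigma>) f))"
  unfolding agree_def
proof (intro allI ballI)
  fix w z assume z: "z \<in> D"
  let ?p = "\<lambda>g z. z (Pv s (fst g) (snd g)) :: real"
  let ?v = "Qv a \<sigma>"
  have R: "jetf r (odd_der_right g f w)" for g
    by (rule of_order_jetf[OF density_operator_order[OF density_operator_odd_der_right f]])
  have der_R: "pder ?v (odd_der_right g f w) z = odd_der_right g (der ?v f) w z" for g
  proof -
    have "pder ?v (odd_der_right g f w) z = pder ?v (\<lambda>z. (-1) ^ length w * contract g w (\<lambda>u. f u z)) z"
      by (rule pder_cong[OF open_D _ z]) (rule odd_der_right_eq)
    also have "\<dots> = (-1) ^ length w * contract g w (\<lambda>u. pder ?v (f u) z)"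
      by (simp only: pder_scale[OF jetf_word_functional[OF word_functional_contract of_order_jetf[OF f]] z]
          pder_word_functional[OF word_functional_contract of_order_jetf[OF f] z])
    finally show ?thesis by (simp add: odd_der_right_eq der_def)
  qed
  have "der ?v (contraction s f) w z = pder ?v (\<lambda>z. \<Sum>g\<in>letters r. ?p g z * odd_der_right g f w z) z"
    unfolding der_def by (rule pder_cong[OF open_D _ z]) (rule contraction_eq_sum[OF f le_refl])
  also have "\<dots> = (\<Sum>g\<in>letters r. pder ?v (\<lambda>z. ?p g z * odd_der_right g f w z) z)"
    by (rule pder_sum[OF _ z, of _ "max r s"]) (auto intro!: jetf_mult jetf_p jetf_mono[OF R])
  also have "\<dots> = (\<Sum>g\<in>letters r. ?p g z * odd_der_right g (der ?v f) w z)"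
  proof (rule sum.cong[OF refl])
    fix g assume "g \<in> letters r"
    then have "partial_differentiable ?v (?p g) z"
      by (intro jetf_differentiable[OF jetf_p z]) auto
    then show "pder ?v (\<lambda>z. ?p g z * odd_der_right g f w z) z = ?p g z * odd_der_right g (der ?v f) w z"
      by (simp add: pder_mult jetf_differentiable[OF R z] pder_coordinate der_R)
  qed
  also have "\<dots> = contraction s (der ?v f) w z"
    by (rule contraction_eq_sum[OF density_operator_order[OF density_operator_der f] le_refl z, symmetric])
  finally show "der ?v (contraction s f) w z = contraction s (der ?v f) w z" .
qed

text \<open>Two contractions anticommute, but the right derivative carries the sign of the length of its result, which the other
derivative changes by one; this makes a left and a right derivative commute. For two right
derivatives both orders get the same sign.\<close>

lemma odd_der_left_right:
  "odd_der_left g (odd_der_right h f) w z = odd_der_right h (odd_der_left g f) w z"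
proof -
  have "contract g w (\<lambda>u. (-1) ^ length u * contract h u (\<lambda>x. f x z)) =
    (-1) ^ Suc (length w) * contract g w (\<lambda>u. contract h u (\<lambda>x. f x z))"
    unfolding contract_scale[symmetric] by (rule contract_cong) simp
  then show ?thesis
    by (simp add: odd_der_left_eq odd_der_right_eq contract_contract[of g w h])
qed

lemma odd_der_right_right:
  "odd_der_right g (odd_der_right h f) w z = - odd_der_right h (odd_der_right g f) w z"
  using odd_der_left_right[of g h f w z] odd_der_left_right[of h g f w z]
  by (simp add: odd_der_left_eq odd_der_right_eq contract_contract[of g w h])

lemma contraction_odd_der_left:
  assumes f: "of_ord r f"
  shows "agr (odd_der_left g (contraction s f)) (contraction s (odd_der_left g f))"
  unfolding agree_def
proof (intro allI ballI)
  fix w z assume z: "z \<in> D"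
  show "odd_der_left g (contraction s f) w z = contraction s (odd_der_left g f) w z"
    unfolding contraction_eq_sum[OF density_operator_order[OF density_operator_odd_der_left f] le_refl z]
      odd_der_left_right[symmetric] odd_der_left_eq contraction_eq_sum[OF f le_refl z]
      word_functional_sum[OF word_functional_contract] contract_scale ..
qed

lemma contraction_odd_der_right:
  assumes f: "of_ord r f"
  shows "agr (odd_der_right g (contraction s f)) (\<lambda>w z. - contraction s (odd_der_right g f) w z)"
  unfolding agree_def
proof (intro allI ballI)
  fix w z assume z: "z \<in> D"
  have "odd_der_right g (contraction s f) w z =
     (\<Sum>h\<in>letters r. z (Pv s (fst h) (snd h)) * odd_der_right g (odd_der_right h f) w z)"
    unfolding odd_der_right_eq[of g] contraction_eq_sum[OF f le_refl z]
      word_functional_sum[OF word_functional_contract] contract_scale sum_distrib_left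
    by (simp add: mult.left_commute)
  also have "\<dots> = - contraction s (odd_der_right g f) w z"
    unfolding contraction_eq_sum[OF density_operator_order[OF density_operator_odd_der_right f] le_refl z]
      odd_der_right_right[of g] by (simp add: sum_negf)
  finally show "odd_der_right g (contraction s f) w z = - contraction s (odd_der_right g f) w z" .
qed

lemma contraction_op_power:
  assumes f: "of_ord r f"
  shows "agr (contraction s (op_power total_der \<sigma> f)) (op_power total_der \<sigma> (contraction s f))"
proof -
  let ?R = "\<lambda>n f g h. of_ord n f \<and> of_ord (n + s) g \<and> agr (contraction s f) g"
  have order: "of_ord (n + s) (contraction s f)" if "of_ord n f" for n f
    by (rule of_order_mono[OF density_operator_order[OF density_operator_contraction that]]) simp
  have step: "?R (Suc n) (total_der i f) (total_der i g) (total_der i h)" if "?R n f g h" for n i f g and h :: "('n, 'm) density"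
  proof (intro conjI)
    have f: "of_ord n f" and g: "of_ord (n + s) g" and eq: "agr (contraction s f) g" using that by auto
    show "of_ord (Suc n) (total_der i f)" "of_ord (Suc n + s) (total_der i g)"
      using of_order_total_der[OF f] of_order_total_der[OF g] by auto
    have "agr (contraction s (total_der i f)) (total_der i (contraction s f))"
      by (rule contraction_total_der[OF f])
    also have "agr \<dots> (total_der i g)"
      by (rule density_operator_cong[OF density_operator_total_der g eq])
    finally show "agr (contraction s (total_der i f)) (total_der i g)" .
  qed
  show ?thesis
    using op_power_rel[of ?R r f "contraction s f" undefined total_der total_der total_der \<sigma>, OF _ step]
      f order[OF f] by simp
qed

text \<open>The factor \<open>\<epsilon>\<close> records whether contraction commutes or anticommutes with the derivatives of the family; powers of total derivatives
commute with it and do not change the factor.\<close>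

lemma variation_contraction:
  assumes A: "variation_family A" and f: "of_ord r f"
    and comm: "\<And>\<sigma>. agr (A \<sigma> (contraction s f)) (\<lambda>w z. \<epsilon> * contraction s (A \<sigma> f) w z)"
  shows "agr (variation A (contraction s f)) (\<lambda>w z. \<epsilon> * contraction s (variation A f) w z)"
  unfolding agree_def
proof (intro allI ballI)
  fix w z assume z: "z \<in> D"
  let ?M = "{\<sigma> :: 'n \<Rightarrow> nat. msize \<sigma> \<le> max r s}"
  let ?P = "op_power total_der"
  have order: "of_ord (max r s) (contraction s f)"
    by (rule density_operator_order[OF density_operator_contraction f])
  have summand: "of_ord (r + max r s) (\<lambda>w z. (-1) ^ msize \<sigma> * ?P \<sigma> (A \<sigma> f) w z)" if "\<sigma> \<in> ?M" for \<sigma>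
    using that by (intro of_order_scale of_order_mono[OF density_operator_order[OF density_operator_op_power A_order[OF A f]]]) auto
  have P: "?P \<sigma> (A \<sigma> (contraction s f)) w z = \<epsilon> * contraction s (?P \<sigma> (A \<sigma> f)) w z" for \<sigma>
  proof -
    have "agr (?P \<sigma> (A \<sigma> (contraction s f))) (\<lambda>w z. \<epsilon> * ?P \<sigma> (contraction s (A \<sigma> f)) w z + 0 * ?P \<sigma> (contraction s (A \<sigma> f)) w z)"
      using comm by (intro density_operator_linear[OF density_operator_op_power, of "max r s"]
        density_operator_order[OF density_operator_contraction A_order[OF A f]]) simp_all
    then show ?thesis
      using contraction_op_power[OF A_order[OF A f]] z by (simp add: agree_def)
  qed
  have "variation A (contraction s f) w z = \<epsilon> * (\<Sum>\<sigma>\<in>?M. (-1) ^ msize \<sigma> * contraction s (?P \<sigma> (A \<sigma> f)) w z)"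
    unfolding variation_eq_sum[OF A order le_refl z] P by (simp add: sum_distrib_left mult.left_commute)
  also have "(\<Sum>\<sigma>\<in>?M. (-1) ^ msize \<sigma> * contraction s (?P \<sigma> (A \<sigma> f)) w z) =
      (\<Sum>\<sigma>\<in>?M. contraction s (\<lambda>w z. (-1) ^ msize \<sigma> * ?P \<sigma> (A \<sigma> f) w z) w z)"
  proof (rule sum.cong[OF refl])
    fix \<sigma>
    have P: "of_ord (r + msize \<sigma>) (?P \<sigma> (A \<sigma> f))"
      by (rule density_operator_order[OF density_operator_op_power A_order[OF A f]])
    show "(-1) ^ msize \<sigma> * contraction s (?P \<sigma> (A \<sigma> f)) w z = contraction s (\<lambda>w z. (-1) ^ msize \<sigma> * ?P \<sigma> (A \<sigma> f) w z) w z"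
      using agreeD[OF density_operator_linear[OF density_operator_contraction P P, of _ "(-1) ^ msize \<sigma>" 0] z]
      by simp
  qed
  also have "\<dots> = contraction s (\<lambda>w z. \<Sum>\<sigma>\<in>?M. (-1) ^ msize \<sigma> * ?P \<sigma> (A \<sigma> f) w z) w z"
    by (rule agreeD[OF agree_sym[OF density_operator_sum[OF density_operator_contraction summand]] z])
  also have "\<dots> = contraction s (variation A f) w z"
    by (rule agreeD[OF density_operator_cong[OF density_operator_contraction _ _] z, symmetric,
        OF of_order_sum[OF summand]]) (auto simp: agree_def variation_eq_sum[OF A f])
  finally show "variation A (contraction s f) w z = \<epsilon> * contraction s (variation A f) w z" .
qed

text \<open>A right derivation has to pass the second factor in order to reach the first one. The sign \<open>\<epsilon>\<close> is the parity of the second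
factor, given through an equation so that a vanishing density counts as even or odd as needed.\<close>

lemma contraction_mult:
  assumes f: "of_ord r f" and h: "of_ord r h"
    and parity: "\<And>w z. z \<in> D \<Longrightarrow> (-1) ^ length w * h w z = \<epsilon> * h w z"
  shows "agr (contraction s (mult f h)) (\<lambda>w z. mult f (contraction s h) w z + \<epsilon> * mult (contraction s f) h w z)"
  unfolding agree_def
proof (intro allI ballI)
  fix w z assume z: "z \<in> D"
  let ?p = "\<lambda>g. z (Pv s (fst g) (snd g)) :: real"
  let ?L = "letters (r + r)"
  have R: "odd_der_right g (mult f h) w z =
      word_conv (\<lambda>u. f u z) (\<lambda>u. odd_der_right g h u z) w + \<epsilon> * word_conv (\<lambda>u. odd_der_right g f u z) (\<lambda>u. h u z) w" for g
  proof -
    have "odd_der_right g (mult f h) w z =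
      word_conv (\<lambda>u. odd_der_right g f u z) (\<lambda>u. (-1) ^ length u * h u z) w +
      word_conv (\<lambda>u. ((-1) ^ length u * (-1) ^ length u) * f u z) (\<lambda>u. odd_der_right g h u z) w"
      unfolding odd_der_right_eq mult_eq_word_conv contract_word_conv distrib_left word_conv_grade mult.assoc ..
    also have "(\<lambda>u. (-1) ^ length u * h u z) = (\<lambda>u. \<epsilon> * h u z)"
      by (rule ext) (rule parity[OF z])
    finally show ?thesis
      by (simp add: word_conv_def sum_distrib_left mult_ac flip: power_mult_distrib)
  qed
  have "contraction s (mult f h) w z = (\<Sum>g\<in>?L. ?p g * odd_der_right g (mult f h) w z)"
    by (rule contraction_eq_sum[OF of_order_mult[OF f h] le_refl z])
  also have "\<dots> = (\<Sum>g\<in>?L. ?p g * word_conv (\<lambda>u. f u z) (\<lambda>u. odd_der_right g h u z) w) +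
      \<epsilon> * (\<Sum>g\<in>?L. ?p g * word_conv (\<lambda>u. odd_der_right g f u z) (\<lambda>u. h u z) w)"
    unfolding R by (simp add: sum.distrib sum_distrib_left algebra_simps)
  also have "\<dots> = mult f (contraction s h) w z + \<epsilon> * mult (contraction s f) h w z"
    unfolding mult_eq_word_conv word_conv_sum_left[symmetric] word_conv_sum_right[symmetric]
    using contraction_eq_sum[OF f, of "r + r" z] contraction_eq_sum[OF h, of "r + r" z] z by simp
  finally show "contraction s (mult f h) w z = mult f (contraction s h) w z + \<epsilon> * mult (contraction s f) h w z" .
qed

end

context open_jets
begin

section \<open>Insertion\<close>

text \<open>The normalising factor of a word is determined by the length of the word that remains, because one letter is removed. Grouping
the positions by their letter gives the right derivatives.\<close>

lemma insert_eq_contraction: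
  assumes f: "of_ord r f" and z: "z \<in> D"
  shows "insert_density s f w z = 1 / real (Suc (length w)) * contraction s f w z"
proof -
  let ?p = "\<lambda>g. z (Pv s (fst g) (snd g)) :: real"
  let ?k = "\<lambda>u j. of_bool (w = del j u) * (-1) ^ (length u - Suc j) * ?p (u ! j)"
  let ?J = "\<lambda>g u j. of_bool (u ! j = g \<and> w = del j u) * (-1) ^ (length u - Suc j) :: real"
  let ?K = "\<lambda>g u. \<Sum>j<length u. ?J g u j"
  have outside: "f u z = 0" if "u \<notin> words r" for u
    by (rule of_order_outside_words[OF f that z])
  have "insert_density s f w z = (\<Sum>u\<in>words r. 1 / real (length u) * (\<Sum>j<length u. ?k u j) * f u z)"
    unfolding insert_density_def
    by (rule Sum_any.expand_superset[OF finite_words]) (use outside in auto)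
  also have "\<dots> = (\<Sum>u\<in>words r. 1 / real (Suc (length w)) * ((\<Sum>g\<in>letters r. ?p g * ?K g u) * f u z))"
  proof (rule sum.cong[OF refl])
    fix u :: "('n, 'm) ovar list" assume u: "u \<in> words r"
    have "1 / real (length u) * ?k u j = 1 / real (Suc (length w)) * ?k u j" if "j < length u" for j
    proof (cases "w = del j u")
      case True
      then have "Suc (length w) = length u" using that by (simp add: del_def)
      then show ?thesis by simp
    qed simp
    then have weight: "1 / real (length u) * (\<Sum>j<length u. ?k u j) = 1 / real (Suc (length w)) * (\<Sum>j<length u. ?k u j)"
      unfolding sum_distrib_left by (intro sum.cong) auto
    have "(\<Sum>j<length u. ?k u j) = (\<Sum>j<length u. \<Sum>g\<in>letters r. ?p g * ?J g u j)"
    proof (rule sum.cong[OF refl])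
      fix j assume "j \<in> {..<length u}"
      then have "u ! j \<in> letters r" using u by (auto simp: words_def)
      then have "?k u j = (\<Sum>g\<in>{u ! j}. ?p g * ?J g u j)"
        by simp
      also have "\<dots> = (\<Sum>g\<in>letters r. ?p g * ?J g u j)"
        using \<open>u ! j \<in> letters r\<close> by (intro sum.mono_neutral_left finite_letters) auto
      finally show "?k u j = \<dots>" .
    qed
    also have "\<dots> = (\<Sum>g\<in>letters r. ?p g * ?K g u)"
      unfolding sum_distrib_left by (rule sum.swap)
    finally have K: "(\<Sum>j<length u. ?k u j) = (\<Sum>g\<in>letters r. ?p g * ?K g u)" .
    show "1 / real (length u) * (\<Sum>j<length u. ?k u j) * f u z =
      1 / real (Suc (length w)) * ((\<Sum>g\<in>letters r. ?p g * ?K g u) * f u z)"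
      unfolding weight unfolding K by (rule mult.assoc)
  qed
  also have "\<dots> = 1 / real (Suc (length w)) * (\<Sum>u\<in>words r. \<Sum>g\<in>letters r. ?p g * (?K g u * f u z))"
    unfolding sum_distrib_left sum_distrib_right by (simp only: mult.assoc)
  also have "(\<Sum>u\<in>words r. \<Sum>g\<in>letters r. ?p g * (?K g u * f u z)) =
      (\<Sum>g\<in>letters r. ?p g * (\<Sum>u\<in>words r. ?K g u * f u z))"
    unfolding sum_distrib_left by (rule sum.swap)
  also have "\<dots> = (\<Sum>g\<in>letters r. ?p g * odd_der_right g f w z)"
    unfolding odd_der_right_def
    by (intro sum.cong refl arg_cong[of _ _ "\<lambda>x. _ * x"] Sum_any.expand_superset[OF finite_words, symmetric])
       (use outside in auto)
  also have "\<dots> = contraction s f w z"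
    by (rule contraction_eq_sum[OF f le_refl z, symmetric])
  finally show ?thesis .
qed

lemma agree_insert_contraction:
  "of_ord r f \<Longrightarrow> agr (insert_density s f) (\<lambda>w z. 1 / real (Suc (length w)) * contraction s f w z)"
  unfolding agree_def using insert_eq_contraction by blast

lemma density_operator_insert: "density_operator D (\<lambda>r. max r s) (insert_density s)"
  unfolding density_operator_def
proof (intro conjI allI impI)
  fix r f assume f: "of_ord r f"
  show "of_ord (max r s) (insert_density s f)"
    by (rule of_order_cong[OF of_order_grade[OF density_operator_order[OF density_operator_contraction f]]
        agree_insert_contraction[OF f]])
next
  fix r a b f g h assume f: "of_ord r f" and g: "of_ord r g" and h: "agr h (\<lambda>w z. a * f w z + b * g w z)"
  have r: "of_ord r h" using of_order_cong[OF of_order_lin[OF f g] h] .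
  show "agr (insert_density s h) (\<lambda>w z. a * insert_density s f w z + b * insert_density s g w z)"
    using density_operator_linear[OF density_operator_contraction f g h, of s]
    by (simp add: agree_def insert_eq_contraction[OF f] insert_eq_contraction[OF g]
        insert_eq_contraction[OF r] add_divide_distrib)
qed

lemma null_insert:
  assumes f: "null f" shows "null (insert_density s f)"
proof -
  obtain r where r: "of_ord r f" using null_of_order[OF f] by blast
  show ?thesis
    by (rule anticomm_null_agree[OF null_grade[OF null_contraction[OF f]] agree_insert_contraction[OF r]])
qed

lemma insert_total_der:
  assumes f: "of_ord r f"
  shows "agr (insert_density s (total_der i f)) (total_der i (insert_density s f))"
proof -
  let ?c = "\<lambda>n. 1 / real (Suc n)"
  let ?G = "\<lambda>w z. ?c (length w) * contraction s f w z"
  have C: "of_ord (max r s) (contraction s f)"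
    by (rule density_operator_order[OF density_operator_contraction f])
  have "agr (insert_density s (total_der i f)) (\<lambda>w z. ?c (length w) * contraction s (total_der i f) w z)"
    by (rule agree_insert_contraction[OF of_order_total_der[OF f]])
  also have "agr \<dots> (\<lambda>w z. ?c (length w) * total_der i (contraction s f) w z)"
    using contraction_total_der[OF f] by (simp add: agree_def)
  also have "agr \<dots> (total_der i ?G)"
    by (rule agree_sym[OF total_der_grade[OF C]])
  also have "agr \<dots> (total_der i (insert_density s f))"
    by (rule agree_sym[OF density_operator_cong[OF density_operator_total_der of_order_grade[OF C] agree_insert_contraction[OF f]]])
  finally show ?thesis .
qed

text \<open>In degree \<open>0\<close> both sides vanish, so the relation also covers the terms of the bracket formula with coefficient \<open>0\<close>.\<close>

lemma insert_homogeneous: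
  assumes f: "of_ord r f" and k: "lengths_in D {k} f"
  shows "agr (contraction s f) (\<lambda>w z. real k * insert_density s f w z)"
  unfolding agree_def
proof (intro allI ballI)
  fix w z assume z: "z \<in> D"
  show "contraction s f w z = real k * insert_density s f w z"
    using lengths_in_contraction[OF k, of s] z
    by (cases "Suc (length w) = k") (auto simp: insert_eq_contraction[OF f z] lengths_in_def)
qed

section \<open>The Schouten bracket of densities\<close>

lemma bracket_orders:
  assumes "of_ord r f"
  shows "of_ord (2 * r) (var_q a f)" "of_ord (2 * r) (var_b_left a f)" "of_ord (2 * r) (var_b_right a f)"
  unfolding var_q_eq var_b_left_eq var_b_right_eq
  using assms density_operator_order[OF density_operator_variation] variation_family_q variation_family_left
    variation_family_right by blast+

lemma of_order_bracket:
  assumes f: "of_ord r f" and g: "of_ord r g"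
  shows "of_ord (2 * r + 2 * r) (bracket_density f g)"
proof -
  have "of_ord (2 * r + 2 * r) (\<lambda>w z. \<Sum>a\<in>UNIV. mult (var_q a f) (var_b_left a g) w z - mult (var_b_right a f) (var_q a g) w z)"
    by (intro of_order_sum of_order_diff of_order_mult bracket_orders f g)
  then show ?thesis by (simp add: bracket_density_def[abs_def])
qed

lemma bracket_scale:
  assumes f: "of_ord r f" and f': "agr f' (\<lambda>w z. c * f w z)"
  shows "agr (bracket_density f' g) (\<lambda>w z. c * bracket_density f g w z)"
    and "agr (bracket_density g f') (\<lambda>w z. c * bracket_density g f w z)"
proof -
  have lin: "agr (variation A f') (\<lambda>w z. c * variation A f w z)" if "variation_family A" for A
    using density_operator_linear[OF density_operator_variation[OF that] f f, of f' c 0] f' by simp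
  have "mult (variation A f') h w z = c * mult (variation A f) h w z"
    "mult h (variation A f') w z = c * mult h (variation A f) w z" if "variation_family A" "z \<in> D" for A h w z
    using agreeD[OF lin[OF that(1)] that(2)] by (simp_all add: mult_def sum_distrib_left mult_ac)
  then show "agr (bracket_density f' g) (\<lambda>w z. c * bracket_density f g w z)"
    "agr (bracket_density g f') (\<lambda>w z. c * bracket_density g f w z)"
    by (simp_all add: agree_def bracket_density_def var_q_eq var_b_left_eq var_b_right_eq variation_family_q
        variation_family_left variation_family_right sum_distrib_left right_diff_distrib)
qed

lemma lengths_in_var:
  assumes f: "of_ord r f" and k: "lengths_in D {k} f"
  shows "lengths_in D {k} (var_q a f)" "lengths_in D {n. Suc n = k} (var_b_left a f)"
    "lengths_in D {n. Suc n = k} (var_b_right a f)"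
  unfolding var_q_eq var_b_left_eq var_b_right_eq
  using lengths_in_der[OF k] lengths_in_odd_der_left[OF k] lengths_in_odd_der_right[OF k]
  by (auto intro!: lengths_in_variation[OF _ f] variation_family_q variation_family_left variation_family_right)

lemma lengths_in_bracket:
  assumes f: "of_ord r f" "lengths_in D {k} f" and g: "of_ord r g" "lengths_in D {l} g"
  shows "lengths_in D {n. Suc n = k + l} (bracket_density f g)"
proof -
  have "lengths_in D {n. Suc n = k + l} (mult (var_q a f) (var_b_left a g))"
    "lengths_in D {n. Suc n = k + l} (mult (var_b_right a f) (var_q a g))" for a
    by (rule lengths_in_mult[OF lengths_in_var(1)[OF f] lengths_in_var(2)[OF g]]
        lengths_in_mult[OF lengths_in_var(3)[OF f] lengths_in_var(1)[OF g]]; simp)+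
  then show ?thesis
    by (simp add: lengths_in_def bracket_density_def)
qed

lemma var_contraction:
  assumes f: "of_ord r f"
  shows "agr (var_q a (contraction s f)) (contraction s (var_q a f))"
    "agr (var_b_left a (contraction s f)) (contraction s (var_b_left a f))"
    "agr (var_b_right a (contraction s f)) (\<lambda>w z. - contraction s (var_b_right a f) w z)"
  using variation_contraction[OF variation_family_q[of a] f, of s 1] contraction_der[OF f, of a _ s]
    variation_contraction[OF variation_family_left[of a] f, of s 1] contraction_odd_der_left[OF f, of _ s]
    variation_contraction[OF variation_family_right[of a] f, of s "-1"] contraction_odd_der_right[OF f, of _ s]
  by (simp_all add: var_q_eq var_b_left_eq var_b_right_eq)

text \<open>The Leibniz rule gives four terms for each field. Since \<open>\<delta>g/\<delta>b\<close> has the opposite parity of \<open>g\<close> and contraction anticommutes with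
the right \<open>\<delta>/\<delta>b\<close>, the two terms with a contraction of \<open>f\<close> get the same sign \<open>- (-1)\<^sup>l\<close>.\<close>

lemma bracket_contraction:
  assumes f: "of_ord r f" and g: "of_ord r g" and l: "lengths_in D {l} g"
  shows "agr (contraction s (bracket_density f g))
    (\<lambda>w z. bracket_density f (contraction s g) w z - (-1) ^ l * bracket_density (contraction s f) g w z)"
proof -
  let ?\<iota> = "contraction s"
  let ?X = "\<lambda>a. mult (var_q a f) (var_b_left a g)" and ?Y = "\<lambda>a. mult (var_b_right a f) (var_q a g)"
  have XY: "of_ord (2 * r + 2 * r) (?X a)" "of_ord (2 * r + 2 * r) (?Y a)" for a
    by (intro of_order_mult bracket_orders f g)+
  have parity_q: "(-1) ^ length w * var_q a g w z = (-1) ^ l * var_q a g w z" if "z \<in> D" for a w z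
    using lengths_in_var(1)[OF g l, of a] that by (cases "length w = l") (auto simp: lengths_in_def)
  have parity_b: "(-1) ^ length w * var_b_left a g w z = - ((-1) ^ l) * var_b_left a g w z" if "z \<in> D" for a w z
    using lengths_in_var(2)[OF g l, of a] that by (cases "Suc (length w) = l") (auto simp: lengths_in_def)
  have X: "?\<iota> (?X a) w z = mult (var_q a f) (var_b_left a (?\<iota> g)) w z
      - (-1) ^ l * mult (var_q a (?\<iota> f)) (var_b_left a g) w z" if z: "z \<in> D" for a w z
    using agreeD[OF contraction_mult[OF bracket_orders(1)[OF f] bracket_orders(2)[OF g] parity_b] z, of s a a w]
      agreeD[OF var_contraction(2)[OF g] z, of a s] agreeD[OF var_contraction(1)[OF f] z, of a s]
    by (simp add: mult_def)
  have Y: "?\<iota> (?Y a) w z = mult (var_b_right a f) (var_q a (?\<iota> g)) w z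
      - (-1) ^ l * mult (var_b_right a (?\<iota> f)) (var_q a g) w z" if z: "z \<in> D" for a w z
    using agreeD[OF contraction_mult[OF bracket_orders(3)[OF f] bracket_orders(1)[OF g] parity_q] z, of s a a w]
      agreeD[OF var_contraction(1)[OF g] z, of a s] agreeD[OF var_contraction(3)[OF f] z, of a s]
    by (simp add: mult_def sum_negf)
  have "agr (?\<iota> (bracket_density f g)) (\<lambda>w z. \<Sum>a\<in>UNIV. ?\<iota> (\<lambda>w z. ?X a w z - ?Y a w z) w z)"
    unfolding bracket_density_def[abs_def]
    by (rule density_operator_sum[OF density_operator_contraction of_order_diff[OF XY]])
  moreover have "?\<iota> (\<lambda>w z. ?X a w z - ?Y a w z) w z = ?\<iota> (?X a) w z - ?\<iota> (?Y a) w z" if "z \<in> D" for a w z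
  proof -
    have "agr (?\<iota> (\<lambda>w z. ?X a w z - ?Y a w z)) (\<lambda>w z. 1 * ?\<iota> (?X a) w z + (-1) * ?\<iota> (?Y a) w z)"
      by (rule density_operator_linear[OF density_operator_contraction XY]) (simp add: agree_def)
    then show ?thesis using that by (simp add: agree_def)
  qed
  ultimately show ?thesis
    by (simp add: agree_def X Y bracket_density_def sum_subtractf sum.distrib sum_distrib_left algebra_simps)
qed

text \<open>All insertions are replaced by contractions at the price of the degrees \<open>k + l - 1\<close>, \<open>l\<close> and \<open>k\<close> of the densities into which
\<open>p\<close> is inserted.\<close>

lemma insert_bracket:
  assumes kl: "k + l \<ge> 2"
    and f: "of_ord r f" "lengths_in D {k} f" and g: "of_ord r g" "lengths_in D {l} g"
  shows "agr (insert_density s (bracket_density f g))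
    (\<lambda>w z. real l / (real k + real l - 1) * bracket_density f (insert_density s g) w z +
      (-1) powi (int l - 1) * (real k / (real k + real l - 1)) * bracket_density (insert_density s f) g w z)"
  unfolding agree_def
proof (intro allI ballI)
  fix w z assume z: "z \<in> D"
  let ?B = "bracket_density f g" and ?n = "real k + real l - 1"
  have B: "of_ord (2 * r + 2 * r) ?B" by (rule of_order_bracket[OF f(1) g(1)])
  have "lengths_in D {k + l - 1} ?B"
    by (rule lengths_in_mono[OF lengths_in_bracket[OF f g]]) auto
  from agreeD[OF insert_homogeneous[OF B this] z]
  have "?n * insert_density s ?B w z = contraction s ?B w z"
    using kl by (simp add: of_nat_diff)
  also have "\<dots> = bracket_density f (contraction s g) w z - (-1) ^ l * bracket_density (contraction s f) g w z"
    by (rule agreeD[OF bracket_contraction[OF f(1) g] z])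
  also have "bracket_density f (contraction s g) w z = real l * bracket_density f (insert_density s g) w z"
    by (rule agreeD[OF bracket_scale(2)[OF density_operator_order[OF density_operator_insert g(1)] insert_homogeneous[OF g]] z])
  also have "bracket_density (contraction s f) g w z = real k * bracket_density (insert_density s f) g w z"
    by (rule agreeD[OF bracket_scale(1)[OF density_operator_order[OF density_operator_insert f(1)] insert_homogeneous[OF f]] z])
  finally have eq: "?n * insert_density s ?B w z = real l * bracket_density f (insert_density s g) w z
      - (-1) ^ l * (real k * bracket_density (insert_density s f) g w z)" .
  have sign: "(-1 :: real) powi (int l - 1) = - ((-1) ^ l)"
    by (simp add: power_int_diff)
  have "?n \<noteq> 0" using kl by linarith
  then have "insert_density s ?B w z = ?n * insert_density s ?B w z / ?n" by simp
  then show "insert_density s ?B w z = real l / ?n * bracket_density f (insert_density s g) w z +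
      (-1) powi (int l - 1) * (real k / ?n) * bracket_density (insert_density s f) g w z"
    unfolding eq sign by (simp add: diff_divide_distrib)
qed

section \<open>Independence of the representatives\<close>

lemma density_operator_exact:
  assumes S: "density_operator D q S" and f: "of_ord r f" "of_ord r f'" and g: "\<And>i. of_ord r (g i)"
  shows "agr (\<lambda>w z. S f' w z - S f w z - (\<Sum>i\<in>UNIV. S (total_der i (g i)) w z))
    (S (\<lambda>w z. f' w z - f w z - (\<Sum>i\<in>UNIV. total_der i (g i) w z)))"
proof -
  let ?T = "\<lambda>w z. \<Sum>i\<in>UNIV. total_der i (g i) w z"
  have o: "of_ord (Suc r) f" "of_ord (Suc r) f'" "of_ord (Suc r) ?T"
    using of_order_mono[OF f(1)] of_order_mono[OF f(2)] by (auto intro!: of_order_sum of_order_total_der g)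
  have "agr (S (\<lambda>w z. f' w z - f w z - ?T w z)) (\<lambda>w z. 1 * S (\<lambda>w z. f' w z - f w z) w z + (-1) * S ?T w z)"
    by (rule density_operator_linear[OF S of_order_diff[OF o(2,1)] o(3)]) (simp add: agree_def)
  moreover have "agr (S (\<lambda>w z. f' w z - f w z)) (\<lambda>w z. 1 * S f' w z + (-1) * S f w z)"
    by (rule density_operator_linear[OF S o(2,1)]) (simp add: agree_def)
  moreover have "agr (S ?T) (\<lambda>w z. \<Sum>i\<in>UNIV. S (total_der i (g i)) w z)"
    by (rule density_operator_sum[OF S of_order_total_der[OF g]])
  ultimately show ?thesis by (simp add: agree_def)
qed

lemma variation_exact:
  assumes A: "variation_family A" and f: "of_ord r f" "of_ord r f'" and g: "\<And>i. of_ord r (g i)"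
    and n: "null (\<lambda>w z. f' w z - f w z - (\<Sum>i\<in>UNIV. total_der i (g i) w z))"
  shows "null (\<lambda>w z. variation A f' w z - variation A f w z)"
  by (rule anticomm_null_agree[OF null_variation[OF A n]])
     (use density_operator_exact[OF density_operator_variation[OF A] f g] variation_total_der[OF A g] in \<open>simp add: agree_def\<close>)

lemma null_mult_diff:
  assumes "of_ord r f" "of_ord r g'"
    and "null (\<lambda>w z. f' w z - f w z)" "null (\<lambda>w z. g' w z - g w z)"
  shows "null (\<lambda>w z. mult f' g' w z - mult f g w z)"
proof (rule anticomm_null_agree[OF null_add[OF null_mult(1)[OF assms(3,2)] null_mult(2)[OF assms(4,1)]]])
  show "agr (\<lambda>w z. mult f' g' w z - mult f g w z)
    (\<lambda>w z. mult (\<lambda>w z. f' w z - f w z) g' w z + mult f (\<lambda>w z. g' w z - g w z) w z)"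
    by (simp add: agree_def mult_def algebra_simps sum.distrib sum_subtractf)
qed

lemma bracket_exact:
  assumes f: "of_ord r f" "of_ord r f'" "\<And>i. of_ord r (x i)"
    and fn: "null (\<lambda>w z. f' w z - f w z - (\<Sum>i\<in>UNIV. total_der i (x i) w z))"
    and g: "of_ord r g" "of_ord r g'" "\<And>i. of_ord r (y i)"
    and gn: "null (\<lambda>w z. g' w z - g w z - (\<Sum>i\<in>UNIV. total_der i (y i) w z))"
  shows "null (\<lambda>w z. bracket_density f' g' w z - bracket_density f g w z)"
proof -
  have M: "null (\<lambda>w z. mult (variation A f') (variation C g') w z - mult (variation A f) (variation C g) w z)"
    if "variation_family A" "variation_family C" for A C
    using density_operator_order[OF density_operator_variation[OF that(1)] f(1)]
      density_operator_order[OF density_operator_variation[OF that(2)] g(2)]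
      variation_exact[OF that(1) f fn] variation_exact[OF that(2) g gn]
    by (rule null_mult_diff)
  have "null (\<lambda>w z. \<Sum>a\<in>UNIV. (mult (var_q a f') (var_b_left a g') w z - mult (var_q a f) (var_b_left a g) w z)
     - (mult (var_b_right a f') (var_q a g') w z - mult (var_b_right a f) (var_q a g) w z))"
    unfolding var_q_eq var_b_left_eq var_b_right_eq
    by (rule null_sum, rule null_diff)
       (rule M[OF variation_family_q variation_family_left] M[OF variation_family_right variation_family_q])+
  then show ?thesis
    by (rule anticomm_null_agree)
       (simp add: agree_def bracket_density_def sum_subtractf)
qed

lemma insert_exact:
  assumes f: "of_ord r f" "of_ord r f'" "\<And>i. of_ord r (g i)"
    and n: "null (\<lambda>w z. f' w z - f w z - (\<Sum>i\<in>UNIV. total_der i (g i) w z))"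
  shows "null (\<lambda>w z. insert_density s f' w z - insert_density s f w z
    - (\<Sum>i\<in>UNIV. total_der i (insert_density s (g i)) w z))"
  by (rule anticomm_null_agree[OF null_insert[OF n, of s]])
     (use density_operator_exact[OF density_operator_insert f, of s] insert_total_der[OF f(3)] in \<open>simp add: agree_def\<close>)

section \<open>Values of densities on covectors\<close>

lemma density_value_eq_sum:
  assumes f: "of_ord r f" and z: "z \<in> D"
  shows "density_value f z \<beta>s = (\<Sum>w\<in>words r. f w z * alt_value \<beta>s w)"
  unfolding density_value_def
  by (rule Sum_any.expand_superset[OF finite_words]) (use of_order_outside_words[OF f _ z] in auto)

lemma density_value_lin:
  assumes f: "of_ord r f" and g: "of_ord r g" and z: "z \<in> D"
  shows "density_value (\<lambda>w z. a * f w z + b * g w z) z \<beta>s = a * density_value f z \<beta>s + b * density_value g z \<beta>s"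
  unfolding density_value_eq_sum[OF f z] density_value_eq_sum[OF g z]
    density_value_eq_sum[OF of_order_lin[OF f g] z]
  by (simp add: sum_distrib_left sum.distrib algebra_simps)

lemma alt_value_length: "length w \<noteq> length \<beta>s \<Longrightarrow> alt_value \<beta>s w = 0"
proof (induction \<beta>s arbitrary: w)
  case (Cons \<beta> \<beta>s)
  have "alt_value \<beta>s (del j w) = 0" if "j < length w" for j
    using that Cons.prems by (intro Cons.IH) (auto simp: del_def)
  then show ?case by simp
qed simp

text \<open>The alternating form of a monomial is expanded along its first covector with exactly the signs that occur in insertion, so
inserting \<open>p\<close> is the same as evaluating with the jet of \<open>p\<close> in the first place.\<close>

lemma density_value_insert:
  assumes f: "of_ord r f" and z: "z \<in> D"
  shows "density_value (insert_density s f) z \<beta>s =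
    1 / real (Suc (length \<beta>s)) * density_value f z ((\<lambda>g. z (Pv s (fst g) (snd g))) # \<beta>s)"
proof -
  let ?p = "\<lambda>g. z (Pv s (fst g) (snd g)) :: real"
  let ?e = "\<lambda>u j. (-1) ^ (length u - Suc j) * ?p (u ! j)"
  have outside: "f u z = 0" if "u \<notin> words r" for u
    by (rule of_order_outside_words[OF f that z])
  have insert: "insert_density s f w z = (\<Sum>u\<in>words r. 1 / real (length u) * (\<Sum>j<length u. of_bool (w = del j u) * ?e u j) * f u z)" for w
    unfolding insert_density_def
    by (subst Sum_any.expand_superset[OF finite_words[of r]]) (use outside in \<open>auto simp: mult.assoc\<close>)
  have of: "of_ord (max r s) (insert_density s f)"
    by (rule density_operator_order[OF density_operator_insert f])
  have "density_value (insert_density s f) z \<beta>s =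
    (\<Sum>w\<in>words (max r s). \<Sum>u\<in>words r. \<Sum>j<length u. f u z / real (length u) * ?e u j * (of_bool (w = del j u) * alt_value \<beta>s w))"
    unfolding density_value_eq_sum[OF of z] insert sum_distrib_left sum_distrib_right
    by (intro sum.cong refl) (simp add: mult_ac)
  also have "\<dots> = (\<Sum>u\<in>words r. \<Sum>j<length u. \<Sum>w\<in>words (max r s). f u z / real (length u) * ?e u j * (of_bool (w = del j u) * alt_value \<beta>s w))"
    by (subst sum.swap, rule sum.cong[OF refl], subst sum.swap) (rule refl)
  also have "\<dots> = (\<Sum>u\<in>words r. \<Sum>j<length u. f u z / real (length u) * ?e u j * alt_value \<beta>s (del j u))"
  proof (intro sum.cong refl)
    fix u :: "('n, 'm) ovar list" and j assume u: "u \<in> words r" and j: "j \<in> {..<length u}"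
    have "set (del j u) \<subseteq> set u" unfolding del_def by (auto dest: in_set_takeD in_set_dropD)
    then have "del j u \<in> words (max r s)"
      using u j by (auto simp: words_def del_def intro: le_trans[OF _ max.cobounded1])
    then have *: "words (max r s) \<inter> {w. w = del j u} = {del j u}" by auto
    show "(\<Sum>w\<in>words (max r s). f u z / real (length u) * ?e u j * (of_bool (w = del j u) * alt_value \<beta>s w)) =
      f u z / real (length u) * ?e u j * alt_value \<beta>s (del j u)"
      unfolding sum_distrib_left[symmetric] sum_of_bool_mult_eq[OF finite_words] * by simp
  qed
  also have "\<dots> = (\<Sum>u\<in>words r. 1 / real (Suc (length \<beta>s)) * (f u z * alt_value (?p # \<beta>s) u))"
  proof (rule sum.cong[OF refl])
    fix u :: "('n, 'm) ovar list"
    have "(\<Sum>j<length u. f u z / real (length u) * ?e u j * alt_value \<beta>s (del j u)) =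
        1 / real (length u) * (f u z * alt_value (?p # \<beta>s) u)"
      by (simp add: sum_distrib_left sum_divide_distrib mult_ac)
    also have "\<dots> = 1 / real (Suc (length \<beta>s)) * (f u z * alt_value (?p # \<beta>s) u)"
      using alt_value_length[of u "?p # \<beta>s"] by (cases "length u = Suc (length \<beta>s)") (simp_all del: alt_value.simps)
    finally show "(\<Sum>j<length u. f u z / real (length u) * ?e u j * alt_value \<beta>s (del j u)) =
        1 / real (Suc (length \<beta>s)) * (f u z * alt_value (?p # \<beta>s) u)" .
  qed
  finally show ?thesis
    unfolding density_value_eq_sum[OF f z] sum_distrib_left .
qed

end

section \<open>Insertion and jets of sections\<close>

definition inserted_covector :: "nat \<Rightarrow> ('n, 'm) jet \<Rightarrow> ('n, 'm) ovar \<Rightarrow> real" where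
  "inserted_covector s z g = z (Pv s (fst g) (snd g))"

lemma inserted_covector_even_jet: "inserted_covector s (even_jet x u \<rho>) = odd_jet x (\<rho> s)"
  by (rule ext) (simp add: inserted_covector_def even_jet_def odd_jet_def)

text \<open>The inserted variable is tested on sections of the same bundle as the odd coordinates, so its section may serve as one more
covector in both charts.\<close>

lemma same_jets_insert:
  assumes "(x, z, \<beta>s, z', \<beta>s') \<in> same_jets B c d"
  shows "(x, z, inserted_covector s z # \<beta>s, z', inserted_covector s z' # \<beta>s') \<in> same_jets B c d"
proof -
  obtain u \<rho> vs u' \<rho>' vs' where e: "z = even_jet x u \<rho>" "\<beta>s = map (odd_jet x) vs"
    "z' = even_jet (base_trans c d x) u' \<rho>'" "\<beta>s' = map (odd_jet (base_trans c d x)) vs'"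
    "x \<in> overlap c d" "related_field B c d u u'" "\<forall>s. related_dual B c d (\<rho> s) (\<rho>' s)"
    "list_all2 (related_dual B c d) vs vs'"
    using assms unfolding same_jets_def by auto
  then show ?thesis
    unfolding same_jets_def
    by (intro CollectI exI[of _ x] exI[of _ u] exI[of _ \<rho>] exI[of _ "\<rho> s # vs"] exI[of _ u'] exI[of _ \<rho>']
        exI[of _ "\<rho>' s # vs'"]) (simp add: inserted_covector_even_jet)
qed

lemma same_jets_length:
  "(x, z, \<beta>s, z', \<beta>s') \<in> same_jets B c d \<Longrightarrow> length \<beta>s = length \<beta>s'"
  unfolding same_jets_def by (auto dest: list_all2_lengthD)

lemma finite_order_iff: "finite_order B f \<longleftrightarrow> (\<exists>r. \<forall>c\<in>charts B. of_order (jet_dom c) r (f c))"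
  by (simp add: finite_order_def of_order_def)

section \<open>Horizontally exact densities\<close>

context
  fixes B :: "('a, 'e, 'n::finite, 'm::finite) vbundle"
  assumes B: "oriented_vector_bundle B"
begin

lemma chart_open_jets:
  assumes "c \<in> charts B" shows "open_jets (jet_dom c)"
proof
  have "open (cbase c ` cdom c)"
    using B assms unfolding oriented_vector_bundle_def by blast
  moreover have "continuous_on UNIV (\<lambda>z :: ('n, 'm) jet. \<lambda>i. z (Xv i))"
    by (intro continuous_on_coordinatewise_then_product continuous_on_product_coordinates)
  ultimately have "open ((\<lambda>z :: ('n, 'm) jet. \<lambda>i. z (Xv i)) -` (cbase c ` cdom c))"
    using open_vimage by blast
  then show "open (jet_dom c :: ('n, 'm) jet set)"
    by (simp add: jet_dom_def vimage_def)
qed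

lemma cbase_inj:
  assumes "c \<in> charts B" shows "inj_on (cbase c) (cdom c)"
proof -
  have "homeomorphic_map (subtopology (base_space B) (cdom c)) (top_of_set (cbase c ` cdom c)) (cbase c)"
    "openin (base_space B) (cdom c)"
    using B assms unfolding oriented_vector_bundle_def by blast+
  then show ?thesis
    using homeomorphic_imp_injective_map openin_subset topspace_subtopology_subset by metis
qed

lemma same_jets_dom:
  assumes c: "c \<in> charts B" and j: "(x, z, \<beta>s, z', \<beta>s') \<in> same_jets B c d"
  shows "z \<in> jet_dom c" "z' \<in> jet_dom d"
proof -
  obtain u \<rho> u' \<rho>' where e: "z = even_jet x u \<rho>" "z' = even_jet (base_trans c d x) u' \<rho>'"
    "x \<in> overlap c d"
    using j unfolding same_jets_def by auto
  then obtain y where y: "y \<in> cdom c" "y \<in> cdom d" "x = cbase c y"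
    by (auto simp: overlap_def)
  then have "base_trans c d x = cbase d y"
    by (simp add: base_trans_def cbase_inj[OF c])
  then show "z \<in> jet_dom c" "z' \<in> jet_dom d"
    using y by (auto simp: jet_dom_def e even_jet_def)
qed

lemma finite_order_zero: "finite_order B (\<lambda>c w z. 0)"
  unfolding finite_order_iff using open_jets.of_order_const_zero[OF chart_open_jets] by blast

text \<open>The horizontal components \<open>h i\<close> are finitely many, so one bound serves for all of them and for all charts.\<close>

lemma finite_order_common:
  assumes "finite_order B f" "finite_order B g" "\<And>i :: 'n. finite_order B (h i)"
  obtains r where "\<And>c. c \<in> charts B \<Longrightarrow> of_order (jet_dom c) r (f c)"
    "\<And>c. c \<in> charts B \<Longrightarrow> of_order (jet_dom c) r (g c)"
    "\<And>c i. c \<in> charts B \<Longrightarrow> of_order (jet_dom c) r (h i c)"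
proof -
  obtain r r' where r: "\<And>c. c \<in> charts B \<Longrightarrow> of_order (jet_dom c) r (f c)"
    "\<And>c. c \<in> charts B \<Longrightarrow> of_order (jet_dom c) r' (g c)"
    using assms(1,2) unfolding finite_order_iff by blast
  have "\<exists>k. \<forall>c\<in>charts B. of_order (jet_dom c) k (h i c)" for i
    using assms(3) unfolding finite_order_iff .
  then obtain k where k: "\<And>i c. c \<in> charts B \<Longrightarrow> of_order (jet_dom c) (k i) (h i c)"
    by metis
  show ?thesis
  proof (rule that[of "r + r' + (\<Sum>i\<in>UNIV. k i)"])
    fix c i assume c: "c \<in> charts B"
    note mono = open_jets.of_order_mono[OF chart_open_jets[OF c]]
    have "k i \<le> (\<Sum>i\<in>UNIV. k i)" by (rule member_le_sum) auto
    then show "of_order (jet_dom c) (r + r' + (\<Sum>i\<in>UNIV. k i)) (f c)"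
      "of_order (jet_dom c) (r + r' + (\<Sum>i\<in>UNIV. k i)) (g c)"
      "of_order (jet_dom c) (r + r' + (\<Sum>i\<in>UNIV. k i)) (h i c)"
      by (auto intro: mono[OF r(1)[OF c]] mono[OF r(2)[OF c]] mono[OF k[OF c, of i]])
  qed
qed

lemma finite_order_lin:
  assumes "finite_order B f" "finite_order B g"
  shows "finite_order B (\<lambda>c w z. a * f c w z + b * g c w z)"
proof -
  obtain r where "\<And>c. c \<in> charts B \<Longrightarrow> of_order (jet_dom c) r (f c)"
    "\<And>c. c \<in> charts B \<Longrightarrow> of_order (jet_dom c) r (g c)"
    using finite_order_common[OF assms finite_order_zero] by metis
  then show ?thesis
    unfolding finite_order_iff using open_jets.of_order_lin[OF chart_open_jets] by blast
qed

lemma density_value_chart_lin: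
  assumes "finite_order B f" "finite_order B g" "c \<in> charts B" "z \<in> jet_dom c"
  shows "density_value (\<lambda>w z. a * f c w z + b * g c w z) z \<beta>s =
    a * density_value (f c) z \<beta>s + b * density_value (g c) z \<beta>s"
proof -
  obtain r where "of_order (jet_dom c) r (f c)" "of_order (jet_dom c) r (g c)"
    using finite_order_common[OF assms(1,2) finite_order_zero] assms(3) by metis
  then show ?thesis
    by (rule open_jets.density_value_lin[OF chart_open_jets[OF assms(3)] _ _ assms(4)])
qed

lemma global_subtop_form_zero: "global_subtop_form B (\<lambda>i c w z. 0)"
  unfolding global_subtop_form_def by (auto simp: finite_order_zero density_value_def)

lemma global_subtop_form_lin:
  assumes "global_subtop_form B g" "global_subtop_form B h"
  shows "global_subtop_form B (\<lambda>i c w z. a * g i c w z + b * h i c w z)"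
proof -
  have fin: "finite_order B (g i)" "finite_order B (h i)" for i
    using assms unfolding global_subtop_form_def by auto
  show ?thesis
    unfolding global_subtop_form_def
  proof (intro conjI allI ballI, rule finite_order_lin[OF fin], clarify)
    fix c d x z \<beta>s z' \<beta>s' j
    assume c: "c \<in> charts B" and d: "d \<in> charts B" and J: "(x, z, \<beta>s, z', \<beta>s') \<in> same_jets B c d"
    have *: "(\<Sum>i\<in>UNIV. jacobian c d x $ j $ i * density_value (k i c) z \<beta>s) =
        det (jacobian c d x) * density_value (k j d) z' \<beta>s'" if "global_subtop_form B k" for k
      using that c d J unfolding global_subtop_form_def by blast
    show "(\<Sum>i\<in>UNIV. jacobian c d x $ j $ i * density_value (\<lambda>w z. a * g i c w z + b * h i c w z) z \<beta>s) =
        det (jacobian c d x) * density_value (\<lambda>w z. a * g j d w z + b * h j d w z) z' \<beta>s'"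
      unfolding density_value_chart_lin[OF fin c same_jets_dom(1)[OF c J]]
        density_value_chart_lin[OF fin d same_jets_dom(2)[OF c J]] distrib_left sum.distrib
        mult.left_commute[of _ a] mult.left_commute[of _ b] sum_distrib_left[symmetric]
        *[OF assms(1)] *[OF assms(2)] ..
  qed
qed

text \<open>Invariance of the form with components \<open>g\<close>, tested with the jet of \<open>p\<close> as an additional covector, is invariance of the inserted form; the
number of the remaining covectors is the same in both charts, and so is the normalising factor.\<close>

lemma global_subtop_form_insert:
  assumes "global_subtop_form B g"
  shows "global_subtop_form B (\<lambda>i c. insert_density s (g i c))"
proof -
  have fin: "finite_order B (g i)" for i
    using assms unfolding global_subtop_form_def by auto
  have insert_value: "density_value (insert_density s (g i c)) z \<beta>s =
      1 / real (Suc (length \<beta>s)) * density_value (g i c) z (inserted_covector s z # \<beta>s)"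
    if c: "c \<in> charts B" and z: "z \<in> jet_dom c" for i c z \<beta>s
  proof -
    obtain r where "of_order (jet_dom c) r (g i c)"
      using fin[of i] c unfolding finite_order_iff by blast
    then show ?thesis
      unfolding inserted_covector_def[abs_def]
      by (rule open_jets.density_value_insert[OF chart_open_jets[OF c] _ z])
  qed
  show ?thesis
    unfolding global_subtop_form_def
  proof (intro conjI allI ballI)
    fix i
    obtain r where "\<And>c. c \<in> charts B \<Longrightarrow> of_order (jet_dom c) r (g i c)"
      using fin[of i] unfolding finite_order_iff by blast
    then show "finite_order B (\<lambda>c. insert_density s (g i c))"
      unfolding finite_order_iff
      using density_operator_order[OF open_jets.density_operator_insert[OF chart_open_jets]] by blast
  next
    fix c d p assume c: "c \<in> charts B" and d: "d \<in> charts B" and p: "p \<in> same_jets B c d"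
    obtain x z \<beta>s z' \<beta>s' where p_eq: "p = (x, z, \<beta>s, z', \<beta>s')" by (cases p)
    have J: "(x, z, \<beta>s, z', \<beta>s') \<in> same_jets B c d" using p p_eq by simp
    note dom = same_jets_dom[OF c J]
    have "(\<Sum>i\<in>UNIV. jacobian c d x $ j $ i * density_value (insert_density s (g i c)) z \<beta>s) =
        det (jacobian c d x) * density_value (insert_density s (g j d)) z' \<beta>s'" for j
    proof -
      have "(\<Sum>i\<in>UNIV. jacobian c d x $ j $ i * density_value (g i c) z (inserted_covector s z # \<beta>s)) =
        det (jacobian c d x) * density_value (g j d) z' (inserted_covector s z' # \<beta>s')"
        using assms c d same_jets_insert[OF J, of s] unfolding global_subtop_form_def by blast
      then show ?thesis
        unfolding insert_value[OF c dom(1)] insert_value[OF d dom(2)]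
          same_jets_length[OF J] mult.left_commute[of _ "1 / real (Suc (length \<beta>s'))"] sum_distrib_left[symmetric]
        by (rule arg_cong)
    qed
    then show "case p of (x, z, \<beta>s, z', \<beta>s') \<Rightarrow> \<forall>j.
        (\<Sum>i\<in>UNIV. jacobian c d x $ j $ i * density_value (insert_density s (g i c)) z \<beta>s) =
        det (jacobian c d x) * density_value (insert_density s (g j d)) z' \<beta>s'"
      by (simp add: p_eq)
  qed
qed

lemma horizontally_exact_null:
  assumes "\<And>c. c \<in> charts B \<Longrightarrow> anticomm_null (jet_dom c) (h c)"
  shows "horizontally_exact B h"
  unfolding horizontally_exact_def
proof (intro exI conjI ballI, rule global_subtop_form_zero)
  fix c assume c: "c \<in> charts B"
  interpret open_jets "jet_dom c" by (rule chart_open_jets[OF c])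
  have "agree (jet_dom c) (\<lambda>w z. h c w z - (\<Sum>i\<in>UNIV. total_der i (\<lambda>w z. 0) w z)) (h c)"
    using density_operator_zero[OF density_operator_total_der, of "\<lambda>w z. 0"] by (simp add: agree_def)
  then show "anticomm_null (jet_dom c) (\<lambda>w z. h c w z - (\<Sum>i\<in>UNIV. total_der i (\<lambda>w z. 0) w z))"
    by (rule anticomm_null_agree[OF assms[OF c]])
qed

lemma horizontally_exact_lin:
  assumes "horizontally_exact B h" "horizontally_exact B k"
  shows "horizontally_exact B (\<lambda>c w z. a * h c w z + b * k c w z)"
proof -
  obtain x where x: "global_subtop_form B x"
    "\<And>c. c \<in> charts B \<Longrightarrow> anticomm_null (jet_dom c) (\<lambda>w z. h c w z - (\<Sum>i\<in>UNIV. total_der i (x i c) w z))"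
    using assms(1) unfolding horizontally_exact_def by blast
  obtain y where y: "global_subtop_form B y"
    "\<And>c. c \<in> charts B \<Longrightarrow> anticomm_null (jet_dom c) (\<lambda>w z. k c w z - (\<Sum>i\<in>UNIV. total_der i (y i c) w z))"
    using assms(2) unfolding horizontally_exact_def by blast
  let ?g = "\<lambda>i c w z. a * x i c w z + b * y i c w z"
  have "anticomm_null (jet_dom c) (\<lambda>w z. a * h c w z + b * k c w z - (\<Sum>i\<in>UNIV. total_der i (?g i c) w z))"
    if c: "c \<in> charts B" for c
  proof -
    interpret open_jets "jet_dom c" by (rule chart_open_jets[OF c])
    have fin: "finite_order B (x i)" "finite_order B (y i)" for i
      using x(1) y(1) unfolding global_subtop_form_def by auto
    have T: "total_der i (?g i c) w z = a * total_der i (x i c) w z + b * total_der i (y i c) w z"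
      if "z \<in> jet_dom c" for i w z
    proof -
      obtain r where "of_ord r (x i c)" "of_ord r (y i c)"
        using finite_order_common[OF fin[of i] finite_order_zero] c by metis
      from density_operator_linear[OF density_operator_total_der this, of "?g i c" a b i] show ?thesis
        using that by (simp add: agree_def)
    qed
    show ?thesis
      by (rule anticomm_null_agree[OF null_add[OF null_scale[OF x(2)[OF c], of a] null_scale[OF y(2)[OF c], of b]]])
         (simp add: agree_def T sum.distrib sum_distrib_left algebra_simps)
  qed
  then show ?thesis
    unfolding horizontally_exact_def using global_subtop_form_lin[OF x(1) y(1)] by blast
qed

section \<open>Operations on classes\<close>

abbreviation cohomologous :: "('a, 'e, 'n, 'm) densities \<Rightarrow> ('a, 'e, 'n, 'm) densities \<Rightarrow> bool" where
  "cohomologous f g \<equiv> horizontally_exact B (\<lambda>c w z. f c w z - g c w z)"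

lemma cohomologous_agree:
  assumes "\<And>c. c \<in> charts B \<Longrightarrow> agree (jet_dom c) (f c) (g c)"
  shows "cohomologous f g"
  by (rule horizontally_exact_null, rule anticomm_null.zero) (use assms in \<open>simp add: agree_def\<close>)

lemma cohomologous_lin:
  assumes "cohomologous f f'" "cohomologous g g'"
  shows "cohomologous (\<lambda>c w z. a * f c w z + b * g c w z) (\<lambda>c w z. a * f' c w z + b * g' c w z)"
  using horizontally_exact_lin[OF assms, of a b] by (simp add: algebra_simps)

lemma cohomologous_sym: "cohomologous f g \<Longrightarrow> cohomologous g f"
  using horizontally_exact_lin[of _ _ "-1" 0] by fastforce

lemma cohomologous_trans: "cohomologous f g \<Longrightarrow> cohomologous g h \<Longrightarrow> cohomologous f h"
  using horizontally_exact_lin[of "\<lambda>c w z. f c w z - g c w z" "\<lambda>c w z. g c w z - h c w z" 1 1] by simp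

lemma var_class_eq: "cohomologous f g \<Longrightarrow> var_class B f = var_class B g"
  unfolding var_class_def using cohomologous_trans cohomologous_sym by blast

lemma var_class_self: "finite_order B f \<Longrightarrow> f \<in> var_class B f"
  unfolding var_class_def using cohomologous_agree[of f f] by simp

text \<open>An operation that respects the equivalence sends a class to one single class; the representative \<open>f\<close> itself shows that the union is not empty.\<close>

lemma var_class_UN:
  assumes f: "finite_order B f"
    and op: "\<And>f'. finite_order B f' \<Longrightarrow> cohomologous f' f \<Longrightarrow> cohomologous (S f') (S f)"
  shows "(\<Union>f'\<in>var_class B f. var_class B (S f')) = var_class B (S f)"
proof -
  have "var_class B (S f') = var_class B (S f)" if "f' \<in> var_class B f" for f'
    using that by (intro var_class_eq op) (auto simp: var_class_def)
  then show ?thesis using var_class_self[OF f] by blast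
qed

lemma var_class_UN2:
  assumes f: "finite_order B f" and g: "finite_order B g"
    and op: "\<And>f' g'. finite_order B f' \<Longrightarrow> cohomologous f' f \<Longrightarrow> finite_order B g' \<Longrightarrow> cohomologous g' g
      \<Longrightarrow> cohomologous (S f' g') (S f g)"
  shows "(\<Union>f'\<in>var_class B f. \<Union>g'\<in>var_class B g. var_class B (S f' g')) = var_class B (S f g)"
proof -
  have "var_class B (S f' g') = var_class B (S f g)" if "f' \<in> var_class B f" "g' \<in> var_class B g" for f' g'
    using that by (intro var_class_eq op) (auto simp: var_class_def)
  then show ?thesis using var_class_self[OF f] var_class_self[OF g] by blast
qed

lemma var_scale_class:
  "finite_order B f \<Longrightarrow> var_scale B t (var_class B f) = var_class B (\<lambda>c w z. t * f c w z)"
  unfolding var_scale_def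
  by (erule var_class_UN) (use cohomologous_lin[where b = 0 and a = t] cohomologous_agree[of _ _] in fastforce)

lemma var_plus_class:
  "finite_order B f \<Longrightarrow> finite_order B g \<Longrightarrow>
    var_plus B (var_class B f) (var_class B g) = var_class B (\<lambda>c w z. f c w z + g c w z)"
  unfolding var_plus_def
  by (erule (1) var_class_UN2) (use cohomologous_lin[where b = 1 and a = 1] in fastforce)

text \<open>If \<open>f' - f\<close> is exact with primitive \<open>g\<close>, then the insertions differ by a form with primitive the insertion into \<open>g\<close>.\<close>

lemma insertion_class:
  assumes f: "finite_order B f"
  shows "insertion B s (var_class B f) = var_class B (\<lambda>c. insert_density s (f c))"
  unfolding insertion_def
proof (rule var_class_UN[OF f])
  fix f' assume f': "finite_order B f'" "cohomologous f' f"
  then obtain g where g: "global_subtop_form B g"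
    "\<And>c. c \<in> charts B \<Longrightarrow> anticomm_null (jet_dom c) (\<lambda>w z. f' c w z - f c w z - (\<Sum>i\<in>UNIV. total_der i (g i c) w z))"
    unfolding horizontally_exact_def by blast
  then have "finite_order B (g i)" for i
    unfolding global_subtop_form_def by auto
  then obtain r where r: "\<And>c. c \<in> charts B \<Longrightarrow> of_order (jet_dom c) r (f c)"
    "\<And>c. c \<in> charts B \<Longrightarrow> of_order (jet_dom c) r (f' c)"
    "\<And>c i. c \<in> charts B \<Longrightarrow> of_order (jet_dom c) r (g i c)"
    using finite_order_common[OF f f'(1)] by blast
  show "cohomologous (\<lambda>c. insert_density s (f' c)) (\<lambda>c. insert_density s (f c))"
    unfolding horizontally_exact_def
    using global_subtop_form_insert[OF g(1), of s] open_jets.insert_exact[OF chart_open_jets r g(2)] by blast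
qed

text \<open>Brackets of equivalent densities differ only by elements of the anticommutation ideal, so the primitive \<open>0\<close> is enough here.\<close>

lemma schouten_class:
  assumes f: "finite_order B f" and g: "finite_order B g"
  shows "schouten B (var_class B f) (var_class B g) = var_class B (\<lambda>c. bracket_density (f c) (g c))"
  unfolding schouten_def
proof (rule var_class_UN2[OF f g])
  fix f' g' assume f': "finite_order B f'" "cohomologous f' f" and g': "finite_order B g'" "cohomologous g' g"
  obtain x where x: "\<And>i. finite_order B (x i)"
    "\<And>c. c \<in> charts B \<Longrightarrow> anticomm_null (jet_dom c) (\<lambda>w z. f' c w z - f c w z - (\<Sum>i\<in>UNIV. total_der i (x i c) w z))"
    using f'(2) unfolding horizontally_exact_def global_subtop_form_def by blast
  obtain y where y: "\<And>i. finite_order B (y i)"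
    "\<And>c. c \<in> charts B \<Longrightarrow> anticomm_null (jet_dom c) (\<lambda>w z. g' c w z - g c w z - (\<Sum>i\<in>UNIV. total_der i (y i c) w z))"
    using g'(2) unfolding horizontally_exact_def global_subtop_form_def by blast
  show "cohomologous (\<lambda>c. bracket_density (f' c) (g' c)) (\<lambda>c. bracket_density (f c) (g c))"
  proof (rule horizontally_exact_null)
    fix c assume c: "c \<in> charts B"
    interpret open_jets "jet_dom c" by (rule chart_open_jets[OF c])
    obtain r where r: "of_ord r (f c)" "of_ord r (f' c)" "\<And>i. of_ord r (x i c)"
      by (rule finite_order_common[OF f f'(1), of x, OF x(1)]) (use c in blast)
    obtain q where q: "of_ord q (g c)" "of_ord q (g' c)" "\<And>i. of_ord q (y i c)"
      by (rule finite_order_common[OF g g'(1), of y, OF y(1)]) (use c in blast)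
    note mono = of_order_mono[OF _ max.cobounded1[of r q]] of_order_mono[OF _ max.cobounded2[of q r]]
    show "null (\<lambda>w z. bracket_density (f' c) (g' c) w z - bracket_density (f c) (g c) w z)"
      by (rule bracket_exact[of "max r q", OF mono(1)[OF r(1)] mono(1)[OF r(2)] mono(1)[OF r(3)] x(2)[OF c]
            mono(2)[OF q(1)] mono(2)[OF q(2)] mono(2)[OF q(3)] y(2)[OF c]])
  qed
qed

lemma finite_order_insert:
  assumes "finite_order B f" shows "finite_order B (\<lambda>c. insert_density s (f c))"
  using assms density_operator_order[OF open_jets.density_operator_insert[OF chart_open_jets]]
  unfolding finite_order_iff by blast

lemma finite_order_bracket:
  assumes f: "finite_order B f" and g: "finite_order B g"
  shows "finite_order B (\<lambda>c. bracket_density (f c) (g c))"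
proof -
  obtain r where r: "\<And>c. c \<in> charts B \<Longrightarrow> of_order (jet_dom c) r (f c)"
    "\<And>c. c \<in> charts B \<Longrightarrow> of_order (jet_dom c) r (g c)"
    using finite_order_common[OF f g finite_order_zero] by metis
  then show ?thesis
    unfolding finite_order_iff using open_jets.of_order_bracket[OF chart_open_jets] by blast
qed

lemma multivector_representative:
  assumes "\<xi> \<in> multivectors B k"
  obtains f where "\<xi> = var_class B f" "finite_order B f"
    "\<And>c. c \<in> charts B \<Longrightarrow> lengths_in (jet_dom c) {k} (f c)"
  using assms unfolding multivectors_def global_top_form_def homogeneous_def lengths_in_def by blast

end

section \<open>Insertion into the Schouten bracket\<close>

text \<open>The representatives \<open>f\<close> and \<open>g\<close> can be chosen homogeneous. Every class in the statement is then the class of an explicit density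
built from them, and the two densities agree over each chart.\<close>

theorem theorem1:
  fixes B :: "('a, 'e, 'n::finite, 'm::finite) vbundle"
    and \<xi> \<eta> :: "('a, 'e, 'n, 'm) densities set"
    and k l s :: nat
  assumes "oriented_vector_bundle B"
    and "k + l \<ge> 2"
    and "\<xi> \<in> multivectors B k"
    and "\<eta> \<in> multivectors B l"
  shows "insertion B s (schouten B \<xi> \<eta>) =
    var_plus B
      (var_scale B (real l / (real k + real l - 1)) (schouten B \<xi> (insertion B s \<eta>)))
      (var_scale B ((-1) powi (int l - 1) * (real k / (real k + real l - 1)))
        (schouten B (insertion B s \<xi>) \<eta>))"
proof -
  note B = assms(1)
  obtain f where f: "\<xi> = var_class B f" "finite_order B f"
    "\<And>c. c \<in> charts B \<Longrightarrow> lengths_in (jet_dom c) {k} (f c)"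
    using multivector_representative[OF B assms(3)] by blast
  obtain g where g: "\<eta> = var_class B g" "finite_order B g"
    "\<And>c. c \<in> charts B \<Longrightarrow> lengths_in (jet_dom c) {l} (g c)"
    using multivector_representative[OF B assms(4)] by blast
  let ?a = "real l / (real k + real l - 1)"
  let ?b = "(-1) powi (int l - 1) * (real k / (real k + real l - 1))"
  let ?X = "\<lambda>c. bracket_density (f c) (insert_density s (g c))"
  let ?Y = "\<lambda>c. bracket_density (insert_density s (f c)) (g c)"
  note fin = f(2) g(2) finite_order_insert[OF B f(2)] finite_order_insert[OF B g(2)]
  have X: "finite_order B ?X" and Y: "finite_order B ?Y"
    by (intro finite_order_bracket[OF B] fin)+
  have scaled: "finite_order B (\<lambda>c w z. t * h c w z)" if "finite_order B h" for t h
    using finite_order_lin[OF B that that, of t 0] by simp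
  have "insertion B s (schouten B \<xi> \<eta>) = var_class B (\<lambda>c. insert_density s (bracket_density (f c) (g c)))"
    unfolding f(1) g(1)
    by (simp only: schouten_class[OF B fin(1,2)] insertion_class[OF B finite_order_bracket[OF B fin(1,2)]])
  also have "\<dots> = var_class B (\<lambda>c w z. ?a * ?X c w z + ?b * ?Y c w z)"
  proof (rule var_class_eq[OF B cohomologous_agree[OF B]])
    fix c assume c: "c \<in> charts B"
    obtain r where "of_order (jet_dom c) r (f c)" "of_order (jet_dom c) r (g c)"
      using finite_order_common[OF B f(2) g(2) finite_order_zero[OF B]] c by metis
    then show "agree (jet_dom c) (insert_density s (bracket_density (f c) (g c))) (\<lambda>w z. ?a * ?X c w z + ?b * ?Y c w z)"
      by (intro open_jets.insert_bracket[OF chart_open_jets[OF B c] assms(2)] f(3) g(3) c)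
  qed
  also have "\<dots> = var_plus B (var_scale B ?a (schouten B \<xi> (insertion B s \<eta>))) (var_scale B ?b (schouten B (insertion B s \<xi>) \<eta>))"
    unfolding f(1) g(1)
    by (simp only: insertion_class[OF B] schouten_class[OF B] var_scale_class[OF B] var_plus_class[OF B] fin X Y scaled)
  finally show ?thesis .
qed

end
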